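(* For every chain $S_\bullet\in\mathcal C_{d+1}$ define \[ \alpha(S_\bullet)=\sum_{D}\operatorname{Tdcoeff}(D)\,\operatorname{Binom}(D)\,\operatorname{sgn}(D)\,\operatorname{wt}(D), \] the sum over all spider diagrams $D$ on the chain $S_\bullet$ (i.e. whose underlying set of vertices is the set of elements of $S_\bullet$, with arbitrary head chain). Then in $A_d$ \[ \operatorname{Td}(X_d)=\sum_{S_\bullet\in\mathcal C_{d+1}}\alpha(S_\bullet)\,x_{S_\bullet}, \] and $\alpha(S_\bullet)=\alpha^{\mathrm{BV}}(\sigma_{S_\bullet})$ for every $S_\bullet\in\mathcal C_{d+1}$.
   Context: $[d+1]=\{1,\dots,d+1\}$; $\overline{\mathcal B}_{d+1}$ is the set of subsets of $[d+1]$ other than $\emptyset$, $[d+1]$; $\mathcal C_{d+1}$ is the set of chains $S_\bullet=(S_1\subsetneq\cdots\subsetneq S_k)$ in $\overline{\mathcal B}_{d+1}$, $k\ge0$. $A_d=R_d/(I_1+I_2)$ with $R_d=\mathbb Q[x_S:S\in\overline{\mathcal B}_{d+1}]$, $I_1=\langle x_Sx_{S'}:S,S'$ incomparable$\rangle$, $I_2=\langle\ell_a-\ell_b:a,b\in[d+1]\rangle$, $\ell_i=\sum_{S\ni i}x_S$ — the rational Chow ring of the permutohedral variety $X_d$ (toric variety of the braid fan in $\mathbb R^{d+1}/\mathbb R\mathbf 1$ with cones $\sigma_{S_\bullet}=\operatorname{Cone}(\bm e_S:S\in S_\bullet)$, $\bm e_S=\sum_{i\in S}\bm e_i$), where $x_{S_\bullet}=\prod_{S\in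 S_\bullet}x_S$ represents $[V(\sigma_{S_\bullet})]$. Write $\frac{x}{1-e^{-x}}=\sum_{n\ge0}c_nx^n=1+\frac x2+\frac{x^2}{12}-\frac{x^4}{720}+\cdots$; $\operatorname{Td}(X_d)=\prod_{S\in\overline{\mathcal B}_{d+1}}\sum_n c_nx_S^n$ (finite in $A_d$). $\alpha^{\mathrm{BV}}$ is the Berline–Vergne function on rational cones (their local Euler–Maclaurin/Danilov function built from the standard inner product). Spider diagrams: for a chain $T_\bullet=(T_1\subsetneq\cdots\subsetneq T_n)$, a spider diagram $D$ on $T_\bullet$ is a partition of $\{T_1,\dots,T_n\}$ into nonempty consecutive intervals $A_1,\dots,A_k$ with a head $S_i\in A_i$ chosen in each; set $S_0=\emptyset$, $S_{k+1}=[d+1]$. Left legs of spider $i$: elements of $A_i$ strictly inside $S_i$, listed $T^L_{i,1}\subsetneq\cdots\subsetneq T^L_{i,p_i}$; right legs: elements strictly containing $S_i$, listed $T^R_{i,1}\supsetneq\cdots\supsetneq T^R_{i,q_i}$; if $p_i=0$ put $T^L_{i,1}:=S_i$, if $q_i=0$ put $T^R_{i,1}:=S_i$; $T^R_{0,1}:=\emptyset$, $T^L_{k+1,1}:=[d+1]$. With $|B\setminus A|$ the cardinality of a difference: $\operatorname{wt}(\mathrm{Sp}_i)=\prod_{j=2}^{p_i}\frac{|T^L_{i,j}\setminus T^L_{i,j-1}|}{|S_i\setminus T^L_{i,j-1}|}\prod_{j=2}^{q_i}\frac{|T^R_{i,j-1}\setminus T^R_{i,j}|}{|T^R_{i,j-1}\setminus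 S_i|}$, $\operatorname{bdwt}(D)=\prod_{i=1}^{k+1}\frac{|T^L_{i,1}\setminus T^R_{i-1,1}|}{|S_i\setminus S_{i-1}|}$, $\operatorname{wt}(D)=\operatorname{bdwt}(D)\prod_{i=1}^k\operatorname{wt}(\mathrm{Sp}_i)$, $\operatorname{sgn}(D)=(-1)^{\sum_i(|A_i|-1)}$, $\operatorname{Binom}(D)=\prod_{i=1}^k\binom{p_i+q_i}{p_i}$, and $\operatorname{Tdcoeff}(D)=\prod_{i=1}^k c_{|A_i|}$ (the coefficient of $\prod_i x_{S_i}^{|A_i|}$ in the expansion of $\operatorname{Td}(X_d)$). For the empty chain the unique (empty) diagram contributes $1$. *)

theory Defs
  imports
    "HOL-Analysis.Analysis"
    "HOL-Algebra.QuotRing"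
    "HOL-Library.Poly_Mapping"
    "HOL-Computational_Algebra.Formal_Power_Series"
begin

section \<open>Chains and spider diagrams\<close>

text \<open>
  The ground set \<open>[d+1]\<close> is the universe of an arbitrary finite type \<open>'n\<close>, so that
  \<open>d + 1 = CARD('n)\<close> and \<open>\<real>\<^sup>d\<^sup>+\<^sup>1\<close> is the type \<open>real ^ 'n\<close>.
\<close>

definition proper_subsets :: "'n set set" where
  "proper_subsets = {S. S \<noteq> {} \<and> S \<noteq> UNIV}"

text \<open>A chain is the list of its members in increasing order.\<close>

definition chains_of_subsets :: "'n set list set" where
  "chains_of_subsets = {Ts. sorted_wrt (\<subset>) Ts \<and> set Ts \<subseteq> proper_subsets}"

text \<open>
  In \<open>(Ls, S, Rs)\<close> the head is \<open>S\<close>, the left legs \<open>Ls\<close> are listed increasingly and the right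
  legs \<open>Rs\<close> decreasingly, i.e. both from the outermost leg towards the head.
\<close>

type_synonym 'n spider = "'n set list \<times> 'n set \<times> 'n set list"

fun left_legs :: "'n spider \<Rightarrow> 'n set list" where "left_legs (Ls, S, Rs) = Ls"
fun head :: "'n spider \<Rightarrow> 'n set" where "head (Ls, S, Rs) = S"
fun right_legs :: "'n spider \<Rightarrow> 'n set list" where "right_legs (Ls, S, Rs) = Rs"

definition vertices :: "'n spider \<Rightarrow> 'n set list" where
  "vertices s = left_legs s @ [head s] @ rev (right_legs s)"

text \<open>
  A partition of a chain into nonempty consecutive intervals with a chosen head in each is a way of
  writing the chain as a concatenation of vertex lists of spiders.
\<close>

definition spider_diagrams :: "'n set list \<Rightarrow> 'n spider list set" where
  "spider_diagrams Ts = {D. concat (map vertices D) = Ts}"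

definition first_left :: "'n spider \<Rightarrow> 'n set" where
  "first_left s = (if left_legs s = [] then head s else hd (left_legs s))"

definition first_right :: "'n spider \<Rightarrow> 'n set" where
  "first_right s = (if right_legs s = [] then head s else hd (right_legs s))"

definition diff_ratio :: "'n::finite set \<Rightarrow> 'n set \<Rightarrow> 'n set \<Rightarrow> 'n set \<Rightarrow> rat" where
  "diff_ratio B A S T = of_nat (card (B - A)) / of_nat (card (S - T))"

definition spider_wt :: "'n::finite spider \<Rightarrow> rat" where
  "spider_wt s =
     (let L = left_legs s; R = right_legs s; S = head s in
      (\<Prod>j\<in>{1..<length L}. diff_ratio (L ! j) (L ! (j - 1)) S (L ! (j - 1))) *
      (\<Prod>j\<in>{1..<length R}. diff_ratio (R ! (j - 1)) (R ! j) (R ! (j - 1)) S))"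

text \<open>
  The legless spiders with heads \<open>{}\<close> and \<open>UNIV\<close> added at the two ends implement the conventions
  for the indices \<open>0\<close> and \<open>k + 1\<close>.
\<close>

definition boundary_wt :: "'n::finite spider list \<Rightarrow> rat" where
  "boundary_wt D =
     (let E = ([], {}, []) # D @ [([], UNIV, [])] in
      \<Prod>i\<in>{1..length D + 1}.
        diff_ratio (first_left (E ! i)) (first_right (E ! (i - 1))) (head (E ! i)) (head (E ! (i - 1))))"

definition diagram_wt :: "'n::finite spider list \<Rightarrow> rat" where
  "diagram_wt D = boundary_wt D * (\<Prod>s\<leftarrow>D. spider_wt s)"

definition diagram_sgn :: "'n spider list \<Rightarrow> rat" where
  "diagram_sgn D = (- 1) ^ (\<Sum>s\<leftarrow>D. length (vertices s) - 1)"

definition diagram_binom :: "'n spider list \<Rightarrow> rat" where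
  "diagram_binom D =
     (\<Prod>s\<leftarrow>D. of_nat ((length (left_legs s) + length (right_legs s)) choose length (left_legs s)))"

text \<open>The coefficients of \<open>x / (1 - e\<^sup>-\<^sup>x)\<close>.\<close>

definition todd_coeff :: "nat \<Rightarrow> rat" where
  "todd_coeff n = fps_nth (fps_X / (1 - fps_exp (- 1))) n"

definition diagram_todd :: "'n spider list \<Rightarrow> rat" where
  "diagram_todd D = (\<Prod>s\<leftarrow>D. todd_coeff (length (vertices s)))"

definition alpha :: "'n::finite set list \<Rightarrow> rat" where
  "alpha Ts = (\<Sum>D\<in>spider_diagrams Ts.
     diagram_todd D * diagram_binom D * diagram_sgn D * diagram_wt D)"


section \<open>The Chow ring of the permutohedral variety\<close>

text \<open>
  A polynomial in variables indexed by sets is a finitely supported function from monomials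
  (finitely supported exponent functions) to coefficients, multiplied by convolution.
\<close>

type_synonym 'n set_poly = "('n set \<Rightarrow>\<^sub>0 nat) \<Rightarrow>\<^sub>0 rat"

definition var :: "'n set \<Rightarrow> 'n set_poly" where
  "var S = Poly_Mapping.single (Poly_Mapping.single S 1) 1"

definition const :: "rat \<Rightarrow> 'n set_poly" where
  "const c = Poly_Mapping.single 0 c"

definition poly_ring :: "'n set_poly ring" where
  "poly_ring = \<lparr>carrier = {p. \<forall>m\<in>Poly_Mapping.keys p. Poly_Mapping.keys m \<subseteq> proper_subsets},
     monoid.mult = (*), one = 1, zero = 0, add = (+)\<rparr>"

definition incomparable_ideal :: "'n set_poly set" where
  "incomparable_ideal = genideal poly_ring
     {var S * var T | S T. S \<in> proper_subsets \<and> T \<in> proper_subsets \<and> \<not> S \<subseteq> T \<and> \<not> T \<subseteq> S}"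

definition linear_form :: "'n::finite \<Rightarrow> 'n set_poly" where
  "linear_form i = (\<Sum>S | S \<in> proper_subsets \<and> i \<in> S. var S)"

definition linear_ideal :: "'n::finite set_poly set" where
  "linear_ideal = genideal poly_ring {linear_form a - linear_form b | a b. True}"

definition chow_ideal :: "'n::finite set_poly set" where
  "chow_ideal = set_add poly_ring incomparable_ideal linear_ideal"

definition chow_ring :: "'n::finite set_poly set ring" where
  "chow_ring = FactRing poly_ring chow_ideal"

definition chow_class :: "'n::finite set_poly \<Rightarrow> 'n set_poly set" where
  "chow_class p = a_r_coset poly_ring chow_ideal p"

text \<open>
  The series \<open>\<Sum>n. c\<^sub>n x\<^sub>S\<^sup>n\<close> is a finite sum in the Chow ring because \<open>x\<^sub>S\<close> is nilpotent there;
  it is summed over those \<open>n\<close> for which \<open>x\<^sub>S\<^sup>n\<close> does not vanish in the quotient.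
\<close>

definition todd_class :: "'n::finite set_poly set" where
  "todd_class = chow_class
     (\<Prod>S\<in>proper_subsets. \<Sum>n | var S ^ n \<notin> chow_ideal. const (todd_coeff n) * var S ^ n)"

definition chain_monomial :: "'n set list \<Rightarrow> 'n set_poly" where
  "chain_monomial Ts = (\<Prod>S\<in>set Ts. var S)"


section \<open>The Berline-Vergne function\<close>

definition lattice_basis :: "(real ^ 'n) set \<Rightarrow> (real ^ 'n) set \<Rightarrow> bool" where
  "lattice_basis \<Lambda> B \<longleftrightarrow>
     independent B \<and> \<Lambda> = {\<Sum>b\<in>B. of_int (k b) *\<^sub>R b | k :: real ^ 'n \<Rightarrow> int. True}"

definition rational_cone :: "(real ^ 'n) set \<Rightarrow> (real ^ 'n) set \<Rightarrow> bool" where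
  "rational_cone \<Lambda> C \<longleftrightarrow>
     (\<exists>B. lattice_basis \<Lambda> B) \<and> (\<exists>G. finite G \<and> G \<subseteq> \<Lambda> \<and> C = convex_cone hull G)"

definition lineality :: "(real ^ 'n) set \<Rightarrow> (real ^ 'n) set" where
  "lineality C = {x \<in> C. - x \<in> C}"

text \<open>Lebesgue measure on \<open>span \<Lambda>\<close>, normalised so that a fundamental domain of \<open>\<Lambda>\<close> has measure 1.\<close>

definition lattice_measure :: "(real ^ 'n) set \<Rightarrow> (real ^ 'n) measure" where
  "lattice_measure \<Lambda> =
     (let B = (SOME B. lattice_basis \<Lambda> B)
      in distr (Pi\<^sub>M B (\<lambda>_. lborel)) borel (\<lambda>t. \<Sum>b\<in>B. t b *\<^sub>R b))"

definition cone_sum :: "(real ^ 'n) set \<Rightarrow> (real ^ 'n) set \<Rightarrow> real ^ 'n \<Rightarrow> real" where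
  "cone_sum \<Lambda> C \<xi> = (\<Sum>\<^sub>\<infinity>x\<in>C \<inter> \<Lambda>. exp (\<xi> \<bullet> x))"

definition cone_integral :: "(real ^ 'n) set \<Rightarrow> (real ^ 'n) set \<Rightarrow> real ^ 'n \<Rightarrow> real" where
  "cone_integral \<Lambda> F \<xi> = (LINT x:F|lattice_measure (\<Lambda> \<inter> span F). exp (\<xi> \<bullet> x))"

text \<open>For a pointed rational cone these are the \<open>\<xi>\<close> at which the sum and the integrals converge.\<close>

definition convergence_domain :: "(real ^ 'n) set \<Rightarrow> (real ^ 'n) set" where
  "convergence_domain C = {\<xi>. \<forall>x\<in>C. x \<noteq> 0 \<longrightarrow> \<xi> \<bullet> x < 0}"

text \<open>Orthogonal projection onto the orthogonal complement of a subspace.\<close>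

definition perp_proj :: "(real ^ 'n) set \<Rightarrow> real ^ 'n \<Rightarrow> real ^ 'n" where
  "perp_proj L x = (THE y. y \<in> L\<^sup>\<bottom> \<and> x - y \<in> L)"

definition analytic_at_0 :: "(real ^ 'n \<Rightarrow> real) \<Rightarrow> bool" where
  "analytic_at_0 g \<longleftrightarrow> (\<exists>a :: ('n \<Rightarrow> nat) \<Rightarrow> real. \<exists>r>0. \<forall>\<xi>\<in>ball 0 r.
     ((\<lambda>k. a k * (\<Prod>i\<in>UNIV. (\<xi> $ i) ^ k i)) has_sum g \<xi>) UNIV)"

text \<open>
  \<open>BV \<Lambda> C g\<close>: the germ at 0 of \<open>g\<close> is the Berline-Vergne function \<open>\<mu>(C)\<close> of the cone \<open>C\<close> with
  respect to the lattice \<open>\<Lambda>\<close>. The inner product identifies the quotient of the ambient space by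
  \<open>span F\<close> with \<open>(span F)\<^sup>\<bottom>\<close>, a space with its dual, and extends functions on the dual of the quotient
  by orthogonal projection. The local Euler-Maclaurin identity
    \<open>S(C)(\<xi>) = (\<Sum>F. \<mu>(C/F)(\<xi>) I(F)(\<xi>))\<close>,
  with the sum over the nonempty faces \<open>F\<close> of the pointed cone \<open>C\<close>, determines \<open>\<mu>(C)\<close> recursively: the
  summand at the vertex \<open>F = {0}\<close> is \<open>\<mu>(C)(\<xi>)\<close> itself, and the transverse cones \<open>C/F\<close> at the other
  faces have smaller dimension. As sum and integrals agree with their meromorphic continuations on
  the convergence domain, which is open, it is enough to have the identity there.
\<close>

inductive BV :: "(real ^ 'n) set \<Rightarrow> (real ^ 'n) set \<Rightarrow> (real ^ 'n \<Rightarrow> real) \<Rightarrow> bool" where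
  BV_line: "rational_cone \<Lambda> C \<Longrightarrow> lineality C \<noteq> {0} \<Longrightarrow> BV \<Lambda> C (\<lambda>_. 0)"
| BV_pointed: "rational_cone \<Lambda> C \<Longrightarrow> lineality C = {0} \<Longrightarrow> analytic_at_0 g \<Longrightarrow>
    (\<And>F. F face_of C \<Longrightarrow> F \<noteq> {} \<Longrightarrow> F \<noteq> {0} \<Longrightarrow>
       BV (perp_proj (span F) ` \<Lambda>) (perp_proj (span F) ` C) (h F)) \<Longrightarrow>
    (\<forall>\<^sub>F \<xi> in at 0 within convergence_domain C.
       cone_sum \<Lambda> C \<xi> = g \<xi> +
         (\<Sum>F | F face_of C \<and> F \<noteq> {} \<and> F \<noteq> {0}.
            h F (perp_proj (span F) \<xi>) * cone_integral \<Lambda> F \<xi>)) \<Longrightarrow>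
    BV \<Lambda> C g"

text \<open>
  For a lattice \<open>M\<close>, a cone \<open>\<sigma>\<close> in the dual space is given by a set of representatives, since vectors
  having the same inner product with every element of \<open>M\<close> define the same functional. The value
  attached to \<open>\<sigma>\<close> (the normal cone of a face of a polytope in \<open>span M\<close>) is the constant term of
  \<open>\<mu>\<close> at the transverse cone of that face, i.e. at the dual cone of \<open>\<sigma>\<close> modulo its lineality space.
\<close>

definition dual_cone :: "(real ^ 'n) set \<Rightarrow> (real ^ 'n) set \<Rightarrow> (real ^ 'n) set" where
  "dual_cone M \<sigma> = {m \<in> span M. \<forall>v\<in>\<sigma>. 0 \<le> m \<bullet> v}"

definition alpha_BV :: "(real ^ 'n) set \<Rightarrow> (real ^ 'n) set \<Rightarrow> real" where
  "alpha_BV M \<sigma> =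
     (let C = dual_cone M \<sigma>; p = perp_proj (lineality C)
      in THE a. \<exists>g. BV (p ` M) (p ` C) g \<and> g 0 = a)"

text \<open>
  The character lattice of the torus of \<open>X\<^sub>d\<close>, and the cone \<open>\<sigma>\<close> of a chain in \<open>\<real>\<^sup>d\<^sup>+\<^sup>1 / \<real>1\<close>, represented
  by its preimage in \<open>\<real>\<^sup>d\<^sup>+\<^sup>1\<close>.
\<close>

definition root_lattice :: "(real ^ 'n) set" where
  "root_lattice = {m. (\<forall>i. m $ i \<in> \<int>) \<and> (\<Sum>i\<in>UNIV. m $ i) = 0}"

definition subset_vec :: "'n set \<Rightarrow> real ^ 'n" where
  "subset_vec S = (\<chi> i. if i \<in> S then 1 else 0)"

definition braid_cone :: "'n set list \<Rightarrow> (real ^ 'n) set" where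
  "braid_cone Ts =
     {v + t *\<^sub>R subset_vec UNIV | v t. v \<in> convex_cone hull (subset_vec ` set Ts)}"

end

theory Submission
  imports Defs
begin

text \<open>
  Let \<open>A\<close> and \<open>B\<close> be the neighbours of \<open>S\<close> in a chain \<open>J\<close>. Multiplying \<open>x\<^sub>J\<close> by the linear relation of
  the functional \<open>e\<^sub>S\<^sub>-\<^sub>A / |S - A| - e\<^sub>B\<^sub>-\<^sub>S / |B - S|\<close> expresses \<open>x\<^sub>S x\<^sub>J\<close> through the monomials of the
  chains obtained by inserting one set between \<open>A\<close> and \<open>S\<close> or between \<open>S\<close> and \<open>B\<close>. Iterating this
  attaches legs to \<open>S\<close>, the outermost ones first, so that every power product with support a chain of
  heads becomes a sum over spider diagrams; the binomial coefficients count the orders in which the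
  left and the right legs of a spider may be attached, and the fractions at the boundaries telescope.

  For the Berline-Vergne function, the transverse cone belonging to a chain is unimodular, spanned by
  the basis dual to the vectors \<open>e\<^sub>S\<close>, and its quotients by faces are the cones of the subchains. In
  the coordinates \<open>y\<^sub>S\<close> of the cone the local Euler-Maclaurin formula becomes
  \<open>\<Prod> y\<^sub>S / (1 - exp (-y\<^sub>S)) = (\<Sum>K. (\<Prod>S\<in>K. y\<^sub>S) \<mu>\<^sub>K)\<close>, where \<open>\<mu>\<^sub>K\<close> only depends on the orthogonal projection
  to the space of \<open>K\<close>. The same reduction, with the linear form of the functional above in place of
  the relation, rewrites the left hand side in this shape. At the origin the linear forms vanish and
  the reduction is that of the Chow ring, so that \<open>\<mu>\<^sub>K(0)\<close> is the same sum over spider diagrams.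
  Uniqueness of \<open>\<mu>\<^sub>K\<close> follows by induction from the identity theorem for power series.
\<close>

section \<open>The reduction operator\<close>

text \<open>The reduction has to act both in a quotient ring and on functions of xi. It is therefore
  carried out on bare coefficient tuples and interpreted only afterwards, by \<open>Phi\<close> as a
  polynomial and by \<open>ev J\<close> as a number. In both readings \<open>step\<close> is
  multiplication by the variable of S on tuples supported on sets containing S, up to the ideal in
  the first case. A head already divides the monomial, so the series applied to it is the Todd
  series without its constant term, divided by the variable; hence the coefficients
  \<open>c (Suc n)\<close>.

  Heads are processed from the smallest to the largest. This makes the intermediate weights
  asymmetric: right legs are measured against the next bare head, left legs against the finished
  spider below. Only the product of the two is the symmetric boundary weight.

  With vanishing linear forms the operator is nilpotent and all sums are finite. With the true
  linear forms it is not, and analyticity needs a norm on tuples in which \<open>step\<close> is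
  smaller than the radius of convergence of the Todd series. A separate obstacle is
  \<open>lattice_measure\<close>, which rests on a chosen basis: its independence of the choice has
  to precede any integral.\<close>

definition pred_in :: "'n set \<Rightarrow> 'n set set \<Rightarrow> 'n set" where
  "pred_in S J = \<Union>{K\<in>J. K \<subset> S}"

text \<open>For a chain, \<open>pred_in\<close> and \<open>succ_in\<close> give the neighbours of S.
  The empty union and the empty intersection supply the conventions \<open>{}\<close> below the
  first and \<open>UNIV\<close> above the last member.\<close>

definition succ_in :: "'n set \<Rightarrow> 'n set set \<Rightarrow> 'n set" where
  "succ_in S J = \<Inter>{K\<in>J. S \<subset> K}"

text \<open>The value at e_s of the functional of the overview, for s outside J and comparable with
  all of J. It is linear in \<open>card s\<close> on either side of S, rising from 0 at the lower
  neighbour to 1 at S and falling back to 0 at the upper one. The scalars are left open: rational in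
  the Chow ring, real in the analytic part.\<close>

definition tent :: "'n::finite set \<Rightarrow> 'n set set \<Rightarrow> 'n set \<Rightarrow> 'a::field_char_0" where
  "tent S J s =
    (if pred_in S J \<subset> s \<and> s \<subset> S then of_nat (card (s - pred_in S J)) / of_nat (card (S - pred_in S J))
     else if S \<subset> s \<and> s \<subset> succ_in S J then of_nat (card (succ_in S J - s)) / of_nat (card (succ_in S J - S))
     else 0)"

text \<open>
  A tuple \<open>V\<close> stands for the sum of the \<open>V J * x\<^sub>J\<close>, and \<open>step l S\<close> for multiplication by \<open>x\<^sub>S\<close>, where
  \<open>l S J\<close> is the value of the linear form of \<open>S\<close> in \<open>J\<close>; this value is \<open>0\<close> in the Chow ring.
\<close>

definition step :: "('n::finite set \<Rightarrow> 'n set set \<Rightarrow> 'a::field_char_0) \<Rightarrow> 'n set \<Rightarrow>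
    ('n set set \<Rightarrow> 'a) \<Rightarrow> 'n set set \<Rightarrow> 'a" where
  "step l S V J =
    (if S \<in> J then l S J * V J - (\<Sum>s\<in>J - {S}. tent S (J - {s}) s * V (J - {s})) else 0)"

abbreviation step0 :: "'n::finite set \<Rightarrow> ('n set set \<Rightarrow> 'a::field_char_0) \<Rightarrow> 'n set set \<Rightarrow> 'a" where
  "step0 \<equiv> step (\<lambda>_ _. 0)"

definition delta :: "'b \<Rightarrow> 'b \<Rightarrow> 'a::zero_neq_one" where
  "delta J K = (if K = J then 1 else 0)"

lemma step_sum:
  "step l S (\<lambda>K. \<Sum>i\<in>I. c i * V i K) J = (\<Sum>i\<in>I. c i * step l S (V i) J)"
proof (cases "S \<in> J")
  case True
  have "(\<Sum>s\<in>J - {S}. tent S (J - {s}) s * (\<Sum>i\<in>I. c i * V i (J - {s})))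
      = (\<Sum>i\<in>I. c i * (\<Sum>s\<in>J - {S}. tent S (J - {s}) s * V i (J - {s})))"
    by (simp add: sum_distrib_left, subst sum.swap) (simp add: algebra_simps)
  then show ?thesis
    using True by (simp add: step_def sum_distrib_left sum_subtractf algebra_simps)
next
  case False
  then show ?thesis by (simp add: step_def)
qed

lemma step_power_sum:
  "(step l S ^^ m) (\<lambda>K. \<Sum>i\<in>I. c i * V i K) J = (\<Sum>i\<in>I. c i * (step l S ^^ m) (V i) J)"
proof (induction m arbitrary: J)
  case (Suc m)
  have "(step l S ^^ m) (\<lambda>K. \<Sum>i\<in>I. c i * V i K) = (\<lambda>K. \<Sum>i\<in>I. c i * (step l S ^^ m) (V i) K)"
    using Suc by blast
  then show ?case by (simp add: step_sum)
qed simp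

text \<open>\<open>step\<close> says what the coefficient at K receives from the sets K - {s}.
  Reductions are easier to follow in this transposed form, where x_J sends a multiple to each set
  obtained from J by one insertion.\<close>

lemma step0_delta:
  fixes S :: "'n::finite set"
  assumes "S \<in> J"
  shows "(step0 S (delta J) K :: 'a::field_char_0) = (\<Sum>s\<in>- J. - tent S J s * delta (insert s J) K)"
proof (cases "\<exists>s0. s0 \<notin> J \<and> K = insert s0 J")
  case True
  then obtain s0 where s0: "s0 \<notin> J" "K = insert s0 J" by blast
  have ne: "s0 \<noteq> S" using s0 assms by blast
  have eq: "(K - {s} = J) = (s = s0)" if "s \<in> K - {S}" for s
    using s0 that by blast
  have "(\<Sum>s\<in>K - {S}. tent S (K - {s}) s * delta J (K - {s})) =
        (\<Sum>s\<in>K - {S}. if s = s0 then tent S J s0 else (0::'a))"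
    using s0 by (intro sum.cong) (auto simp: delta_def eq)
  also have "\<dots> = tent S J s0" using s0 ne by simp
  finally have L: "step0 S (delta J) K = - (tent S J s0 :: 'a)"
    using assms s0 by (simp add: step_def)
  have "(\<Sum>s\<in>- J. - tent S J s * delta (insert s J) K) =
      (\<Sum>s\<in>- J. if s = s0 then - tent S J s0 else (0::'a))"
    using s0 by (intro sum.cong) (auto simp: delta_def)
  also have "\<dots> = - tent S J s0" using s0 by simp
  finally show ?thesis using L by simp
next
  case False
  have "delta J (K - {s}) = (0::'a)" if "s \<in> K - {S}" for s
    using False that by (auto simp: delta_def)
  moreover have "delta (insert s J) K = (0::'a)" if "s \<in> - J" for s
    using False that by (auto simp: delta_def)
  ultimately show ?thesis by (simp add: step_def)
qed

section \<open>Attaching the legs of a single head\<close>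

definition gap :: "'n set \<Rightarrow> 'n set \<Rightarrow> 'n set \<Rightarrow> 'n set set \<Rightarrow> bool" where
  "gap A S B J \<longleftrightarrow> A \<subset> S \<and> S \<subset> B \<and> S \<in> J \<and> (A \<in> J \<or> A = {}) \<and> (B \<in> J \<or> B = UNIV) \<and>
     (\<forall>K\<in>J. K \<subseteq> A \<or> K = S \<or> B \<subseteq> K)"

lemma gap_pred: "gap A S B J \<Longrightarrow> pred_in S J = A"
  unfolding gap_def pred_in_def by blast

lemma gap_succ: "gap A S B J \<Longrightarrow> succ_in S J = B"
  unfolding gap_def succ_in_def by blast

lemma gap_left: "gap A S B J \<Longrightarrow> A \<subset> l \<Longrightarrow> l \<subset> S \<Longrightarrow> gap l S B (insert l J)"
  unfolding gap_def by blast

lemma gap_right: "gap A S B J \<Longrightarrow> S \<subset> r \<Longrightarrow> r \<subset> B \<Longrightarrow> gap A S r (insert r J)"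
  unfolding gap_def by blast

definition between :: "'n set \<Rightarrow> 'n set \<Rightarrow> 'n set set" where
  "between A B = {s. A \<subset> s \<and> s \<subset> B}"

lemma step0_gap:
  fixes S :: "'n::finite set"
  assumes g: "gap A S B J"
  shows "(step0 S (delta J) K :: 'a::field_char_0) =
    (\<Sum>l\<in>between A S. - (of_nat (card (l - A)) / of_nat (card (S - A))) * delta (insert l J) K) +
    (\<Sum>r\<in>between S B. - (of_nat (card (B - r)) / of_nat (card (B - S))) * delta (insert r J) K)"
proof -
  have S: "S \<in> J" using g by (simp add: gap_def)
  have sub: "between A S \<union> between S B \<subseteq> - J"
    using g by (auto simp: gap_def between_def)
  have dis: "between A S \<inter> between S B = {}" by (auto simp: between_def)
  have "step0 S (delta J) K = (\<Sum>s\<in>between A S \<union> between S B. - tent S J s * delta (insert s J) K)"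
    unfolding step0_delta[OF S]
    by (rule sum.mono_neutral_right) (use sub in \<open>auto simp: tent_def gap_pred[OF g] gap_succ[OF g] between_def\<close>)
  also have "\<dots> = (\<Sum>s\<in>between A S. - tent S J s * delta (insert s J) K) +
      (\<Sum>s\<in>between S B. - tent S J s * delta (insert s J) K)"
    using dis by (intro sum.union_disjoint) auto
  also have "\<dots> = (\<Sum>l\<in>between A S. - (of_nat (card (l - A)) / of_nat (card (S - A))) * delta (insert l J) K) +
    (\<Sum>r\<in>between S B. - (of_nat (card (B - r)) / of_nat (card (B - S))) * delta (insert r J) K)"
    by (intro arg_cong2[where f="(+)"] sum.cong)
      (auto simp: tent_def gap_pred[OF g] gap_succ[OF g] between_def)
  finally show ?thesis .
qed

text \<open>Attaching l replaces the lower neighbour A by l and leaves the upper one alone. So the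
  left factors do not see the right legs, and all interleavings of two given leg lists carry the
  same weight.\<close>

fun left_wt :: "'n::finite set \<Rightarrow> 'n set \<Rightarrow> 'n set list \<Rightarrow> 'a::field_char_0" where
  "left_wt A S [] = 1"
| "left_wt A S (l # L) = of_nat (card (l - A)) / of_nat (card (S - A)) * left_wt l S L"

fun right_wt :: "'n::finite set \<Rightarrow> 'n set \<Rightarrow> 'n set list \<Rightarrow> 'a::field_char_0" where
  "right_wt B S [] = 1"
| "right_wt B S (r # R) = of_nat (card (B - r)) / of_nat (card (B - S)) * right_wt r S R"

definition lleg_lists :: "'n set \<Rightarrow> 'n set \<Rightarrow> 'n set list set" where
  "lleg_lists A S = {L. sorted_wrt (\<subset>) L \<and> set L \<subseteq> between A S}"

definition rleg_lists :: "'n set \<Rightarrow> 'n set \<Rightarrow> 'n set list set" where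
  "rleg_lists B S = {R. sorted_wrt (\<supset>) R \<and> set R \<subseteq> between S B}"

lemma Nil_lleg [simp]: "[] \<in> lleg_lists A S" by (simp add: lleg_lists_def)
lemma Nil_rleg [simp]: "[] \<in> rleg_lists B S" by (simp add: rleg_lists_def)

lemma Cons_lleg [simp]: "l # L \<in> lleg_lists A S \<longleftrightarrow> l \<in> between A S \<and> L \<in> lleg_lists l S"
  unfolding lleg_lists_def between_def by (simp, blast)

lemma Cons_rleg [simp]: "r # R \<in> rleg_lists B S \<longleftrightarrow> r \<in> between S B \<and> R \<in> rleg_lists r S"
  unfolding rleg_lists_def between_def by (simp, blast)

lemma finite_sorted_subset:
  fixes r :: "'a::finite \<Rightarrow> 'a \<Rightarrow> bool"
  assumes "irreflp r"
  shows "finite {L. sorted_wrt r L}"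
proof -
  have "distinct L" if "sorted_wrt r L" for L
    using that assms by (induction L) (auto simp: irreflp_def)
  then have "{L. sorted_wrt r L} \<subseteq> {L. set L \<subseteq> UNIV \<and> length L \<le> card (UNIV :: 'a set)}"
    by (auto intro: order_trans[OF eq_refl[OF distinct_card[symmetric]] card_mono])
  then show ?thesis by (rule finite_subset) (rule finite_lists_length_le, simp)
qed

lemma finite_lleg [simp]: "finite (lleg_lists A (S :: 'n::finite set))"
  by (rule finite_subset[OF _ finite_sorted_subset[of "(\<subset>)"]]) (auto simp: lleg_lists_def irreflp_def)

lemma finite_rleg [simp]: "finite (rleg_lists A (S :: 'n::finite set))"
  by (rule finite_subset[OF _ finite_sorted_subset[of "(\<supset>)"]]) (auto simp: rleg_lists_def irreflp_def)

definition leg_pairs :: "nat \<Rightarrow> 'n set \<Rightarrow> 'n set \<Rightarrow> 'n set \<Rightarrow> ('n set list \<times> 'n set list) set" where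
  "leg_pairs m A S B = {(L, R). L \<in> lleg_lists A S \<and> R \<in> rleg_lists B S \<and> length L + length R = m}"

lemma finite_leg_pairs [simp]: "finite (leg_pairs m A (S :: 'n::finite set) B)"
  by (rule finite_subset[of _ "lleg_lists A S \<times> rleg_lists B S"]) (auto simp: leg_pairs_def)

text \<open>\<open>m choose length L\<close> counts the interleavings of the two lists. The outcome
  enters through a function f of the set of legs, so that a recursion can absorb an attached leg
  into f.\<close>

definition legs_sum :: "nat \<Rightarrow> 'n::finite set \<Rightarrow> 'n set \<Rightarrow> 'n set \<Rightarrow> ('n set set \<Rightarrow> 'a) \<Rightarrow> 'a::field_char_0" where
  "legs_sum m A S B f = (\<Sum>(L, R)\<in>leg_pairs m A S B.
     of_nat (m choose length L) * left_wt A S L * right_wt B S R * f (set L \<union> set R))"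

text \<open>Split off the outermost left or the outermost right leg; this is Pascal's rule.\<close>

lemma legs_sum_Suc:
  fixes S :: "'n::finite set" and f :: "'n set set \<Rightarrow> 'a::field_char_0"
  shows "legs_sum (Suc m) A S B f =
    (\<Sum>l\<in>between A S. of_nat (card (l - A)) / of_nat (card (S - A)) * legs_sum m l S B (\<lambda>X. f (insert l X))) +
    (\<Sum>r\<in>between S B. of_nat (card (B - r)) / of_nat (card (B - S)) * legs_sum m A S r (\<lambda>X. f (insert r X)))"
    (is "_ = ?L + ?R")
proof -
  let ?t = "\<lambda>p. left_wt A S (fst p) * right_wt B S (snd p) * f (set (fst p) \<union> set (snd p)) :: 'a"
  let ?P = "leg_pairs (Suc m) A S B"
  have "?L = (\<Sum>(l, p)\<in>Sigma (between A S) (\<lambda>l. leg_pairs m l S B).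
      of_nat (m choose length (fst p)) * ?t (l # fst p, snd p))"
    unfolding legs_sum_def
    by (subst sum.Sigma[symmetric]) (auto simp: sum_distrib_left algebra_simps case_prod_unfold)
  also have "\<dots> = (\<Sum>p\<in>{p\<in>?P. fst p \<noteq> []}. of_nat (m choose (length (fst p) - 1)) * ?t p)"
    by (rule sum.reindex_bij_witness[where i="\<lambda>p. (hd (fst p), (tl (fst p), snd p))"
          and j="\<lambda>(l, p). (l # fst p, snd p)"])
      (auto simp: leg_pairs_def neq_Nil_conv)
  also have "\<dots> = (\<Sum>p\<in>?P. (if fst p \<noteq> [] then of_nat (m choose (length (fst p) - 1)) * ?t p else 0))"
    by (simp add: sum.inter_filter[symmetric])
  finally have L: "?L = \<dots>" .
  have "?R = (\<Sum>(r, p)\<in>Sigma (between S B) (\<lambda>r. leg_pairs m A S r).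
      of_nat (m choose length (fst p)) * ?t (fst p, r # snd p))"
    unfolding legs_sum_def
    by (subst sum.Sigma[symmetric]) (auto simp: sum_distrib_left algebra_simps case_prod_unfold)
  also have "\<dots> = (\<Sum>p\<in>{p\<in>?P. snd p \<noteq> []}. of_nat (m choose (length (fst p))) * ?t p)"
    by (rule sum.reindex_bij_witness[where i="\<lambda>p. (hd (snd p), (fst p, tl (snd p)))"
          and j="\<lambda>(l, p). (fst p, l # snd p)"])
      (auto simp: leg_pairs_def neq_Nil_conv)
  also have "\<dots> = (\<Sum>p\<in>?P. of_nat (m choose (length (fst p))) * ?t p)"
    by (rule sum.mono_neutral_left, rule finite_leg_pairs) (auto simp: leg_pairs_def)
  finally have R: "?R = \<dots>" .
  have pascal: "of_nat (Suc m choose length (fst p)) =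
     (if fst p \<noteq> [] then of_nat (m choose (length (fst p) - 1)) else 0) + (of_nat (m choose (length (fst p))) :: 'a)"
    for p :: "'n set list \<times> 'n set list"
    by (cases "fst p") auto
  show ?thesis
    unfolding L R sum.distrib[symmetric] unfolding legs_sum_def
    by (rule sum.cong[OF refl]) (simp only: case_prod_unfold mult.assoc pascal distrib_right if_distrib cong: if_cong, auto simp: distrib_right)
qed

text \<open>The first set inserted is an outermost leg and becomes a neighbour of S, so the
  remaining applications act in a smaller gap. The sign comes from the minus in
  \<open>step\<close>.\<close>

lemma step0_power_delta:
  fixes S :: "'n::finite set"
  assumes "gap A S B J"
  shows "(step0 S ^^ m) (delta J) K = (-1) ^ m * legs_sum m A S B (\<lambda>X. delta (J \<union> X) K :: 'a::field_char_0)"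
  using assms
proof (induction m arbitrary: A B J K)
  case 0
  have "leg_pairs 0 A S B = {([], [])}" by (auto simp: leg_pairs_def)
  then show ?case by (simp add: legs_sum_def)
next
  case (Suc m)
  let ?a = "\<lambda>l. - (of_nat (card (l - A)) / of_nat (card (S - A))) :: 'a"
  let ?b = "\<lambda>r. - (of_nat (card (B - r)) / of_nat (card (B - S))) :: 'a"
  have ins: "insert l J \<union> X = J \<union> insert l X" for l X by blast
  have dis: "between A S \<inter> between S B = {}" by (auto simp: between_def)
  \<comment> \<open>A single coefficient function on the union of the two disjoint ranges, so that
    linearity of the powers applies to one sum.\<close>
  define c where "c s = (if s \<in> between A S then ?a s else ?b s)" for s
  have "step0 S (delta J) = (\<lambda>K. \<Sum>s\<in>between A S \<union> between S B. c s * delta (insert s J) K)"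
    using dis
    by (intro ext, subst step0_gap[OF Suc.prems], subst sum.union_disjoint)
      (auto simp: c_def intro!: arg_cong2[where f="(+)"] sum.cong)
  \<comment> \<open>\<open>funpow_Suc_right\<close> peels off the application performed first,
    because the induction hypothesis is used at the gaps which that application leaves
    behind.\<close>
  then have "(step0 S ^^ Suc m) (delta J) K =
      (\<Sum>s\<in>between A S \<union> between S B. c s * (step0 S ^^ m) (delta (insert s J)) K)"
    by (simp add: funpow_Suc_right step_power_sum del: funpow.simps)
  also have "\<dots> = (\<Sum>l\<in>between A S. ?a l * (step0 S ^^ m) (delta (insert l J)) K) +
      (\<Sum>r\<in>between S B. ?b r * (step0 S ^^ m) (delta (insert r J)) K)"
    using dis by (subst sum.union_disjoint) (auto simp: c_def intro!: arg_cong2[where f="(+)"] sum.cong)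
  also have "\<dots> = (\<Sum>l\<in>between A S. ?a l * ((-1) ^ m * legs_sum m l S B (\<lambda>X. delta (J \<union> insert l X) K))) +
      (\<Sum>r\<in>between S B. ?b r * ((-1) ^ m * legs_sum m A S r (\<lambda>X. delta (J \<union> insert r X) K)))"
    using Suc.IH[OF gap_left[OF Suc.prems]] Suc.IH[OF gap_right[OF Suc.prems]]
    by (intro arg_cong2[where f="(+)"] sum.cong) (auto simp: between_def ins)
  also have "\<dots> = (-1) ^ Suc m * legs_sum (Suc m) A S B (\<lambda>X. delta (J \<union> X) K)"
    unfolding legs_sum_Suc distrib_left sum_distrib_left by (simp add: mult.left_commute)
  finally show ?case .
qed


section \<open>Running through a chain of heads\<close>

fun next_head :: "'n set list \<Rightarrow> 'n set" where
  "next_head [] = UNIV"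
| "next_head (h # hs) = h"

text \<open>Diagrams in the order in which the reduction produces them; A is the outermost vertex
  already placed. Right legs of h are bounded only by the next head, which has no left legs yet; its
  left legs are later bounded by the new outermost vertex.\<close>

fun diags :: "'n set \<Rightarrow> 'n set list \<Rightarrow> 'n spider list set" where
  "diags A [] = {[]}"
| "diags A (h # hs) = (\<lambda>((L, R), D). (L, h, R) # D) `
     (SIGMA (L, R) : lleg_lists A h \<times> rleg_lists (next_head hs) h. diags (first_right (L, h, R)) hs)"

text \<open>The weights are those met during the reduction, with the next head still bare;
  \<open>diag_coeff_eq\<close> compares them with \<open>diagram_wt\<close>. The argument of c is
  the number of vertices of the spider, its legs and the head.\<close>

fun diag_coeff :: "(nat \<Rightarrow> 'a::field_char_0) \<Rightarrow> 'n::finite set \<Rightarrow> 'n spider list \<Rightarrow> 'a" where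
  "diag_coeff c A [] = 1"
| "diag_coeff c A ((L, h, R) # D) =
     c (Suc (length L + length R)) * (-1) ^ (length L + length R) *
     of_nat ((length L + length R) choose length L) *
     left_wt A h L * right_wt (next_head (map head D)) h R * diag_coeff c (first_right (L, h, R)) D"

lemma finite_diags [simp]: "finite (diags A (hs :: 'n::finite set list))"
  by (induction hs arbitrary: A) (auto intro!: finite_imageI finite_SigmaI)

lemma map_head_diags: "D \<in> diags A hs \<Longrightarrow> map head D = hs"
  by (induction hs arbitrary: A D) auto

text \<open>The shift of the coefficients reflects that S already belongs to the sets on which V is
  supported: x_S^(n+1) is the factor in the monomial times n applications of \<open>step0\<close>.
  The cutoff is harmless, as every application inserts a further set and there are only
  \<open>CARD('n set)\<close> of them.\<close>

definition series0 :: "(nat \<Rightarrow> 'a::field_char_0) \<Rightarrow> 'n::finite set \<Rightarrow> ('n set set \<Rightarrow> 'a) \<Rightarrow> 'n set set \<Rightarrow> 'a" where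
  "series0 c S V K = (\<Sum>n\<le>CARD('n set). c (Suc n) * (step0 S ^^ n) V K)"

fun proc0 :: "(nat \<Rightarrow> 'a::field_char_0) \<Rightarrow> 'n::finite set list \<Rightarrow> ('n set set \<Rightarrow> 'a) \<Rightarrow> 'n set set \<Rightarrow> 'a" where
  "proc0 c [] V = V"
| "proc0 c (h # hs) V = proc0 c hs (series0 c h V)"

lemma series0_sum:
  "series0 c S (\<lambda>K. \<Sum>i\<in>I. a i * V i K) J = (\<Sum>i\<in>I. a i * series0 c S (V i) J)"
  unfolding series0_def step_power_sum sum_distrib_left
  by (subst sum.swap) (simp add: mult.left_commute)

lemma proc0_sum:
  "proc0 c hs (\<lambda>K. \<Sum>i\<in>I. a i * V i K) J = (\<Sum>i\<in>I. a i * proc0 c hs (V i) J)"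
proof (induction hs arbitrary: V)
  case (Cons h hs)
  have "series0 c h (\<lambda>K. \<Sum>i\<in>I. a i * V i K) = (\<lambda>K. \<Sum>i\<in>I. a i * series0 c h (V i) K)"
    by (rule ext, rule series0_sum)
  then show ?case using Cons by simp
qed simp

text \<open>The legs of one head are distinct sets, so the cutoff of \<open>series0\<close> reaches
  every pair of leg lists.\<close>

lemma leg_lengths:
  assumes "L \<in> lleg_lists A (S :: 'n::finite set)" "R \<in> rleg_lists B S"
  shows "length L + length R \<le> CARD('n set)"
proof -
  have 1: "distinct L" if "sorted_wrt (\<subset>) L" for L :: "'n set list"
    using that by (induction L) auto
  have 2: "distinct R" if "sorted_wrt (\<supset>) R" for R :: "'n set list"
    using that by (induction R) auto
  have "distinct (L @ R)"
    using assms 1[of L] 2[of R] by (auto simp: lleg_lists_def rleg_lists_def between_def)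
  from distinct_card[OF this] show ?thesis by (metis card_mono finite length_append subset_UNIV)
qed

lemma series0_delta:
  fixes S :: "'n::finite set"
  assumes "gap A S B J"
  shows "(series0 c S (delta J) K :: 'a::field_char_0) =
    (\<Sum>(L, R)\<in>lleg_lists A S \<times> rleg_lists B S.
      c (Suc (length L + length R)) * (-1) ^ (length L + length R) *
      of_nat ((length L + length R) choose length L) * left_wt A S L * right_wt B S R *
      delta (J \<union> set L \<union> set R) K)"
proof -
  let ?t = "\<lambda>(L, R). c (Suc (length L + length R)) * (-1) ^ (length L + length R) *
      of_nat ((length L + length R) choose length L) * left_wt A S L * right_wt B S R *
      delta (J \<union> set L \<union> set R) K"
  have "series0 c S (delta J) K = (\<Sum>n\<le>CARD('n set). \<Sum>p\<in>leg_pairs n A S B. ?t p)"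
    unfolding series0_def step0_power_delta[OF assms] legs_sum_def sum_distrib_left
    by (intro sum.cong) (auto simp: leg_pairs_def Un_assoc mult_ac)
  also have "\<dots> = (\<Sum>p\<in>(\<Union>n\<le>CARD('n set). leg_pairs n A S B). ?t p)"
    by (rule sum.UNION_disjoint[symmetric], simp, simp, auto simp: leg_pairs_def)
  also have "(\<Union>n\<le>CARD('n set). leg_pairs n A S B) = lleg_lists A S \<times> rleg_lists B S"
    using leg_lengths[of _ A S _ B] by (auto simp: leg_pairs_def)
  finally show ?thesis .
qed

text \<open>The invariant of the run from small to large heads: whatever has been attached lies
  within A, and beyond it only bare heads remain.\<close>

definition ready :: "'n set \<Rightarrow> 'n set list \<Rightarrow> 'n set set \<Rightarrow> bool" where
  "ready A hs J \<longleftrightarrow> sorted_wrt (\<subset>) (A # hs @ [UNIV]) \<and> set hs \<subseteq> J \<and> (A \<in> J \<or> A = {}) \<and>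
     (\<forall>K\<in>J. K \<subseteq> A \<or> K \<in> set hs)"

lemma ready_gap:
  assumes "ready A (h # hs) J"
  shows "gap A h (next_head hs) J"
  using assms unfolding ready_def gap_def by (cases hs) (auto 0 3)

lemma sorted_next_head:
  assumes "sorted_wrt (\<subset>) (hs @ [UNIV])" "X \<subset> next_head hs"
  shows "sorted_wrt (\<subset>) (X # hs @ [UNIV])"
proof -
  have "X \<subset> x" if "x \<in> set hs \<union> {UNIV}" for x
    using that assms by (cases hs) (auto intro: psubset_trans)
  then show ?thesis using assms by simp
qed

text \<open>Legs are listed from the outside inwards, so \<open>first_right\<close> is the largest
  vertex of the finished spider and takes over the role of A.\<close>

lemma ready_step:
  assumes r: "ready A (h # hs) J" and L: "L \<in> lleg_lists A h" and R: "R \<in> rleg_lists (next_head hs) h"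
  shows "ready (first_right (L, h, R)) hs (J \<union> set L \<union> set R)"
proof -
  let ?A = "first_right (L, h, R)"
  have Ah: "A \<subset> h" and hJ: "h \<in> J" "set hs \<subseteq> J" and J: "\<forall>K\<in>J. K \<subseteq> A \<or> K = h \<or> K \<in> set hs"
    and srt: "sorted_wrt (\<subset>) (hs @ [UNIV])" and hn: "h \<subset> next_head hs"
    using r by (cases hs; simp add: ready_def)+
  have R': "h \<subset> x" "x \<subset> next_head hs" if "x \<in> set R" for x
    using R that by (auto simp: rleg_lists_def between_def)
  have h1: "h \<subseteq> ?A"
    using R' by (cases R) (auto simp: first_right_def)
  have h2: "?A \<subset> next_head hs"
    using R' hn by (cases R) (simp_all add: first_right_def)
  have h3: "?A \<in> J \<union> set L \<union> set R"
    using hJ by (cases R) (simp_all add: first_right_def)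
  have h4: "K \<subseteq> ?A" if "K \<in> set R" for K
    using R that by (cases R) (auto simp: first_right_def rleg_lists_def)
  have h5: "K \<subseteq> ?A" if "K \<in> set L" for K
    using L that h1 unfolding lleg_lists_def between_def by blast
  have h6: "K \<subseteq> ?A \<or> K \<in> set hs" if "K \<in> J" for K
    using J that h1 Ah by blast
  have "sorted_wrt (\<subset>) (?A # hs @ [UNIV])"
    by (rule sorted_next_head[OF srt h2])
  moreover have "\<forall>K\<in>J \<union> set L \<union> set R. K \<subseteq> ?A \<or> K \<in> set hs"
    using h4 h5 h6 by blast
  moreover have "set hs \<subseteq> J \<union> set L \<union> set R"
    using hJ(2) by blast
  ultimately show ?thesis
    unfolding ready_def using h3 by simp
qed

lemma proc0_delta:
  fixes J :: "'n::finite set set"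
  assumes "ready A hs J"
  shows "(proc0 c hs (delta J) K :: 'a::field_char_0) =
    (\<Sum>D\<in>diags A hs. diag_coeff c A D * delta (J \<union> set (concat (map vertices D))) K)"
  using assms
proof (induction hs arbitrary: A J K)
  case Nil
  then show ?case by simp
next
  case (Cons h hs)
  let ?P = "lleg_lists A h \<times> rleg_lists (next_head hs) h"
  let ?t = "\<lambda>p. c (Suc (length (fst p) + length (snd p))) * (-1) ^ (length (fst p) + length (snd p)) *
      of_nat ((length (fst p) + length (snd p)) choose length (fst p)) *
      left_wt A h (fst p) * right_wt (next_head hs) h (snd p)"
  have h: "h \<in> J" using Cons.prems by (simp add: ready_def)
  have "series0 c h (delta J) = (\<lambda>K. \<Sum>p\<in>?P. ?t p * delta (J \<union> set (fst p) \<union> set (snd p)) K)"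
    by (rule ext, subst series0_delta[OF ready_gap[OF Cons.prems]]) (simp add: case_prod_unfold)
  then have "proc0 c (h # hs) (delta J) K =
      (\<Sum>p\<in>?P. ?t p * proc0 c hs (delta (J \<union> set (fst p) \<union> set (snd p))) K)"
    by (simp add: proc0_sum)
  also have "\<dots> = (\<Sum>p\<in>?P. \<Sum>D\<in>diags (first_right (fst p, h, snd p)) hs.
      ?t p * (diag_coeff c (first_right (fst p, h, snd p)) D *
      delta (J \<union> set (fst p) \<union> set (snd p) \<union> set (concat (map vertices D))) K))"
    unfolding sum_distrib_left[symmetric]
    by (intro sum.cong refl arg_cong2[where f="(*)"] Cons.IH ready_step[OF Cons.prems]) auto
  also have "\<dots> = (\<Sum>(p, D)\<in>(SIGMA p:?P. diags (first_right (fst p, h, snd p)) hs).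
      ?t p * (diag_coeff c (first_right (fst p, h, snd p)) D *
      delta (J \<union> set (fst p) \<union> set (snd p) \<union> set (concat (map vertices D))) K))"
    by (subst sum.Sigma) auto
  also have "\<dots> = (\<Sum>D\<in>diags A (h # hs). diag_coeff c A D * delta (J \<union> set (concat (map vertices D))) K)"
    unfolding diags.simps
    by (subst sum.reindex)
      (use h in \<open>auto simp: inj_on_def case_prod_unfold map_head_diags vertices_def insert_absorb Un_ac mult_ac
        intro!: sum.cong arg_cong2[where f="delta"]\<close>)
  finally show ?case .
qed

text \<open>The bounds imposed one spider at a time add up to sortedness of the whole vertex list:
  right legs lie below the next head, and also below its left legs because those are chosen above
  the outermost right leg.\<close>

lemma mem_diags_iff:
  assumes "sorted_wrt (\<subset>) (A # hs @ [UNIV])"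
  shows "D \<in> diags A hs \<longleftrightarrow> map head D = hs \<and> sorted_wrt (\<subset>) (A # concat (map vertices D) @ [UNIV])"
  using assms
proof (induction hs arbitrary: A D)
  case Nil
  then show ?case by auto
next
  case (Cons h hs)
  show ?case
  proof (cases D)
    case Nil
    then show ?thesis by auto
  next
    case D: (Cons s D')
    obtain L h' R where s: "s = (L, h', R)" by (cases s)
    let ?A = "first_right (L, h, R)"
    define V where "V = concat (map vertices D')"
    \<comment> \<open>Used for the converse: the next head is a vertex of the remaining spiders or
      \<open>UNIV\<close>, so sortedness bounds the right legs by it.\<close>
    have nh: "next_head hs \<in> insert UNIV (set V)" if "map head D' = hs"
      using that by (cases D') (auto simp: V_def vertices_def)
    have mem: "D \<in> diags A (h # hs) \<longleftrightarrow>
        h' = h \<and> L \<in> lleg_lists A h \<and> R \<in> rleg_lists (next_head hs) h \<and> D' \<in> diags ?A hs"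
      unfolding D s by (auto simp: image_iff case_prod_unfold intro!: bexI[of _ "((L, R), D')"])
    have sort_hs: "sorted_wrt (\<subset>) (hs @ [UNIV])" "A \<subset> h" "h \<subset> next_head hs"
      using Cons.prems by (cases hs; auto)+
    have sort: "sorted_wrt (\<subset>) (?A # hs @ [UNIV])" if "R \<in> rleg_lists (next_head hs) h"
    proof -
      have "?A \<subset> next_head hs"
        using that sort_hs by (cases R) (auto simp: first_right_def rleg_lists_def between_def)
      then show ?thesis using sort_hs(1) by (rule sorted_next_head[rotated])
    qed
    show ?thesis
    proof
      assume "D \<in> diags A (h # hs)"
      then have *: "h' = h" "L \<in> lleg_lists A h" "R \<in> rleg_lists (next_head hs) h" "D' \<in> diags ?A hs"
        using mem by auto
      have **: "map head D' = hs" "sorted_wrt (\<subset>) (?A # V @ [UNIV])"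
        using Cons.IH[OF sort[OF *(3)]] *(4) by (auto simp: V_def)
      have RA: "\<forall>r\<in>insert h (set R). r \<subseteq> ?A"
        using *(3) by (cases R) (auto simp: first_right_def rleg_lists_def between_def)
      have AV: "\<forall>v\<in>insert UNIV (set V). ?A \<subset> v" using **(2) by simp
      have RV: "\<forall>r\<in>insert h (set R). \<forall>v\<in>insert UNIV (set V). r \<subset> v"
        using RA AV by (meson subset_psubset_trans)
      have Ls: "sorted_wrt (\<subset>) L" "\<forall>x\<in>set L. A \<subset> x \<and> x \<subset> h"
        using *(2) by (auto simp: lleg_lists_def between_def)
      have Rs: "sorted_wrt (\<lambda>x y. y \<subset> x) R" "\<forall>x\<in>set R. h \<subset> x"
        using *(3) by (auto simp: rleg_lists_def between_def)
      have LV: "\<forall>x\<in>set L. \<forall>v\<in>insert h (set R \<union> insert UNIV (set V)). x \<subset> v"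
      proof (intro ballI)
        fix x v assume x: "x \<in> set L" and v: "v \<in> insert h (set R \<union> insert UNIV (set V))"
        have "h \<subseteq> v" using v Rs(2) RV by blast
        moreover have "x \<subset> h" using x Ls(2) by blast
        ultimately show "x \<subset> v" by (rule psubset_subset_trans[rotated])
      qed
      have "sorted_wrt (\<subset>) (L @ h # rev R @ V @ [UNIV])"
        using Ls(1) Rs LV RV **(2) by (simp add: sorted_wrt_append sorted_wrt_rev ball_Un)
      moreover have "\<forall>v\<in>set (L @ h # rev R @ V @ [UNIV]). A \<subset> v"
      proof
        fix v assume "v \<in> set (L @ h # rev R @ V @ [UNIV])"
        then consider "v \<in> set L" | "h = v" | "h \<subset> v" using Rs(2) RV by auto
        then show "A \<subset> v" using Ls(2) sort_hs(2) by cases (auto intro: psubset_trans)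
      qed
      ultimately show "map head D = h # hs \<and> sorted_wrt (\<subset>) (A # concat (map vertices D) @ [UNIV])"
        using ** unfolding D s * by (simp add: vertices_def V_def)
    next
      assume asm: "map head D = h # hs \<and> sorted_wrt (\<subset>) (A # concat (map vertices D) @ [UNIV])"
      then have h': "h' = h" and m: "map head D' = hs"
        unfolding D s by auto
      have srt: "sorted_wrt (\<subset>) (A # L @ h # rev R @ V @ [UNIV])"
        using asm unfolding D s h' by (simp add: vertices_def V_def)
      have L: "L \<in> lleg_lists A h"
        using srt unfolding lleg_lists_def between_def by (auto simp: sorted_wrt_append)
      have R: "R \<in> rleg_lists (next_head hs) h"
      proof -
        have "sorted_wrt (\<lambda>x y. y \<subset> x) R" "\<forall>r\<in>set R. h \<subset> r"
          "\<forall>r\<in>set R. \<forall>v\<in>insert UNIV (set V). r \<subset> v"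
          using srt by (simp_all add: sorted_wrt_append sorted_wrt_rev ball_Un)
        then show ?thesis using nh[OF m] unfolding rleg_lists_def between_def by blast
      qed
      have "sorted_wrt (\<subset>) (?A # V @ [UNIV])"
        using srt by (cases R) (simp_all add: first_right_def sorted_wrt_append)
      then have "D' \<in> diags ?A hs" using Cons.IH[OF sort[OF R]] m by (simp add: V_def)
      then show "D \<in> diags A (h # hs)" using mem h' L R by simp
    qed
  qed
qed


section \<open>Diagram weights as telescoping products\<close>

fun chain_prod :: "('b \<Rightarrow> 'b \<Rightarrow> 'a::comm_monoid_mult) \<Rightarrow> 'b \<Rightarrow> 'b list \<Rightarrow> 'a" where
  "chain_prod f x [] = 1"
| "chain_prod f x (y # ys) = f y x * chain_prod f y ys"

lemma prod_nth_chain: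
  "(\<Prod>i\<in>{1..<Suc (length xs)}. f ((x # xs) ! i) ((x # xs) ! (i - 1))) = chain_prod f x xs"
proof (induction xs arbitrary: x)
  case (Cons y ys)
  have "(\<Prod>i\<in>{1..<Suc (length (y # ys))}. f ((x # y # ys) ! i) ((x # y # ys) ! (i - 1)))
      = f y x * (\<Prod>i\<in>{Suc 1..<Suc (Suc (length ys))}. f ((x # y # ys) ! i) ((x # y # ys) ! (i - 1)))"
    by (subst prod.atLeast_Suc_lessThan) auto
  also have "(\<Prod>i\<in>{Suc 1..<Suc (Suc (length ys))}. f ((x # y # ys) ! i) ((x # y # ys) ! (i - 1)))
      = (\<Prod>i\<in>{1..<Suc (length ys)}. f ((y # ys) ! i) ((y # ys) ! (i - 1)))"
    by (subst prod.shift_bounds_Suc_ivl) (auto intro!: prod.cong simp: nth_Cons')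
  finally show ?case using Cons by simp
qed simp

text \<open>Multiplying by |S - A| clears the denominator that belongs to the boundary. The
  remaining product is the left half of \<open>spider_wt\<close>.\<close>

lemma left_wt_eq:
  assumes "A \<subset> (S :: 'n::finite set)"
  shows "of_nat (card (S - A)) * left_wt A S L =
    of_nat (card (first_left (L, S, R) - A)) *
      (\<Prod>j\<in>{1..<length L}. diff_ratio (L ! j) (L ! (j - 1)) S (L ! (j - 1)))"
proof (cases L)
  case Nil
  then show ?thesis by (simp add: first_left_def)
next
  case (Cons l L')
  have "left_wt l S L' = chain_prod (\<lambda>y x. diff_ratio y x S x) l L'" for l L'
    by (induction L' arbitrary: l) (auto simp: diff_ratio_def)
  moreover have "card (S - A) \<noteq> 0" using assms by auto
  ultimately show ?thesis
    using prod_nth_chain[where f="\<lambda>y x. diff_ratio y x S x" and x=l and xs=L']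
    by (simp add: Cons first_left_def)
qed

text \<open>The outermost factor is kept as a ratio, since it is measured against the bare next
  head. Without right legs this ratio is 1.\<close>

lemma right_wt_eq:
  assumes "S \<subset> (B :: 'n::finite set)"
  shows "right_wt B S R =
    diff_ratio B (first_right (L, S, R)) B S *
      (\<Prod>j\<in>{1..<length R}. diff_ratio (R ! (j - 1)) (R ! j) (R ! (j - 1)) S)"
proof (cases R)
  case Nil
  have "card (B - S) \<noteq> 0" using assms by auto
  then show ?thesis using Nil by (simp add: first_right_def diff_ratio_def)
next
  case (Cons r R')
  have "right_wt l S L' = chain_prod (\<lambda>y x. diff_ratio x y x S) l L'" for l L'
    by (induction L' arbitrary: l) (auto simp: diff_ratio_def)
  then show ?thesis
    using prod_nth_chain[where f="\<lambda>y x. diff_ratio x y x S" and x=r and xs=R']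
    by (simp add: Cons first_right_def diff_ratio_def)
qed

definition link :: "'n::finite spider \<Rightarrow> 'n spider \<Rightarrow> rat" where
  "link t s = diff_ratio (first_left t) (first_right s) (head t) (head s)"

definition diagram_coeff :: "'n::finite spider list \<Rightarrow> rat" where
  "diagram_coeff D = diagram_todd D * diagram_binom D * diagram_sgn D * (\<Prod>s\<leftarrow>D. spider_wt s)"

text \<open>Between consecutive heads S and S', with outermost right leg R of S and outermost left
  leg L of S', the reduction yields |S' - R| / |S' - S| from the lower spider and |L - R| / |S' - R|
  from the upper one. The term |S' - R| cancels and the boundary factor |L - R| / |S' - S| remains.
  The ratio on the left hand side is the share of s, the spider just below D.\<close>

lemma diag_coeff_eq:
  fixes s :: "'n::finite spider"
  assumes "D \<in> diags (first_right s) hs" "sorted_wrt (\<subset>) (first_right s # hs @ [UNIV])"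
  shows "diag_coeff todd_coeff (first_right s) D *
      diff_ratio (next_head hs) (first_right s) (next_head hs) (head s) =
    diagram_coeff D * chain_prod link s (D @ [([], UNIV, [])])"
  using assms
proof (induction hs arbitrary: s D)
  case Nil
  then show ?case
    by (simp add: diagram_coeff_def diagram_todd_def diagram_binom_def diagram_sgn_def link_def first_left_def)
next
  case (Cons h hs)
  from Cons.prems(1) obtain L R D' where D: "D = (L, h, R) # D'"
    and L: "L \<in> lleg_lists (first_right s) h" and R: "R \<in> rleg_lists (next_head hs) h"
    and D': "D' \<in> diags (first_right (L, h, R)) hs" by auto
  let ?t = "(L, h, R)" and ?A = "first_right s" and ?A' = "first_right (L, h, R)"
  have srt: "sorted_wrt (\<subset>) (hs @ [UNIV])" "?A \<subset> h" "h \<subset> next_head hs"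
    using Cons.prems(2) by (cases hs; simp)+
  have A': "?A' \<subset> next_head hs"
    using R srt by (cases R) (auto simp: first_right_def rleg_lists_def between_def)
  have IH: "diag_coeff todd_coeff ?A' D' * diff_ratio (next_head hs) ?A' (next_head hs) h =
      diagram_coeff D' * chain_prod link ?t (D' @ [([], UNIV, [])])"
    using Cons.IH[OF D' sorted_next_head[OF srt(1) A']] by simp
  have nh: "next_head (map head D') = next_head hs" using map_head_diags[OF D'] by simp
  let ?l = "\<Prod>j\<in>{1..<length L}. diff_ratio (L ! j) (L ! (j - 1)) h (L ! (j - 1))"
  let ?r = "\<Prod>j\<in>{1..<length R}. diff_ratio (R ! (j - 1)) (R ! j) (R ! (j - 1)) h"
  let ?k = "todd_coeff (Suc (length L + length R)) * (-1) ^ (length L + length R) *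
     of_nat ((length L + length R) choose length L)"
  have l: "left_wt ?A h L * diff_ratio h ?A h (head s) = link ?t s * ?l"
    using left_wt_eq[OF srt(2), of L R] by (simp add: diff_ratio_def link_def mult_ac)
  have r: "right_wt (next_head hs) h R = diff_ratio (next_head hs) ?A' (next_head hs) h * ?r"
    using right_wt_eq[OF srt(3), of R L] .
  have c: "diagram_coeff D = ?k * ?l * ?r * diagram_coeff D'"
    unfolding D diagram_coeff_def diagram_todd_def diagram_binom_def diagram_sgn_def
    by (simp add: vertices_def spider_wt_def power_add)
  have "diag_coeff todd_coeff ?A D * diff_ratio (next_head (h # hs)) ?A (next_head (h # hs)) (head s)
      = ?k * (left_wt ?A h L * diff_ratio h ?A h (head s)) * right_wt (next_head hs) h R * diag_coeff todd_coeff ?A' D'"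
    unfolding D by (simp add: nh)
  also have "\<dots> = ?k * (link ?t s * ?l) * ?r *
      (diag_coeff todd_coeff ?A' D' * diff_ratio (next_head hs) ?A' (next_head hs) h)"
    unfolding l r by (simp only: mult_ac)
  also have "\<dots> = diagram_coeff D * chain_prod link s (D @ [([], UNIV, [])])"
    unfolding IH c by (simp add: D mult_ac)
  finally show ?case .
qed

lemma boundary_wt_eq: "boundary_wt D = chain_prod link ([], {}, []) (D @ [([], UNIV, [])])"
proof -
  have "{1..length D + 1} = {1..<Suc (length (D @ [([], UNIV, [])]))}" by auto
  then show ?thesis
    using prod_nth_chain[where f=link and x="([], {}, [])" and xs="D @ [([], UNIV, [])]"]
    unfolding boundary_wt_def Let_def link_def by presburger
qed

lemma sorted_chain_unique:
  assumes "sorted_wrt (\<subset>) xs" "sorted_wrt (\<subset>) ys" "set xs = (set ys :: 'n set set)"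
  shows "xs = ys"
  using assms
proof (induction xs arbitrary: ys)
  case (Cons x xs)
  then obtain y ys' where ys: "ys = y # ys'" by (cases ys) auto
  have "x = y"
  proof (rule ccontr)
    assume "x \<noteq> y"
    then have "y \<in> set xs" "x \<in> set ys'" using Cons.prems(3) ys by auto
    then show False using Cons.prems(1,2) ys by auto
  qed
  moreover have "set xs = set ys'"
  proof -
    have "x \<notin> set xs" "y \<notin> set ys'" using Cons.prems(1,2) ys by auto
    then show ?thesis using Cons.prems(3) ys \<open>x = y\<close> by auto
  qed
  ultimately show ?case using Cons ys by auto
qed simp

lemma chains_sortedI:
  assumes "Ts \<in> chains_of_subsets"
  shows "sorted_wrt (\<subset>) ({} # Ts @ [UNIV])"
  using assms by (auto simp: chains_of_subsets_def proper_subsets_def sorted_wrt_append)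

lemma ready_chain:
  assumes "Hs \<in> chains_of_subsets"
  shows "ready {} Hs (set Hs)"
  using chains_sortedI[OF assms] by (auto simp: ready_def)

lemma diag_coeff_diagram:
  fixes Hs :: "'n::finite set list"
  assumes "D \<in> diags {} Hs" "Hs \<in> chains_of_subsets"
  shows "diag_coeff todd_coeff {} D = diagram_todd D * diagram_binom D * diagram_sgn D * diagram_wt D"
proof -
  \<comment> \<open>The artificial bottom spider has empty head and empty
    \<open>first_right\<close>, so its share in \<open>diag_coeff_eq\<close> is a quotient of equal
    cardinalities; it equals 1 because the next head is nonempty.\<close>
  have "next_head Hs \<noteq> {}"
    using chains_sortedI[OF assms(2)] by (cases Hs) auto
  then have "card (next_head Hs) \<noteq> 0" by simp
  then show ?thesis
    using diag_coeff_eq[of D "([], {}, [])" Hs] assms(1) chains_sortedI[OF assms(2)]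
    by (simp add: first_right_def diff_ratio_def diagram_coeff_def diagram_wt_def boundary_wt_eq mult_ac)
qed

lemma sum_delta_eq: "finite I \<Longrightarrow> (\<Sum>i\<in>I. a i * delta (f i) K) = (\<Sum>i | i \<in> I \<and> f i = K. a i :: 'a::field_char_0)"
  by (auto simp: sum.inter_filter delta_def intro!: sum.cong)

lemma finite_chains [simp]: "finite (chains_of_subsets :: 'n::finite set list set)"
  by (rule finite_subset[OF _ finite_sorted_subset[of "(\<subset>)"]]) (auto simp: chains_of_subsets_def irreflp_def)

lemma mem_diags_chain:
  assumes "Hs \<in> chains_of_subsets"
  shows "D \<in> diags {} Hs \<longleftrightarrow> map head D = Hs \<and> concat (map vertices D) \<in> chains_of_subsets"
proof -
  have "sorted_wrt (\<subset>) ({} # Vs @ [UNIV]) \<longleftrightarrow> Vs \<in> chains_of_subsets" for Vs :: "'a set list"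
    by (auto simp: chains_of_subsets_def proper_subsets_def sorted_wrt_append)
  then show ?thesis using mem_diags_iff[OF chains_sortedI[OF assms]] by blast
qed

lemma heads_subset_vertices: "set (map head D) \<subseteq> set (concat (map vertices D))"
  by (force simp: vertices_def)

lemma heads_chain:
  assumes "concat (map vertices D) \<in> chains_of_subsets"
  shows "map head D \<in> chains_of_subsets"
proof -
  have "sorted_wrt r (map head D)" if "sorted_wrt r (concat (map vertices D))" for r
    using that
  proof (induction D)
    case (Cons s D)
    have "head s \<in> set (vertices s)" by (simp add: vertices_def)
    then show ?case
      using Cons heads_subset_vertices[of D] by (auto simp: sorted_wrt_append)
  qed simp
  then show ?thesis
    using assms heads_subset_vertices[of D] by (auto simp: chains_of_subsets_def)
qed

text \<open>A diagram determines its head chain, so sorting the diagrams on Ts by heads is a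
  partition. From here on spiders disappear: both halves of the theorem are compared with this sum
  of reduced monomials.\<close>

theorem alpha_eq_proc0:
  assumes Ts: "Ts \<in> (chains_of_subsets :: 'n::finite set list set)"
  shows "alpha Ts = (\<Sum>Hs\<in>chains_of_subsets. proc0 todd_coeff Hs (delta (set Hs)) (set Ts))"
proof -
  let ?C = "chains_of_subsets :: 'n set list set"
  let ?D = "\<lambda>Hs. {D \<in> diags {} Hs. concat (map vertices D) = Ts}"
  have "(\<Sum>Hs\<in>?C. proc0 todd_coeff Hs (delta (set Hs)) (set Ts)) = (\<Sum>Hs\<in>?C. \<Sum>D\<in>?D Hs.
      diagram_todd D * diagram_binom D * diagram_sgn D * diagram_wt D)"
  proof (rule sum.cong[OF refl])
    fix Hs assume Hs: "Hs \<in> ?C"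
    have "set Hs \<union> set (concat (map vertices D)) = set Ts \<longleftrightarrow> concat (map vertices D) = Ts"
      if "D \<in> diags {} Hs" for D
    proof -
      have *: "map head D = Hs" "concat (map vertices D) \<in> chains_of_subsets"
        using that mem_diags_chain[OF Hs] by auto
      have "set Hs \<subseteq> set (concat (map vertices D))"
        unfolding *(1)[symmetric] by (force simp: vertices_def)
      then have "set Hs \<union> set (concat (map vertices D)) = set (concat (map vertices D))"
        by (rule Un_absorb1)
      moreover have "sorted_wrt (\<subset>) (concat (map vertices D))" "sorted_wrt (\<subset>) Ts"
        using *(2) Ts by (simp_all add: chains_of_subsets_def)
      ultimately show ?thesis
        by (metis sorted_chain_unique)
    qed
    then show "proc0 todd_coeff Hs (delta (set Hs)) (set Ts) = (\<Sum>D\<in>?D Hs.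
      diagram_todd D * diagram_binom D * diagram_sgn D * diagram_wt D)"
      unfolding proc0_delta[OF ready_chain[OF Hs]] sum_delta_eq[OF finite_diags]
      by (intro sum.cong) (auto simp: diag_coeff_diagram[OF _ Hs])
  qed
  also have "\<dots> = (\<Sum>D\<in>(\<Union>Hs\<in>?C. ?D Hs). diagram_todd D * diagram_binom D * diagram_sgn D * diagram_wt D)"
    by (rule sum.UNION_disjoint[symmetric]) (auto dest: map_head_diags)
  also have "(\<Union>Hs\<in>?C. ?D Hs) = spider_diagrams Ts"
    using Ts heads_chain mem_diags_chain by (auto simp: spider_diagrams_def)
  finally show ?thesis by (simp add: alpha_def)
qed

section \<open>Chains as sets, and the functional of a gap\<close>

definition chain_set :: "'n set set \<Rightarrow> bool" where
  "chain_set J \<longleftrightarrow> (\<forall>S\<in>J. \<forall>T\<in>J. S \<subseteq> T \<or> T \<subseteq> S)"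

lemma chain_setD: "chain_set J \<Longrightarrow> S \<in> J \<Longrightarrow> T \<in> J \<Longrightarrow> S \<subseteq> T \<or> T \<subseteq> S"
  by (auto simp: chain_set_def)

lemma chain_set_subset: "chain_set J \<Longrightarrow> K \<subseteq> J \<Longrightarrow> chain_set K"
  by (auto simp: chain_set_def)

lemma Union_chain_mem:
  assumes "finite F" "F \<noteq> {}" "chain_set F"
  shows "\<Union>F \<in> F"
  using assms
proof (induction rule: finite_ne_induct)
  case (insert S F)
  then have "\<Union>F \<in> F" using chain_set_subset by blast
  then have "S \<subseteq> \<Union>F \<or> \<Union>F \<subseteq> S" by (intro chain_setD[OF insert.prems]) simp_all
  then have "\<Union>(insert S F) = S \<or> \<Union>(insert S F) = \<Union>F" by blast
  then show ?case using \<open>\<Union>F \<in> F\<close> by (metis insertCI)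
qed simp

lemma Inter_chain_mem:
  assumes "finite F" "F \<noteq> {}" "chain_set F"
  shows "\<Inter>F \<in> F"
  using assms
proof (induction rule: finite_ne_induct)
  case (insert S F)
  then have "\<Inter>F \<in> F" using chain_set_subset by blast
  then have "S \<subseteq> \<Inter>F \<or> \<Inter>F \<subseteq> S" by (intro chain_setD[OF insert.prems]) simp_all
  then have "\<Inter>(insert S F) = S \<or> \<Inter>(insert S F) = \<Inter>F" by blast
  then show ?case using \<open>\<Inter>F \<in> F\<close> by (metis insertCI)
qed simp

lemma gap_chain:
  assumes J: "chain_set J" "J \<subseteq> proper_subsets" and S: "(S :: 'n::finite set) \<in> J"
  shows "gap (pred_in S J) S (succ_in S J) J"
proof -
  let ?P = "{K\<in>J. K \<subset> S}" and ?Q = "{K\<in>J. S \<subset> K}"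
  have P: "?P \<noteq> {} \<longrightarrow> pred_in S J \<in> ?P"
    unfolding pred_in_def by (intro impI Union_chain_mem chain_set_subset[OF J(1)]) auto
  have Q: "?Q \<noteq> {} \<longrightarrow> succ_in S J \<in> ?Q"
    unfolding succ_in_def by (intro impI Inter_chain_mem chain_set_subset[OF J(1)]) auto
  have S0: "S \<noteq> {}" "S \<noteq> UNIV" using J S by (auto simp: proper_subsets_def)
  have p: "pred_in S J \<subset> S \<and> (pred_in S J \<in> J \<or> pred_in S J = {})"
  proof (cases "?P = {}")
    case True
    then have "pred_in S J = {}" by (simp only: pred_in_def Union_empty)
    then show ?thesis using S0 by auto
  qed (use P in auto)
  have q: "S \<subset> succ_in S J \<and> (succ_in S J \<in> J \<or> succ_in S J = UNIV)"
  proof (cases "?Q = {}")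
    case True
    then have "succ_in S J = UNIV" by (simp only: succ_in_def Inter_empty)
    then show ?thesis using S0 by auto
  qed (use Q in auto)
  have "K \<subseteq> pred_in S J \<or> K = S \<or> succ_in S J \<subseteq> K" if KJ: "K \<in> J" for K
  proof -
    consider "K \<subset> S" | "K = S" | "S \<subset> K" using chain_setD[OF J(1) KJ S] by blast
    then show ?thesis using KJ by cases (auto simp: pred_in_def succ_in_def)
  qed
  then show ?thesis using p q S unfolding gap_def by blast
qed

text \<open>The functional of the overview at e_s for arbitrary s, including sets incomparable with
  members of the chain, since the linear relation involves all variables.\<close>

definition hat :: "'n::finite set \<Rightarrow> 'n set \<Rightarrow> 'n set \<Rightarrow> 'n set \<Rightarrow> 'a::field_char_0" where
  "hat A S B s = of_nat (card (s \<inter> (S - A))) / of_nat (card (S - A)) -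
     of_nat (card (s \<inter> (B - S))) / of_nat (card (B - S))"

lemma hat_cases:
  assumes "A \<subset> S" "S \<subset> (B :: 'n::finite set)"
  shows "s \<subseteq> A \<Longrightarrow> hat A S B s = (0 :: 'a::field_char_0)"
    and "A \<subset> s \<Longrightarrow> s \<subset> S \<Longrightarrow> hat A S B s = (of_nat (card (s - A)) / of_nat (card (S - A)) :: 'a)"
    and "hat A S B S = (1 :: 'a)"
    and "S \<subset> s \<Longrightarrow> s \<subset> B \<Longrightarrow> hat A S B s = (of_nat (card (B - s)) / of_nat (card (B - S)) :: 'a)"
    and "B \<subseteq> s \<Longrightarrow> hat A S B s = (0 :: 'a)"
proof -
  have n: "card (S - A) \<noteq> 0" "card (B - S) \<noteq> 0" using assms by auto
  show "hat A S B s = (0 :: 'a)" if "s \<subseteq> A"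
  proof -
    have "s \<inter> (S - A) = {}" "s \<inter> (B - S) = {}" using that assms by auto
    then show ?thesis by (simp add: hat_def)
  qed
  show "hat A S B s = (of_nat (card (s - A)) / of_nat (card (S - A)) :: 'a)" if "A \<subset> s" "s \<subset> S"
  proof -
    have "s \<inter> (S - A) = s - A" "s \<inter> (B - S) = {}" using that assms by auto
    then show ?thesis by (simp add: hat_def)
  qed
  show "hat A S B S = (1 :: 'a)"
  proof -
    have "S \<inter> (S - A) = S - A" "S \<inter> (B - S) = {}" using assms by auto
    then show ?thesis using n by (simp add: hat_def)
  qed
  show "hat A S B s = (of_nat (card (B - s)) / of_nat (card (B - S)) :: 'a)" if "S \<subset> s" "s \<subset> B"
  proof -
    have "s \<inter> (S - A) = S - A" "s \<inter> (B - S) = s - S" using that assms by auto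
    moreover have "card (B - s) + card (s - S) = card (B - S)"
      using that by (subst card_Un_disjoint[symmetric]) (auto intro!: arg_cong[where f=card])
    then have "of_nat (card (B - s)) + of_nat (card (s - S)) = (of_nat (card (B - S)) :: 'a)"
      by (metis of_nat_add)
    ultimately show ?thesis using n by (simp add: hat_def field_simps)
  qed
  show "hat A S B s = (0 :: 'a)" if "B \<subseteq> s"
  proof -
    have "s \<inter> (S - A) = S - A" "s \<inter> (B - S) = B - S" using that assms by auto
    then show ?thesis using n by (simp add: hat_def)
  qed
qed

lemma hat_mem:
  assumes "gap A S B J" "K \<in> J"
  shows "hat A S B K = (if K = S then 1 else 0 :: 'a::field_char_0)"
proof -
  have "A \<subset> S" "S \<subset> B" "K \<subseteq> A \<or> K = S \<or> B \<subseteq> K" using assms by (auto simp: gap_def)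
  then show ?thesis using hat_cases[OF \<open>A \<subset> S\<close> \<open>S \<subset> B\<close>, where 'a='a] by auto
qed

text \<open>Comparability puts s into one of the intervals cut out by the gap, where both formulas
  agree. For incomparable s they differ in general, which is why the Chow relation has to discard
  non-chains.\<close>

lemma hat_tent:
  assumes g: "gap A S B J" and s: "s \<notin> J" "\<forall>K\<in>J. s \<subseteq> K \<or> K \<subseteq> s"
  shows "hat A S B s = (tent S J s :: 'a::field_char_0)"
proof -
  have AS: "A \<subset> S" "S \<subset> B" using g by (auto simp: gap_def)
  have "A \<subseteq> s \<or> s \<subseteq> A" "S \<subseteq> s \<or> s \<subseteq> S" "B \<subseteq> s \<or> s \<subseteq> B" "s \<noteq> S"
    using g s unfolding gap_def by blast+
  then consider "s \<subseteq> A" | "A \<subset> s" "s \<subset> S" | "S \<subset> s" "s \<subset> B" | "B \<subseteq> s" by blast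
  then show ?thesis
    using AS by cases (auto simp: hat_cases[OF AS] tent_def gap_pred[OF g] gap_succ[OF g])
qed

text \<open>Turns deletions into insertions: \<open>step\<close> collects from smaller sets, while
  the relation of J distributes to larger ones.\<close>

lemma sum_remove_reindex:
  assumes "finite T"
  shows "(\<Sum>J\<in>{J\<in>Pow T. S \<in> J}. \<Sum>s\<in>J - {S}. g (J - {s}) s) =
    (\<Sum>J\<in>{J\<in>Pow T. S \<in> J}. \<Sum>s\<in>T - J. (g J s :: 'a::comm_monoid_add))"
proof -
  have f: "finite {J\<in>Pow T. S \<in> J}" using assms by simp
  have fJ: "\<forall>J\<in>{J\<in>Pow T. S \<in> J}. finite (J - {S})" "\<forall>J\<in>{J\<in>Pow T. S \<in> J}. finite (T - J)"
    using assms by (auto intro: finite_subset)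
  have "(\<Sum>J\<in>{J\<in>Pow T. S \<in> J}. \<Sum>s\<in>J - {S}. g (J - {s}) s) =
      (\<Sum>(J, s)\<in>(SIGMA J:{J\<in>Pow T. S \<in> J}. J - {S}). g (J - {s}) s)"
    using f fJ by (subst sum.Sigma) auto
  also have "\<dots> = (\<Sum>(J, s)\<in>(SIGMA J:{J\<in>Pow T. S \<in> J}. T - J). g J s)"
    by (rule sum.reindex_bij_witness[where i="\<lambda>(J, s). (insert s J, s)" and j="\<lambda>(J, s). (J - {s}, s)"])
      (auto simp: insert_absorb)
  also have "\<dots> = (\<Sum>J\<in>{J\<in>Pow T. S \<in> J}. \<Sum>s\<in>T - J. g J s)"
    using f fJ by (subst sum.Sigma) auto
  finally show ?thesis .
qed

text \<open>Each application consults only sets with one element fewer, and \<open>step0\<close>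
  vanishes on the empty set.\<close>

lemma step0_nilpotent: "card K < n \<Longrightarrow> (step0 (S :: 'n::finite set) ^^ n) V K = 0"
proof (induction n arbitrary: K)
  case (Suc n)
  show ?case
  proof (cases "S \<in> K")
    case True
    have "(step0 S ^^ n) V (K - {s}) = 0" if "s \<in> K - {S}" for s
    proof (rule Suc.IH)
      have "card (K - {s}) < card K" using that by (intro psubset_card_mono) auto
      then show "card (K - {s}) < n" using Suc.prems by simp
    qed
    then have "step0 S ((step0 S ^^ n) V) K = 0"
      unfolding step_def[of _ _ "(step0 S ^^ n) V" K] by simp
    then show ?thesis by simp
  qed (simp add: step_def)
qed simp

text \<open>The operator keeps or enlarges sets. This preserves the support condition under which
  \<open>step\<close> represents multiplication by the variable of S.\<close>

lemma step_power_support: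
  assumes "\<And>J. V J \<noteq> 0 \<Longrightarrow> H \<subseteq> J" "(step l S ^^ n) V J \<noteq> 0" "S \<in> H"
  shows "H \<subseteq> J"
  using assms(2)
proof (induction n arbitrary: J)
  case (Suc n)
  then have J: "step l S ((step l S ^^ n) V) J \<noteq> 0" by simp
  show ?case
  proof (cases "(step l S ^^ n) V J \<noteq> 0")
    case False
    with J have "(\<Sum>s\<in>J - {S}. tent S (J - {s}) s * (step l S ^^ n) V (J - {s})) \<noteq> 0"
      unfolding step_def[of _ _ "(step l S ^^ n) V" J] by (auto split: if_splits)
    then obtain s where "(step l S ^^ n) V (J - {s}) \<noteq> 0"
      by (metis (no_types, lifting) mult_zero_right sum.neutral)
    then show ?thesis using Suc.IH by blast
  qed (use Suc.IH in blast)
qed (use assms in auto)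

lemma todd_fps_mult: "Abs_fps todd_coeff * (1 - fps_exp (- 1)) = fps_X"
proof -
  have "fps_nth (1 - fps_exp (- 1 :: rat)) 1 = 1" by simp
  then have nz: "1 - fps_exp (- 1 :: rat) \<noteq> 0" by fastforce
  \<comment> \<open>Division of formal power series is exact here because the order of the
    denominator does not exceed that of \<open>fps_X\<close>.\<close>
  moreover have "subdegree (1 - fps_exp (- 1 :: rat)) \<le> 1"
    by (rule subdegree_leI) simp
  ultimately have "1 - fps_exp (- 1 :: rat) dvd fps_X"
    by (subst fps_dvd_iff) auto
  moreover have "Abs_fps todd_coeff = fps_X / (1 - fps_exp (- 1))"
    by (simp add: todd_coeff_def fps_eq_iff)
  ultimately show ?thesis by simp
qed

lemma todd_coeff_0: "todd_coeff 0 = 1"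
proof -
  have "fps_nth (Abs_fps todd_coeff * (1 - fps_exp (- 1))) 1 = 1"
    unfolding todd_fps_mult by simp
  then show ?thesis by (simp add: fps_mult_nth)
qed

lemma chain_list_exists:
  assumes "chain_set (J :: 'n::finite set set)" "J \<subseteq> proper_subsets"
  shows "\<exists>Ts\<in>chains_of_subsets. set Ts = J"
proof -
  obtain xs where xs: "set xs = J" "distinct xs" using finite_distinct_list[of J] by auto
  let ?Ts = "sort_key card xs"
  have *: "sorted (map card ?Ts)" "distinct ?Ts" "set ?Ts = J" using xs by simp_all
  have "sorted_wrt (\<subset>) ys" if "sorted (map card ys)" "distinct ys" "set ys \<subseteq> J" for ys
    using that
  proof (induction ys)
    case (Cons y ys)
    have "y \<subset> z" if z: "z \<in> set ys" for z
    proof -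
      have "card y \<le> card z" "y \<noteq> z" using Cons.prems z by auto
      moreover have "y \<subseteq> z \<or> z \<subseteq> y" using Cons.prems z by (intro chain_setD[OF assms(1)]) auto
      ultimately show ?thesis by (metis card_subset_eq finite order.antisym psubsetI card_mono)
    qed
    then show ?case using Cons by auto
  qed simp
  then have "sorted_wrt (\<subset>) ?Ts" using * by simp
  then show ?thesis using * assms(2) by (intro bexI[of _ ?Ts]) (auto simp: chains_of_subsets_def)
qed

lemma chain_set_list: "Ts \<in> chains_of_subsets \<Longrightarrow> chain_set (set Ts)"
proof -
  have "chain_set (set Ts)" if "sorted_wrt (\<subset>) Ts" for Ts :: "'a set list"
    using that by (induction Ts) (auto simp: chain_set_def)
  then show "Ts \<in> chains_of_subsets \<Longrightarrow> chain_set (set Ts)" by (auto simp: chains_of_subsets_def)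
qed

lemma bij_chain_lists:
  "bij_betw set (chains_of_subsets :: 'n::finite set list set) {J \<in> Pow proper_subsets. chain_set J}"
  unfolding bij_betw_def
proof
  show "inj_on set (chains_of_subsets :: 'n set list set)"
    by (rule inj_onI) (auto simp: chains_of_subsets_def intro: sorted_chain_unique)
  show "set ` chains_of_subsets = {J \<in> Pow (proper_subsets :: 'n set set). chain_set J}"
    using chain_list_exists chain_set_list by (force simp: chains_of_subsets_def)
qed

section \<open>The Chow ring\<close>

abbreviation PC :: "'n set_poly set" where "PC \<equiv> carrier poly_ring"

lemma PC_iff: "p \<in> PC \<longleftrightarrow> (\<forall>m\<in>Poly_Mapping.keys p. Poly_Mapping.keys m \<subseteq> proper_subsets)"
  by (simp add: poly_ring_def)

lemma PC_add [intro]: "p \<in> PC \<Longrightarrow> q \<in> PC \<Longrightarrow> p + q \<in> PC"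
  unfolding PC_iff using keys_add[of p q] by blast

lemma PC_uminus [intro]: "p \<in> PC \<Longrightarrow> - p \<in> PC"
  unfolding PC_iff by simp

lemma PC_diff [intro]: "p \<in> PC \<Longrightarrow> q \<in> PC \<Longrightarrow> p - q \<in> PC"
  using PC_add[of p "- q"] PC_uminus[of q] by simp

lemma PC_0 [intro, simp]: "0 \<in> PC" unfolding PC_iff by simp

lemma PC_1 [intro, simp]: "1 \<in> PC" unfolding PC_iff by simp

lemma PC_const [intro, simp]: "const c \<in> PC" unfolding PC_iff const_def by simp

lemma PC_var [intro]: "S \<in> proper_subsets \<Longrightarrow> var S \<in> PC" unfolding PC_iff var_def by simp

lemma PC_mult [intro]:
  assumes "p \<in> PC" "q \<in> PC"
  shows "p * q \<in> PC"
  unfolding PC_iff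
proof
  fix m assume "m \<in> Poly_Mapping.keys (p * q)"
  then obtain a b where m: "m = a + b" "a \<in> Poly_Mapping.keys p" "b \<in> Poly_Mapping.keys q"
    using keys_mult[of p q] by blast
  show "Poly_Mapping.keys m \<subseteq> proper_subsets"
    using assms m keys_add[of a b] unfolding PC_iff by blast
qed

lemma PC_sum [intro]: "(\<And>i. i \<in> I \<Longrightarrow> f i \<in> PC) \<Longrightarrow> sum f I \<in> PC"
  by (induction I rule: infinite_finite_induct) auto

lemma PC_prod [intro]: "(\<And>i. i \<in> I \<Longrightarrow> f i \<in> PC) \<Longrightarrow> prod f I \<in> PC"
  by (induction I rule: infinite_finite_induct) auto

lemma PC_power [intro]: "p \<in> PC \<Longrightarrow> p ^ n \<in> PC"
  by (induction n) auto

lemma poly_ring_ops: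
  "p \<otimes>\<^bsub>poly_ring\<^esub> q = p * q" "\<one>\<^bsub>poly_ring\<^esub> = 1" "\<zero>\<^bsub>poly_ring\<^esub> = 0" "p \<oplus>\<^bsub>poly_ring\<^esub> q = p + q"
  by (simp_all add: poly_ring_def)

lemma cring_poly_ring: "cring (poly_ring :: 'n set_poly ring)"
proof (rule cringI)
  show "abelian_group (poly_ring :: 'n set_poly ring)"
  proof (rule abelian_groupI)
    fix x assume "x \<in> PC"
    then show "\<exists>y\<in>PC. y \<oplus>\<^bsub>poly_ring\<^esub> x = \<zero>\<^bsub>poly_ring\<^esub>"
      by (intro bexI[of _ "- x"]) (auto simp: poly_ring_ops)
  qed (auto simp: poly_ring_ops algebra_simps)
  show "comm_monoid (poly_ring :: 'n set_poly ring)"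
    by (rule comm_monoidI) (auto simp: poly_ring_ops algebra_simps)
qed (auto simp: poly_ring_ops algebra_simps)

lemma poly_ring_minus:
  assumes "p \<in> PC" "q \<in> PC"
  shows "p \<ominus>\<^bsub>poly_ring\<^esub> q = p - q"
proof -
  interpret cring poly_ring by (rule cring_poly_ring)
  have "\<ominus>\<^bsub>poly_ring\<^esub> q = - q"
    using assms by (intro minus_equality) (auto simp: poly_ring_ops)
  then show ?thesis by (simp add: a_minus_def poly_ring_ops)
qed

lemma PC_linear_form [intro]: "linear_form i \<in> PC"
  unfolding linear_form_def by (intro PC_sum PC_var) simp

lemma chow_ideal_ideal: "ideal chow_ideal (poly_ring :: 'n::finite set_poly ring)"
proof -
  interpret cring "poly_ring :: 'n set_poly ring" by (rule cring_poly_ring)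
  show ?thesis unfolding chow_ideal_def incomparable_ideal_def linear_ideal_def
    by (intro add_ideals genideal_ideal) auto
qed

lemma chow_ideal_gens:
  shows "S \<in> proper_subsets \<Longrightarrow> T \<in> proper_subsets \<Longrightarrow> \<not> S \<subseteq> T \<Longrightarrow> \<not> T \<subseteq> S \<Longrightarrow>
      var S * var (T :: 'n::finite set) \<in> chow_ideal"
    and "linear_form a - linear_form (b :: 'n) \<in> chow_ideal"
proof -
  interpret cring "poly_ring :: 'n set_poly ring" by (rule cring_poly_ring)
  have I: "ideal (incomparable_ideal :: 'n set_poly set) poly_ring" "ideal (linear_ideal :: 'n set_poly set) poly_ring"
    unfolding incomparable_ideal_def linear_ideal_def by (auto intro!: genideal_ideal)
  have z: "0 \<in> (incomparable_ideal :: 'n set_poly set)" "0 \<in> (linear_ideal :: 'n set_poly set)"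
    using I[THEN ideal.axioms(1), THEN additive_subgroup.zero_closed] by (auto simp: poly_ring_ops)
  have set_add: "x + y \<in> chow_ideal" if "x \<in> incomparable_ideal" "y \<in> linear_ideal" for x y :: "'n set_poly"
    using that unfolding chow_ideal_def set_add_def' by (force simp: poly_ring_ops)
  show "var S * var T \<in> chow_ideal" if "S \<in> proper_subsets" "T \<in> proper_subsets" "\<not> S \<subseteq> T" "\<not> T \<subseteq> S"
    for S T :: "'n set"
  proof -
    have "var S * var T \<in> incomparable_ideal"
      unfolding incomparable_ideal_def by (rule subsetD[OF genideal_self]) (use that in auto)
    from set_add[OF this z(2)] show ?thesis by simp
  qed
  have "linear_form a - linear_form b \<in> linear_ideal"
    unfolding linear_ideal_def by (rule subsetD[OF genideal_self]) auto
  from set_add[OF z(1) this] show "linear_form a - linear_form b \<in> chow_ideal" by simp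
qed

lemma
  fixes p q :: "'n::finite set_poly"
  shows chow_ideal_0: "0 \<in> (chow_ideal :: 'n set_poly set)"
    and chow_ideal_add: "p \<in> chow_ideal \<Longrightarrow> q \<in> chow_ideal \<Longrightarrow> p + q \<in> chow_ideal"
    and chow_ideal_PC: "p \<in> chow_ideal \<Longrightarrow> p \<in> PC"
    and chow_ideal_mult: "p \<in> PC \<Longrightarrow> q \<in> chow_ideal \<Longrightarrow> p * q \<in> chow_ideal"
proof -
  interpret cring "poly_ring :: 'n set_poly ring" by (rule cring_poly_ring)
  interpret ideal chow_ideal "poly_ring :: 'n set_poly ring" by (rule chow_ideal_ideal)
  show "0 \<in> (chow_ideal :: 'n set_poly set)" using zero_closed by (simp add: poly_ring_ops)
  show "p + q \<in> chow_ideal" if "p \<in> chow_ideal" "q \<in> chow_ideal"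
    using a_closed[OF that] by (simp add: poly_ring_ops)
  show "p \<in> PC" if "p \<in> chow_ideal" using that a_subset by blast
  show "p * q \<in> chow_ideal" if "p \<in> PC" "q \<in> chow_ideal"
    using I_l_closed[OF that(2,1)] by (simp add: poly_ring_ops)
qed

lemma chow_ideal_uminus: "p \<in> chow_ideal \<Longrightarrow> - p \<in> chow_ideal"
  using chow_ideal_mult[of "- 1" p] by auto

lemma chow_ideal_mult_right: "p \<in> chow_ideal \<Longrightarrow> q \<in> PC \<Longrightarrow> p * q \<in> chow_ideal"
  using chow_ideal_mult[of q p] by (simp add: mult.commute)

lemma chow_ideal_sum: "(\<And>i. i \<in> I \<Longrightarrow> f i \<in> chow_ideal) \<Longrightarrow> sum f I \<in> chow_ideal"
  by (induction I rule: infinite_finite_induct) (auto intro: chow_ideal_0 chow_ideal_add)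

lemma chow_class_eqI:
  fixes p q :: "'n::finite set_poly"
  assumes "p \<in> PC" "q \<in> PC" "p - q \<in> chow_ideal"
  shows "chow_class p = chow_class q"
proof -
  interpret cring "poly_ring :: 'n set_poly ring" by (rule cring_poly_ring)
  show ?thesis
    using quotient_eq_iff_same_a_r_cos[OF chow_ideal_ideal assms(1,2)] assms
    by (simp add: chow_class_def poly_ring_minus)
qed

lemma const_simps: "const 0 = 0" "const 1 = 1" "const (a + b) = const a + const b" "const (a * b) = const a * const b"
    "const (- a) = - const a" "const (a - b) = const a - const b"
  by (simp_all add: const_def single_add mult_single single_uminus single_diff)

lemma const_sum: "const (sum f I) = (\<Sum>i\<in>I. const (f i))"
  by (induction I rule: infinite_finite_induct) (auto simp: const_simps)

section \<open>Square-free monomials and the relation of a chain\<close>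

definition monom_of :: "'n set set \<Rightarrow> 'n::finite set_poly" where
  "monom_of J = (\<Prod>S\<in>J. var S)"

lemma monom_of_insert: "s \<notin> J \<Longrightarrow> monom_of (insert s J) = var s * monom_of (J :: 'n::finite set set)"
  by (simp add: monom_of_def)

lemma PC_monom_of [intro]: "J \<subseteq> proper_subsets \<Longrightarrow> monom_of J \<in> PC"
  unfolding monom_of_def by (intro PC_prod PC_var) auto

lemma monom_of_nonchain:
  assumes J: "J \<subseteq> proper_subsets" "\<not> chain_set (J :: 'n::finite set set)"
  shows "monom_of J \<in> chow_ideal"
proof -
  obtain S T where ST: "S \<in> J" "T \<in> J" "\<not> S \<subseteq> T" "\<not> T \<subseteq> S" using J(2) by (auto simp: chain_set_def)
  have "J = insert S (insert T (J - {S, T}))" using ST by auto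
  moreover have "S \<noteq> T" using ST by auto
  ultimately have "monom_of J = var S * (var T * monom_of (J - {S, T}))"
    by (metis DiffE insertCI insertE monom_of_insert)
  also have "\<dots> = (var S * var T) * monom_of (J - {S, T})" by (simp add: mult.assoc)
  also have "\<dots> \<in> chow_ideal"
    using ST J by (intro chow_ideal_mult_right chow_ideal_gens PC_monom_of) auto
  finally show ?thesis .
qed

text \<open>The relation of the functional \<open>e\<^sub>S\<^sub>-\<^sub>A / |S - A| - e\<^sub>B\<^sub>-\<^sub>S / |B - S|\<close>.\<close>

lemma hat_relation:
  assumes "A \<subset> S" "S \<subset> (B :: 'n::finite set)"
  shows "(\<Sum>s\<in>proper_subsets. const (hat A S B s) * var s) \<in> chow_ideal"
proof -
  define u :: "'n \<Rightarrow> rat" where "u i = (if i \<in> S - A then 1 / of_nat (card (S - A)) else 0) -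
    (if i \<in> B - S then 1 / of_nat (card (B - S)) else 0)" for i
  have u: "(\<Sum>i\<in>s. u i) = hat A S B s" for s
    by (simp add: u_def hat_def sum_subtractf sum.If_cases set_diff_eq[symmetric])
  have "hat A S B UNIV = (0 :: rat)" using hat_cases(5)[OF assms, of UNIV] by simp
  then have u0: "(\<Sum>i\<in>UNIV. u i) = 0" using u by simp
  fix i0 :: 'n
  have lf: "linear_form i = (\<Sum>s\<in>proper_subsets. if i \<in> s then var s else 0)" for i :: 'n
    unfolding linear_form_def by (rule sum.inter_filter) simp
  have "(\<Sum>i\<in>UNIV. const (u i) * (linear_form i - linear_form i0)) =
      (\<Sum>i\<in>UNIV. const (u i) * linear_form i) - const (\<Sum>i\<in>UNIV. u i) * linear_form i0"
    by (simp add: right_diff_distrib sum_subtractf const_sum sum_distrib_right)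
  also have "\<dots> = (\<Sum>i\<in>UNIV. \<Sum>s\<in>proper_subsets. if i \<in> s then const (u i) * var s else 0)"
    unfolding u0 lf sum_distrib_left by (simp add: const_simps if_distrib cong: if_cong)
  also have "\<dots> = (\<Sum>s\<in>proper_subsets. \<Sum>i\<in>UNIV. if i \<in> s then const (u i) * var s else 0)"
    by (rule sum.swap)
  also have "\<dots> = (\<Sum>s\<in>proper_subsets. const (hat A S B s) * var s)"
    by (intro sum.cong refl) (simp add: sum.If_cases const_sum sum_distrib_right u[symmetric])
  finally have "(\<Sum>s\<in>proper_subsets. const (hat A S B s) * var s) =
      (\<Sum>i\<in>UNIV. const (u i) * (linear_form i - linear_form i0))" by simp
  then show ?thesis
    by (metis (no_types, lifting) chow_ideal_sum chow_ideal_mult PC_const chow_ideal_gens(2))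
qed

text \<open>The relation of the gap, multiplied by x_J. The functional is 1 at S and 0 at the other
  members of J, so x_S x_J is the only product with a square that survives. If J is not a chain,
  every term lies in the ideal.\<close>

lemma chain_relation:
  assumes J: "J \<subseteq> proper_subsets" and S: "(S :: 'n::finite set) \<in> J"
  shows "var S * monom_of J + (\<Sum>s\<in>proper_subsets - J. const (tent S J s) * monom_of (insert s J)) \<in> chow_ideal"
proof (cases "chain_set J")
  case False
  then have "\<not> chain_set (insert s J)" for s using chain_set_subset by blast
  then show ?thesis
    using J S False
    by (intro chow_ideal_add chow_ideal_sum chow_ideal_mult monom_of_nonchain PC_var PC_const) auto
next
  case True
  define A B where "A = pred_in S J" and "B = succ_in S J"
  have g: "gap A S B J" unfolding A_def B_def by (rule gap_chain[OF True J S])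
  then have AS: "A \<subset> S" "S \<subset> B" by (auto simp: gap_def)
  let ?h = "\<lambda>s. const (hat A S B s) :: 'n set_poly"
  have "monom_of J * (\<Sum>s\<in>proper_subsets. ?h s * var s) \<in> chow_ideal"
    by (intro chow_ideal_mult hat_relation[OF AS] PC_monom_of J)
  also have "monom_of J * (\<Sum>s\<in>proper_subsets. ?h s * var s) =
      (\<Sum>s\<in>J. ?h s * var s * monom_of J) + (\<Sum>s\<in>proper_subsets - J. ?h s * monom_of (insert s J))"
    using J by (subst sum.subset_diff[of J]) (auto simp: algebra_simps sum_distrib_left monom_of_insert)
  also have "(\<Sum>s\<in>J. ?h s * var s * monom_of J) = (\<Sum>s\<in>J. if s = S then var S * monom_of J else 0)"
    by (intro sum.cong) (auto simp: hat_mem[OF g] const_simps)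
  also have "\<dots> = var S * monom_of J" using S by simp
  finally have 1: "var S * monom_of J + (\<Sum>s\<in>proper_subsets - J. ?h s * monom_of (insert s J)) \<in> chow_ideal" .
  \<comment> \<open>Passing from the functional to \<open>tent\<close> only changes coefficients of
    sets incomparable with some member of J, and their monomials vanish in the quotient.\<close>
  have 2: "(\<Sum>s\<in>proper_subsets - J. (const (tent S J s) - ?h s) * monom_of (insert s J)) \<in> chow_ideal"
  proof (rule chow_ideal_sum)
    fix s assume s: "s \<in> proper_subsets - J"
    show "(const (tent S J s) - ?h s) * monom_of (insert s J) \<in> chow_ideal"
    proof (cases "\<forall>K\<in>J. s \<subseteq> K \<or> K \<subseteq> s")
      case True
      then have "hat A S B s = (tent S J s :: rat)" using s by (intro hat_tent[OF g]) auto
      then show ?thesis by (simp add: chow_ideal_0)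
    next
      case False
      then have "\<not> chain_set (insert s J)" by (auto simp: chain_set_def)
      then show ?thesis using s J by (intro chow_ideal_mult monom_of_nonchain PC_diff PC_const) auto
    qed
  qed
  from chow_ideal_add[OF 1 2] show ?thesis
    by (simp add: left_diff_distrib sum_subtractf)
qed

text \<open>The sum runs over all sets of proper subsets, so no chain condition has to be carried
  along with a tuple; the terms of non-chains lie in the ideal.\<close>

definition Phi :: "('n::finite set set \<Rightarrow> rat) \<Rightarrow> 'n set_poly" where
  "Phi V = (\<Sum>J\<in>Pow proper_subsets. const (V J) * monom_of J)"

lemma Phi_sum: "Phi (\<lambda>J. \<Sum>i\<in>I. a i * V i J) = (\<Sum>i\<in>I. const (a i) * Phi (V i))"
  unfolding Phi_def const_sum sum_distrib_left sum_distrib_right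
  by (subst sum.swap) (simp add: const_simps mult.assoc)

lemma Phi_delta: "J \<subseteq> proper_subsets \<Longrightarrow> Phi (delta J) = monom_of J"
  unfolding Phi_def delta_def by (simp add: const_simps if_distrib if_distribR cong: if_cong)

text \<open>Collecting terms by J turns the difference into a combination of the elements of
  \<open>chain_relation\<close>. The support condition is essential, as that relation is available
  for sets containing S.\<close>

lemma Phi_step:
  fixes S :: "'n::finite set"
  assumes S: "S \<in> proper_subsets" and V: "\<And>J. V J \<noteq> 0 \<Longrightarrow> S \<in> J"
  shows "Phi (step0 S V) - var S * Phi V \<in> chow_ideal"
proof -
  let ?P = "{J\<in>Pow proper_subsets. S \<in> J} :: 'n set set set"
  have "Phi (step0 S V) = (\<Sum>J\<in>?P. const (step0 S V J) * monom_of J)"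
    unfolding Phi_def by (rule sum.mono_neutral_right) (auto simp: step_def const_simps)
  also have "\<dots> = (\<Sum>J\<in>?P. \<Sum>s\<in>J - {S}. - const (tent S (J - {s}) s * V (J - {s})) * monom_of (insert s (J - {s})))"
    by (intro sum.cong refl)
      (auto simp: step_def const_simps const_sum sum_distrib_right sum_negf insert_absorb)
  also have "\<dots> = (\<Sum>J\<in>?P. \<Sum>s\<in>proper_subsets - J. - const (tent S J s * V J) * monom_of (insert s J))"
    by (rule sum_remove_reindex[where g="\<lambda>J s. - const (tent S J s * V J) * monom_of (insert s J)"]) simp
  finally have 1: "Phi (step0 S V) = \<dots>" .
  have "Phi V = (\<Sum>J\<in>?P. const (V J) * monom_of J)"
    unfolding Phi_def by (rule sum.mono_neutral_right) (use V in \<open>auto, metis const_simps(1) mult_zero_left\<close>)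
  then have "Phi (step0 S V) - var S * Phi V = (\<Sum>J\<in>?P. - const (V J) *
     (var S * monom_of J + (\<Sum>s\<in>proper_subsets - J. const (tent S J s) * monom_of (insert s J))))"
    unfolding 1 by (simp only: sum_distrib_left[where r="var S"] sum_subtractf[symmetric], intro sum.cong refl)
      (simp add: sum_distrib_left const_simps distrib_left sum_negf mult_ac)
  also have "\<dots> \<in> chow_ideal"
    by (intro chow_ideal_sum chow_ideal_mult PC_uminus PC_const chain_relation) auto
  finally show ?thesis .
qed

lemma Phi_step_power:
  fixes S :: "'n::finite set"
  assumes S: "S \<in> proper_subsets" and V: "\<And>J. V J \<noteq> 0 \<Longrightarrow> S \<in> J"
  shows "Phi ((step0 S ^^ n) V) - var S ^ n * Phi V \<in> chow_ideal"
proof (induction n)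
  case 0
  then show ?case by (simp add: chow_ideal_0)
next
  case (Suc n)
  let ?W = "(step0 S ^^ n) V"
  have "S \<in> J" if "?W J \<noteq> 0" for J
    using step_power_support[of V "{S}", OF _ that] V by auto
  then have "Phi (step0 S ?W) - var S * Phi ?W + var S * (Phi ?W - var S ^ n * Phi V) \<in> chow_ideal"
    by (intro chow_ideal_add chow_ideal_mult Suc Phi_step S PC_var)
  then show ?case by (simp add: algebra_simps)
qed

text \<open>The Todd series of x_S without its constant term, divided by x_S, and cut off where x_S
  times the next power lies in the ideal.\<close>

definition todd_factor :: "'n::finite set \<Rightarrow> 'n set_poly" where
  "todd_factor S = (\<Sum>n\<le>CARD('n set). const (todd_coeff (Suc n)) * var S ^ n)"

lemma PC_todd_factor [intro]: "S \<in> proper_subsets \<Longrightarrow> todd_factor S \<in> PC"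
  unfolding todd_factor_def by (intro PC_sum PC_mult PC_const PC_power PC_var)

lemma series0_support:
  assumes "\<And>J. V J \<noteq> 0 \<Longrightarrow> H \<subseteq> J" "S \<in> H" "series0 c S V J \<noteq> 0"
  shows "H \<subseteq> J"
proof -
  from assms(3) obtain n where "(step0 S ^^ n) V J \<noteq> 0"
    unfolding series0_def by (metis (no_types, lifting) mult_zero_right sum.neutral)
  then show ?thesis using step_power_support[OF assms(1)] assms(2) by blast
qed

lemma Phi_series0:
  fixes S :: "'n::finite set"
  assumes S: "S \<in> proper_subsets" and V: "\<And>J. V J \<noteq> 0 \<Longrightarrow> S \<in> J"
  shows "Phi (series0 todd_coeff S V) - todd_factor S * Phi V \<in> chow_ideal"
proof -
  have "Phi (series0 todd_coeff S V) - todd_factor S * Phi V =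
      (\<Sum>n\<le>CARD('n set). const (todd_coeff (Suc n)) * (Phi ((step0 S ^^ n) V) - var S ^ n * Phi V))"
    unfolding series0_def Phi_sum todd_factor_def
    by (simp add: sum_distrib_right right_diff_distrib sum_subtractf mult.assoc)
  also have "\<dots> \<in> chow_ideal"
    by (intro chow_ideal_sum chow_ideal_mult PC_const Phi_step_power S V)
  finally show ?thesis .
qed

lemma Phi_proc0:
  fixes Hs :: "'n::finite set list"
  assumes "set Hs \<subseteq> proper_subsets" "set Hs \<subseteq> H" "\<And>J. V J \<noteq> 0 \<Longrightarrow> H \<subseteq> J"
  shows "Phi (proc0 todd_coeff Hs V) - (\<Prod>h\<leftarrow>Hs. todd_factor h) * Phi V \<in> chow_ideal"
  using assms
proof (induction Hs arbitrary: V)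
  case Nil
  then show ?case by (simp add: chow_ideal_0)
next
  case (Cons h Hs)
  let ?W = "series0 todd_coeff h V"
  have 1: "Phi (proc0 todd_coeff Hs ?W) - (\<Prod>h\<leftarrow>Hs. todd_factor h) * Phi ?W \<in> chow_ideal"
    by (rule Cons.IH) (use Cons.prems series0_support[of V H h] in auto)
  have 2: "Phi ?W - todd_factor h * Phi V \<in> chow_ideal"
    by (rule Phi_series0) (use Cons.prems in auto)
  have "(\<Prod>h\<leftarrow>Hs. todd_factor h) \<in> PC" using Cons.prems(1) by (induction Hs) auto
  from chow_ideal_add[OF 1 chow_ideal_mult[OF this 2]] show ?case
    by (simp add: algebra_simps)
qed

text \<open>Starting from x_S itself, m further factors amount to m applications of the nilpotent
  \<open>step0\<close>; hence a bound one larger than for the operator.\<close>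

lemma var_nilpotent:
  fixes S :: "'n::finite set"
  assumes "S \<in> proper_subsets" "n > Suc CARD('n set)"
  shows "var S ^ n \<in> chow_ideal"
proof -
  obtain m where m: "n = Suc m" "m > CARD('n set)" using assms(2) by (cases n) auto
  have "(step0 S ^^ m) (delta {S}) K = (0 :: rat)" for K
    using m(2) card_mono[OF finite subset_UNIV, of K] by (intro step0_nilpotent) simp
  then have z: "Phi ((step0 S ^^ m) (delta {S})) = 0"
    by (simp add: Phi_def const_simps)
  have "Phi ((step0 S ^^ m) (delta {S})) - var S ^ m * Phi (delta {S}) \<in> chow_ideal"
    using assms by (intro Phi_step_power) (auto simp: delta_def split: if_splits)
  then have "- (var S ^ m * var S) \<in> chow_ideal"
    using assms by (simp add: z Phi_delta monom_of_def)
  from chow_ideal_uminus[OF this] show ?thesis by (simp add: m(1) mult.commute)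
qed

lemma chow_prod_cong:
  assumes "finite I" "\<And>i. i \<in> I \<Longrightarrow> f i \<in> PC" "\<And>i. i \<in> I \<Longrightarrow> g i \<in> PC" "\<And>i. i \<in> I \<Longrightarrow> f i - g i \<in> chow_ideal"
  shows "prod f I - prod g I \<in> (chow_ideal :: 'n::finite set_poly set)"
  using assms
proof (induction I rule: finite_induct)
  case (insert i I)
  have "prod f (insert i I) - prod g (insert i I) = (f i - g i) * prod f I + g i * (prod f I - prod g I)"
    using insert by (simp add: algebra_simps)
  also have "\<dots> \<in> chow_ideal"
    using insert by (intro chow_ideal_add chow_ideal_mult chow_ideal_mult_right PC_prod) auto
  finally show ?case .
qed (simp add: chow_ideal_0)

text \<open>The index set in \<open>todd_class\<close> depends on the ideal. By nilpotency it lies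
  in an initial segment, and the terms missing from that segment are in the ideal by the choice of
  the index set.\<close>

lemma todd_truncate:
  fixes S :: "'n::finite set"
  assumes S: "S \<in> proper_subsets"
  shows "(\<Sum>n | var S ^ n \<notin> chow_ideal. const (todd_coeff n) * var S ^ n) - (1 + var S * todd_factor S) \<in> chow_ideal"
    (is "?a - ?b \<in> _")
proof -
  let ?N = "{n. var S ^ n \<notin> chow_ideal}" and ?M = "{..Suc CARD('n set)}"
  have b: "?b = (\<Sum>n\<le>Suc CARD('n set). const (todd_coeff n) * var S ^ n)"
  proof -
    have "?b = const (todd_coeff 0) * var S ^ 0 + (\<Sum>n\<le>CARD('n set). const (todd_coeff (Suc n)) * var S ^ Suc n)"
      unfolding todd_factor_def sum_distrib_left
      by (intro arg_cong2[where f="(+)"] sum.cong refl)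
        (simp only: todd_coeff_0 const_simps(2) power_0 mult_1, simp only: power_Suc mult.left_commute)
    also have "\<dots> = (\<Sum>n\<le>Suc CARD('n set). const (todd_coeff n) * var S ^ n)"
      by (rule sum.atMost_Suc_shift[symmetric])
    finally show ?thesis .
  qed
  have sub: "?N \<subseteq> ?M"
  proof
    fix n assume "n \<in> ?N"
    then have "\<not> Suc CARD('n set) < n" using var_nilpotent[OF S, of n] by blast
    then show "n \<in> ?M" by (simp only: atMost_iff not_less)
  qed
  have "?b = (\<Sum>n\<in>?M - ?N. const (todd_coeff n) * var S ^ n) + ?a"
    unfolding b by (rule sum.subset_diff[OF sub]) simp
  then have "?a - ?b = - (\<Sum>n\<in>?M - ?N. const (todd_coeff n) * var S ^ n)" by simp
  also have "\<dots> \<in> chow_ideal"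
    by (intro chow_ideal_uminus chow_ideal_sum chow_ideal_mult PC_const) auto
  finally show ?thesis .
qed

text \<open>Expanding the product selects the set H of variables that occur, which are the heads.
  Non-chains vanish, and each chain contributes its monomial times Todd factors, which the reduction
  rewrites. Non-chains among the resulting monomials are discarded a second time.\<close>

theorem todd_class_eq:
  "(todd_class :: 'n::finite set_poly set) =
     chow_class (\<Sum>Ts\<in>chains_of_subsets. const (alpha Ts) * chain_monomial Ts)"
  unfolding todd_class_def
proof (rule chow_class_eqI)
  let ?C = "chains_of_subsets :: 'n set list set" and ?P = "proper_subsets :: 'n set set"
  let ?t = "\<lambda>S. \<Sum>n | var S ^ n \<notin> chow_ideal. const (todd_coeff n) * var S ^ n :: 'n set_poly"
  let ?m = "\<lambda>H. monom_of H * prod todd_factor H :: 'n set_poly"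
  let ?R = "\<Sum>Ts\<in>?C. const (alpha Ts) * chain_monomial Ts"
  let ?E = "\<lambda>Hs :: 'n set list. proc0 todd_coeff Hs (delta (set Hs))"
  show p1: "(\<Prod>S\<in>?P. ?t S) \<in> PC"
    by (intro PC_prod PC_sum PC_mult PC_const PC_power PC_var)
  show p2: "?R \<in> PC"
    unfolding chain_monomial_def
    by (intro PC_sum PC_mult PC_const PC_prod PC_var) (auto simp: chains_of_subsets_def)
  have 1: "(\<Prod>S\<in>?P. ?t S) - (\<Prod>S\<in>?P. 1 + var S * todd_factor S) \<in> chow_ideal"
    by (intro chow_prod_cong todd_truncate PC_sum PC_add PC_1 PC_mult PC_const PC_power PC_var PC_todd_factor) auto
  \<comment> \<open>The summands are exchanged so that in \<open>prod_add\<close> the set H marks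
    the variables that occur.\<close>
  have "(\<Prod>S\<in>?P. 1 + var S * todd_factor S) = (\<Prod>S\<in>?P. var S * todd_factor S + 1)"
    by (simp add: add.commute)
  also have "\<dots> = (\<Sum>H\<in>Pow ?P. ?m H)"
    by (subst prod_add) (auto simp: prod.distrib monom_of_def)
  also have "\<dots> = (\<Sum>H\<in>{H\<in>Pow ?P. chain_set H}. ?m H) + (\<Sum>H\<in>Pow ?P - {H\<in>Pow ?P. chain_set H}. ?m H)"
    by (subst sum.subset_diff[of "{H\<in>Pow ?P. chain_set H}"]) (auto simp: add.commute)
  also have "(\<Sum>H\<in>{H\<in>Pow ?P. chain_set H}. ?m H) = (\<Sum>Hs\<in>?C. ?m (set Hs))"
    by (rule sum.reindex_bij_betw[OF bij_chain_lists, symmetric])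
  finally have prod_eq: "(\<Prod>S\<in>?P. 1 + var S * todd_factor S) =
     (\<Sum>Hs\<in>?C. ?m (set Hs)) + (\<Sum>H\<in>Pow ?P - {H\<in>Pow ?P. chain_set H}. ?m H)" .
  have "(\<Sum>H\<in>Pow ?P - {H\<in>Pow ?P. chain_set H}. ?m H) \<in> chow_ideal"
    by (intro chow_ideal_sum chow_ideal_mult_right monom_of_nonchain PC_prod PC_todd_factor) auto
  then have 2: "(\<Prod>S\<in>?P. 1 + var S * todd_factor S) - (\<Sum>Hs\<in>?C. ?m (set Hs)) \<in> chow_ideal"
    unfolding prod_eq by simp
  have "(\<Sum>Hs\<in>?C. Phi (?E Hs) - ?m (set Hs)) \<in> chow_ideal"
  proof (rule chow_ideal_sum)
    fix Hs assume Hs: "Hs \<in> ?C"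
    then have *: "set Hs \<subseteq> ?P" "sorted_wrt (\<subset>) Hs" by (auto simp: chains_of_subsets_def)
    have "distinct Hs" using *(2) by (induction Hs) auto
    then have "(\<Prod>h\<leftarrow>Hs. todd_factor h) = prod todd_factor (set Hs)" by (simp add: prod.distinct_set_conv_list)
    then show "Phi (?E Hs) - ?m (set Hs) \<in> chow_ideal"
      using Phi_proc0[of Hs "set Hs" "delta (set Hs)"] *(1)
      by (simp add: Phi_delta mult.commute) (auto simp: delta_def split: if_splits)
  qed
  then have 3: "(\<Sum>Hs\<in>?C. ?m (set Hs)) - (\<Sum>Hs\<in>?C. Phi (?E Hs)) \<in> chow_ideal"
    using chow_ideal_uminus by (fastforce simp: sum_subtractf)
  have "(\<Sum>Hs\<in>?C. Phi (?E Hs)) = (\<Sum>J\<in>Pow ?P. const (\<Sum>Hs\<in>?C. ?E Hs J) * monom_of J)"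
    unfolding Phi_def const_sum sum_distrib_right by (rule sum.swap)
  also have "\<dots> = (\<Sum>J\<in>{J\<in>Pow ?P. chain_set J}. const (\<Sum>Hs\<in>?C. ?E Hs J) * monom_of J) +
      (\<Sum>J\<in>Pow ?P - {J\<in>Pow ?P. chain_set J}. const (\<Sum>Hs\<in>?C. ?E Hs J) * monom_of J)"
    by (subst sum.subset_diff[of "{H\<in>Pow ?P. chain_set H}"]) (auto simp: add.commute)
  also have "(\<Sum>J\<in>{J\<in>Pow ?P. chain_set J}. const (\<Sum>Hs\<in>?C. ?E Hs J) * monom_of J) =
      (\<Sum>Ts\<in>?C. const (\<Sum>Hs\<in>?C. ?E Hs (set Ts)) * monom_of (set Ts))"
    by (rule sum.reindex_bij_betw[OF bij_chain_lists, symmetric])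
  also have "\<dots> = ?R"
    by (intro sum.cong refl) (simp add: alpha_eq_proc0 monom_of_def chain_monomial_def)
  finally have eq: "(\<Sum>Hs\<in>?C. Phi (?E Hs)) = ?R +
      (\<Sum>J\<in>Pow ?P - {J\<in>Pow ?P. chain_set J}. const (\<Sum>Hs\<in>?C. ?E Hs J) * monom_of J)" .
  have "(\<Sum>J\<in>Pow ?P - {J\<in>Pow ?P. chain_set J}. const (\<Sum>Hs\<in>?C. ?E Hs J) * monom_of J) \<in> chow_ideal"
    by (intro chow_ideal_sum chow_ideal_mult monom_of_nonchain PC_const) auto
  then have 4: "(\<Sum>Hs\<in>?C. Phi (?E Hs)) - ?R \<in> chow_ideal" unfolding eq by simp
  from chow_ideal_add[OF chow_ideal_add[OF 1 2] chow_ideal_add[OF 3 4]]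
  show "(\<Prod>S\<in>?P. ?t S) - ?R \<in> chow_ideal" by simp
qed

section \<open>Power series in several variables\<close>

definition vmon :: "real ^ 'n \<Rightarrow> ('n \<Rightarrow> nat) \<Rightarrow> real" where
  "vmon \<xi> k = (\<Prod>i\<in>UNIV. (\<xi> $ i) ^ k i)"

definition vdeg :: "('n::finite \<Rightarrow> nat) \<Rightarrow> nat" where
  "vdeg k = (\<Sum>i\<in>UNIV. k i)"

definition box_pt :: "real \<Rightarrow> real ^ 'n \<Rightarrow> bool" where
  "box_pt r \<xi> \<longleftrightarrow> (\<forall>i. \<bar>\<xi> $ i\<bar> \<le> r)"

text \<open>A weighted l1 bound on the coefficients of some power series of g that converges on the
  cube of radius r. Unlike bare analyticity it comes with a number that can be summed over
  infinitely many functions.\<close>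

definition majorized :: "real \<Rightarrow> (real ^ 'n \<Rightarrow> real) \<Rightarrow> real \<Rightarrow> bool" where
  "majorized r g B \<longleftrightarrow> (\<exists>a s. ((\<lambda>k. \<bar>a k\<bar> * r ^ vdeg k) has_sum s) UNIV \<and> s \<le> B \<and>
     (\<forall>\<xi>. box_pt r \<xi> \<longrightarrow> ((\<lambda>k. a k * vmon \<xi> k) has_sum g \<xi>) UNIV))"

lemma vmon_bound: "box_pt r \<xi> \<Longrightarrow> \<bar>vmon \<xi> k\<bar> \<le> r ^ vdeg k"
  unfolding vmon_def vdeg_def power_sum abs_prod power_abs
  by (intro prod_mono) (auto simp: box_pt_def intro!: power_mono)

lemma majorized_mono: "majorized r g B \<Longrightarrow> B \<le> B' \<Longrightarrow> majorized r g B'"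
  unfolding majorized_def by (meson order_trans)

lemma majorized_cmult:
  assumes "majorized r g B"
  shows "majorized r (\<lambda>\<xi>. c * g \<xi>) (\<bar>c\<bar> * B)"
proof -
  obtain a s where a: "((\<lambda>k. \<bar>a k\<bar> * r ^ vdeg k) has_sum s) UNIV" "s \<le> B"
     "\<And>\<xi>. box_pt r \<xi> \<Longrightarrow> ((\<lambda>k. a k * vmon \<xi> k) has_sum g \<xi>) UNIV"
    using assms unfolding majorized_def by blast
  show ?thesis unfolding majorized_def
    using has_sum_cmult_right[OF a(1), of "\<bar>c\<bar>"] mult_left_mono[OF a(2), of "\<bar>c\<bar>"] has_sum_cmult_right[OF a(3), of _ c]
    by (intro exI[of _ "\<lambda>k. c * a k"] exI[of _ "\<bar>c\<bar> * s"]) (auto simp: abs_mult mult_ac)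
qed

lemma majorized_add:
  assumes "majorized r g B" "majorized r h B'" "0 \<le> r"
  shows "majorized r (\<lambda>\<xi>. g \<xi> + h \<xi>) (B + B')"
proof -
  obtain a s where a: "((\<lambda>k. \<bar>a k\<bar> * r ^ vdeg k) has_sum s) UNIV" "s \<le> B"
     "\<And>\<xi>. box_pt r \<xi> \<Longrightarrow> ((\<lambda>k. a k * vmon \<xi> k) has_sum g \<xi>) UNIV"
    using assms unfolding majorized_def by blast
  obtain b t where b: "((\<lambda>k. \<bar>b k\<bar> * r ^ vdeg k) has_sum t) UNIV" "t \<le> B'"
     "\<And>\<xi>. box_pt r \<xi> \<Longrightarrow> ((\<lambda>k. b k * vmon \<xi> k) has_sum h \<xi>) UNIV"
    using assms unfolding majorized_def by blast
  have ab: "((\<lambda>k. (\<bar>a k\<bar> + \<bar>b k\<bar>) * r ^ vdeg k) has_sum s + t) UNIV"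
    using has_sum_add[OF a(1) b(1)] by (simp add: algebra_simps)
  have le: "\<bar>a k + b k\<bar> * r ^ vdeg k \<le> (\<bar>a k\<bar> + \<bar>b k\<bar>) * r ^ vdeg k" for k
    using assms(3) by (intro mult_right_mono abs_triangle_ineq) auto
  then have "(\<lambda>k. \<bar>a k + b k\<bar> * r ^ vdeg k) summable_on UNIV"
    using assms(3) by (intro summable_on_comparison_test[OF has_sum_imp_summable[OF ab]]) auto
  then obtain u where u: "((\<lambda>k. \<bar>a k + b k\<bar> * r ^ vdeg k) has_sum u) UNIV"
    using summable_iff_has_sum_infsum by blast
  have "u \<le> s + t" by (rule has_sum_mono[OF u ab le])
  moreover have "((\<lambda>k. (a k + b k) * vmon \<xi> k) has_sum (g \<xi> + h \<xi>)) UNIV" if "box_pt r \<xi>" for \<xi>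
    using has_sum_add[OF a(3) b(3), OF that that] by (simp add: algebra_simps)
  ultimately show ?thesis unfolding majorized_def using u a(2) b(2)
    by (intro exI[of _ "\<lambda>k. a k + b k"] exI[of _ u]) auto
qed

lemma majorized_const: "majorized r (\<lambda>_ :: real ^ 'n::finite. c) \<bar>c\<bar>"
proof -
  have v0: "vmon \<xi> (\<lambda>_. 0) = 1" "vdeg (\<lambda>_::'n. 0) = 0" for \<xi> :: "real ^ 'n"
    by (simp_all add: vmon_def vdeg_def)
  have "((\<lambda>k. (if k = (\<lambda>_. 0) then c else 0) * vmon \<xi> k) has_sum c) UNIV" for \<xi> :: "real ^ 'n"
    by (rule has_sum_finite_neutralI[of "{\<lambda>_. 0}"]) (auto simp: v0)
  moreover have "((\<lambda>k. \<bar>if k = (\<lambda>_::'n. 0) then c else 0\<bar> * r ^ vdeg k) has_sum \<bar>c\<bar>) UNIV"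
    by (rule has_sum_finite_neutralI[of "{\<lambda>_. 0}"]) (auto simp: v0)
  ultimately show ?thesis unfolding majorized_def
    by (intro exI[of _ "\<lambda>k. if k = (\<lambda>_. 0) then c else 0"] exI[of _ "\<bar>c\<bar>"]) auto
qed

lemma majorized_0: "majorized r (\<lambda>_. 0) 0"
  using majorized_const[of r 0] by simp

lemma majorized_finite_sum:
  assumes "\<And>i. i \<in> I \<Longrightarrow> majorized r (g i) (B i)" "0 \<le> r"
  shows "majorized r (\<lambda>\<xi>. \<Sum>i\<in>I. g i \<xi>) (\<Sum>i\<in>I. B i)"
  using assms
proof (induction I rule: infinite_finite_induct)
  case (insert x F)
  then show ?case using majorized_add[of r "g x" "B x" "\<lambda>\<xi>. \<Sum>i\<in>F. g i \<xi>" "\<Sum>i\<in>F. B i"] by simp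
qed (auto simp: majorized_0)

lemma majorized_coord:
  fixes g :: "real ^ 'n \<Rightarrow> real"
  assumes "majorized r g B" "0 \<le> r"
  shows "majorized r (\<lambda>\<xi>. \<xi> $ i * g \<xi>) (r * B)"
proof -
  obtain a s where a: "((\<lambda>k. \<bar>a k\<bar> * r ^ vdeg k) has_sum s) UNIV" "s \<le> B"
     "\<And>\<xi>. box_pt r \<xi> \<Longrightarrow> ((\<lambda>k. a k * vmon \<xi> k) has_sum g \<xi>) UNIV"
    using assms unfolding majorized_def by blast
  define up :: "('n \<Rightarrow> nat) \<Rightarrow> 'n \<Rightarrow> nat" where "up k = k(i := Suc (k i))" for k
  \<comment> \<open>The truncated subtraction at \<open>k i = 0\<close> is never seen, because b is
    0 there.\<close>
  define dn :: "('n \<Rightarrow> nat) \<Rightarrow> 'n \<Rightarrow> nat" where "dn k = k(i := k i - 1)" for k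
  define b where "b k = (if k i = 0 then 0 else a (dn k))" for k
  have bij: "bij_betw up UNIV {k. k i \<noteq> 0}"
    by (rule bij_betw_byWitness[where f'=dn]) (auto simp: up_def dn_def fun_eq_iff)
  have dnup: "dn (up k) = k" "up k i \<noteq> 0" for k by (auto simp: up_def dn_def fun_eq_iff)
  have deg: "vdeg (up k) = Suc (vdeg k)" for k
    unfolding vdeg_def up_def by (subst (1 2) sum.remove[of _ i]) auto
  have mon: "vmon \<xi> (up k) = \<xi> $ i * vmon \<xi> k" for \<xi> k
    unfolding vmon_def up_def by (subst (1 2) prod.remove[of _ i]) auto
  have 1: "((\<lambda>k. \<bar>b k\<bar> * r ^ vdeg k) has_sum r * s) UNIV"
  proof -
    have "((\<lambda>k. \<bar>b (up k)\<bar> * r ^ vdeg (up k)) has_sum r * s) UNIV"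
      using has_sum_cmult_right[OF a(1), of r] by (simp add: b_def dnup deg mult_ac)
    then have "((\<lambda>k. \<bar>b k\<bar> * r ^ vdeg k) has_sum r * s) {k. k i \<noteq> 0}"
      using has_sum_reindex_bij_betw[OF bij, of "\<lambda>k. \<bar>b k\<bar> * r ^ vdeg k"] by simp
    then show ?thesis by (subst has_sum_cong_neutral[where S=UNIV and T="{k. k i \<noteq> 0}"]) (auto simp: b_def)
  qed
  have 2: "((\<lambda>k. b k * vmon \<xi> k) has_sum \<xi> $ i * g \<xi>) UNIV" if "box_pt r \<xi>" for \<xi>
  proof -
    have "((\<lambda>k. b (up k) * vmon \<xi> (up k)) has_sum \<xi> $ i * g \<xi>) UNIV"
      using has_sum_cmult_right[OF a(3)[OF that], of "\<xi> $ i"] by (simp add: b_def dnup mon mult_ac)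
    then have "((\<lambda>k. b k * vmon \<xi> k) has_sum \<xi> $ i * g \<xi>) {k. k i \<noteq> 0}"
      using has_sum_reindex_bij_betw[OF bij, of "\<lambda>k. b k * vmon \<xi> k"] by simp
    then show ?thesis by (subst has_sum_cong_neutral[where S=UNIV and T="{k. k i \<noteq> 0}"]) (auto simp: b_def)
  qed
  show ?thesis unfolding majorized_def using 1 2 mult_left_mono[OF a(2) assms(2)]
    by (intro exI[of _ b] exI[of _ "r * s"]) auto
qed

lemma majorized_inner:
  assumes "majorized r g B" "0 \<le> r"
  shows "majorized r (\<lambda>\<xi>. (\<xi> \<bullet> v) * g \<xi>) ((\<Sum>i\<in>UNIV. \<bar>v $ i\<bar>) * r * B)"
proof -
  have "majorized r (\<lambda>\<xi>. \<Sum>i\<in>UNIV. v $ i * (\<xi> $ i * g \<xi>)) (\<Sum>i\<in>UNIV. \<bar>v $ i\<bar> * (r * B))"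
    by (intro majorized_finite_sum majorized_cmult majorized_coord assms)
  then show ?thesis
    by (simp add: inner_vec_def sum_distrib_left sum_distrib_right mult_ac)
qed

text \<open>The bounds make the double family of coefficients absolutely summable, so the sum over m
  and the sum over monomials may be exchanged.\<close>

lemma majorized_sums:
  assumes g: "\<And>m. majorized r (g m) (b m)" and b: "summable b" and r: "0 < r"
    and G: "\<And>\<xi>. box_pt r \<xi> \<Longrightarrow> (\<lambda>m. g m \<xi>) sums G \<xi>"
  shows "majorized r G (suminf b)"
proof -
  define Q where "Q m a s \<longleftrightarrow> ((\<lambda>k. \<bar>a k\<bar> * r ^ vdeg k) has_sum s) UNIV \<and> s \<le> b m \<and>
     (\<forall>\<xi>. box_pt r \<xi> \<longrightarrow> ((\<lambda>k. a k * vmon \<xi> k) has_sum g m \<xi>) UNIV)" for m a s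
  have "\<forall>m. \<exists>a s. Q m a s" using g by (simp add: majorized_def Q_def)
  then obtain a s where "\<forall>m. Q m (a m) (s m)" by metis
  then have a: "\<And>m. ((\<lambda>k. \<bar>a m k\<bar> * r ^ vdeg k) has_sum s m) UNIV" "\<And>m. s m \<le> b m"
     "\<And>m \<xi>. box_pt r \<xi> \<Longrightarrow> ((\<lambda>k. a m k * vmon \<xi> k) has_sum g m \<xi>) UNIV"
    by (auto simp: Q_def)
  have s0: "0 \<le> s m" for m by (rule has_sum_nonneg[OF a(1)]) (use r in auto)
  have b0: "0 \<le> b m" for m using s0 a(2) order_trans by blast
  have bs: "(b has_sum suminf b) UNIV"
    using b b0 by (intro sums_nonneg_imp_has_sum summable_sums) auto
  then have ss: "s summable_on UNIV"
    using s0 a(2) by (intro summable_on_comparison_test[OF has_sum_imp_summable[OF bs]]) auto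
  let ?F = "\<lambda>(m, k). \<bar>a m k\<bar> * r ^ vdeg k"
  have F: "?F summable_on (UNIV \<times> UNIV)"
    by (rule summable_on_SigmaI[where g=s]) (use a(1) ss r in auto)
  obtain tot where tot: "(?F has_sum tot) (UNIV \<times> UNIV)" using F summable_iff_has_sum_infsum by blast
  have tots: "(s has_sum tot) UNIV" by (rule has_sum_SigmaD[OF tot]) (use a(1) in auto)
  have tot_le: "tot \<le> suminf b" by (rule has_sum_mono[OF tots bs a(2)])
  have tot': "((\<lambda>(k, m). \<bar>a m k\<bar> * r ^ vdeg k) has_sum tot) (UNIV \<times> UNIV)"
    using tot by (subst has_sum_swap) (simp add: case_prod_unfold)
  have colF: "(\<lambda>m. \<bar>a m k\<bar> * r ^ vdeg k) summable_on UNIV" for k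
    using summable_on_SigmaD1[of "\<lambda>k m. \<bar>a m k\<bar> * r ^ vdeg k" UNIV "\<lambda>_. UNIV" k] tot' has_sum_imp_summable by fastforce
  have col: "(\<lambda>m. \<bar>a m k\<bar>) summable_on UNIV" for k
    using summable_on_cmult_left[OF colF, of k "inverse (r ^ vdeg k)"] r
    by (simp add: mult.assoc)
  have colA: "(\<lambda>m. a m k) summable_on UNIV" for k
    by (rule abs_summable_summable) (use col[of k] in simp)
  define A where "A k = (\<Sum>\<^sub>\<infinity>m. a m k)" for k
  have A: "((\<lambda>m. a m k) has_sum A k) UNIV" for k
    unfolding A_def using colA by simp
  define t where "t k = (\<Sum>\<^sub>\<infinity>m. \<bar>a m k\<bar> * r ^ vdeg k)" for k
  have t: "((\<lambda>m. \<bar>a m k\<bar> * r ^ vdeg k) has_sum t k) UNIV" for k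
    unfolding t_def using colF by simp
  have ts: "(t has_sum tot) UNIV" by (rule has_sum_SigmaD[OF tot']) (use t in auto)
  have At: "\<bar>A k\<bar> * r ^ vdeg k \<le> t k" for k
  proof -
    have "((\<lambda>m. \<bar>a m k\<bar>) has_sum (\<Sum>\<^sub>\<infinity>m. \<bar>a m k\<bar>)) UNIV" using col by simp
    moreover from this have "\<bar>A k\<bar> \<le> (\<Sum>\<^sub>\<infinity>m. \<bar>a m k\<bar>)"
      using norm_has_sum_bound[of "\<lambda>m. a m k" UNIV "\<Sum>\<^sub>\<infinity>m. \<bar>a m k\<bar>" "A k"] A by simp
    moreover have "t k = (\<Sum>\<^sub>\<infinity>m. \<bar>a m k\<bar>) * r ^ vdeg k"
      unfolding t_def by (rule infsum_cmult_left) (use col in auto)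
    ultimately show ?thesis using r by (simp add: mult_right_mono)
  qed
  have "(\<lambda>k. \<bar>A k\<bar> * r ^ vdeg k) summable_on UNIV"
    using At r by (intro summable_on_comparison_test[OF has_sum_imp_summable[OF ts]]) auto
  then obtain u where u: "((\<lambda>k. \<bar>A k\<bar> * r ^ vdeg k) has_sum u) UNIV"
    using summable_iff_has_sum_infsum by blast
  have "u \<le> tot" by (rule has_sum_mono[OF u ts At])
  moreover have "((\<lambda>k. A k * vmon \<xi> k) has_sum G \<xi>) UNIV" if \<xi>: "box_pt r \<xi>" for \<xi>
  proof -
    let ?H = "\<lambda>(m, k). a m k * vmon \<xi> k"
    have "(\<lambda>p. norm (?H p)) summable_on (UNIV \<times> UNIV)"
      using vmon_bound[OF \<xi>] by (intro Infinite_Sum.abs_summable_on_comparison_test'[OF F]) (auto simp: abs_mult mult_left_mono)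
    then have "?H summable_on (UNIV \<times> UNIV)" by (rule abs_summable_summable)
    then obtain S where S: "(?H has_sum S) (UNIV \<times> UNIV)" using summable_iff_has_sum_infsum by blast
    have "((\<lambda>m. g m \<xi>) has_sum S) UNIV" by (rule has_sum_SigmaD[OF S]) (use a(3)[OF \<xi>] in auto)
    then have "(\<lambda>m. g m \<xi>) sums S" by (rule has_sum_imp_sums)
    then have "S = G \<xi>" using G[OF \<xi>] sums_unique2 by blast
    moreover have S': "((\<lambda>(k, m). a m k * vmon \<xi> k) has_sum S) (UNIV \<times> UNIV)"
      using S by (subst has_sum_swap) (simp add: case_prod_unfold)
    have "((\<lambda>k. A k * vmon \<xi> k) has_sum S) UNIV"
      by (rule has_sum_SigmaD[OF S']) (use has_sum_cmult_left[OF A] in auto)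
    ultimately show ?thesis by simp
  qed
  ultimately show ?thesis unfolding majorized_def using u tot_le by (intro exI[of _ A] exI[of _ u]) auto
qed

lemma box_pt_ball: "\<xi> \<in> ball 0 r \<Longrightarrow> box_pt r \<xi>"
  unfolding box_pt_def using component_le_norm_cart[of \<xi>] by (force intro: order_trans)

lemma majorized_analytic: "majorized r g B \<Longrightarrow> 0 < r \<Longrightarrow> analytic_at_0 g"
  unfolding majorized_def analytic_at_0_def vmon_def using box_pt_ball[of _ r] by blast

lemma analytic_at_0_diff:
  assumes "analytic_at_0 g" "analytic_at_0 h"
  shows "analytic_at_0 (\<lambda>\<xi>. g \<xi> - h \<xi>)"
proof -
  obtain a r where a: "r > 0" "\<And>\<xi>. \<xi> \<in> ball 0 r \<Longrightarrow> ((\<lambda>k. a k * (\<Prod>i\<in>UNIV. (\<xi> $ i) ^ k i)) has_sum g \<xi>) UNIV"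
    using assms unfolding analytic_at_0_def by blast
  obtain b s where b: "s > 0" "\<And>\<xi>. \<xi> \<in> ball 0 s \<Longrightarrow> ((\<lambda>k. b k * (\<Prod>i\<in>UNIV. (\<xi> $ i) ^ k i)) has_sum h \<xi>) UNIV"
    using assms unfolding analytic_at_0_def by blast
  have "((\<lambda>k. (a k - b k) * (\<Prod>i\<in>UNIV. (\<xi> $ i) ^ k i)) has_sum g \<xi> - h \<xi>) UNIV" if "\<xi> \<in> ball 0 (min r s)" for \<xi>
    using has_sum_add[OF a(2) has_sum_uminusI[OF b(2)], of \<xi> \<xi>] that by (simp add: algebra_simps)
  then show ?thesis unfolding analytic_at_0_def using a(1) b(1)
    by (intro exI[of _ "\<lambda>k. a k - b k"] exI[of _ "min r s"]) auto
qed

section \<open>The identity theorem on an open cone\<close>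

lemma finite_vdeg: "finite {k :: 'n::finite \<Rightarrow> nat. vdeg k = m}"
proof -
  have "k i \<le> vdeg k" for k and i :: 'n
    unfolding vdeg_def by (rule member_le_sum) auto
  then have "{k :: 'n \<Rightarrow> nat. vdeg k = m} \<subseteq> PiE UNIV (\<lambda>_. {..m})" by auto
  then show ?thesis by (rule finite_subset) (intro finite_PiE, auto)
qed

lemma vmon_scale: "vmon (c *\<^sub>R \<xi>) k = c ^ vdeg k * vmon \<xi> k"
  by (simp add: vmon_def vdeg_def power_sum power_mult_distrib prod.distrib)

text \<open>Zeros on one side of the origin suffice: once the lower coefficients vanish, f t / t^m
  is a power series in t whose limit at 0 from the right is \<open>c m\<close>.\<close>

lemma powser_zero_right:
  fixes c :: "nat \<Rightarrow> real"
  assumes r: "r > 0" and s: "\<And>t. \<bar>t\<bar> < r \<Longrightarrow> (\<lambda>n. c n * t ^ n) sums f t"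
    and e: "e > 0" and z: "\<And>t. 0 < t \<Longrightarrow> t < e \<Longrightarrow> f t = 0"
  shows "c m = 0"
proof (induction m rule: less_induct)
  case (less m)
  define h where "h t = suminf (\<lambda>n. c (n + m) * t ^ n)" for t
  have h: "(\<lambda>n. c (n + m) * t ^ n) sums h t" "f t = t ^ m * h t" if "\<bar>t\<bar> < r" "t \<noteq> 0" for t
  proof -
    have "(\<lambda>n. c (n + m) * t ^ (n + m)) sums (f t - (\<Sum>i<m. c i * t ^ i))"
      by (rule sums_split_initial_segment[OF s[OF that(1)]])
    then have 1: "(\<lambda>n. c (n + m) * t ^ (n + m)) sums f t" using less by simp
    from sums_mult[OF this, of "inverse (t ^ m)"]
    have 2: "(\<lambda>n. c (n + m) * t ^ n) sums (inverse (t ^ m) * f t)"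
      using that by (simp add: power_add field_simps)
    then show "(\<lambda>n. c (n + m) * t ^ n) sums h t" unfolding h_def by (simp add: sums_iff)
    show "f t = t ^ m * h t" using 2 that unfolding h_def by (simp add: sums_iff field_simps)
  qed
  have "(h \<longlongrightarrow> c (0 + m)) (at 0)"
  proof (rule powser_limit_0_strong[OF r])
    fix t :: real assume "t \<noteq> 0" "norm t < r"
    then show "(\<lambda>n. c (n + m) * t ^ n) sums h t" using h by simp
  qed
  then have l: "(h \<longlongrightarrow> c m) (at_right 0)" by (simp add: filterlim_at_split)
  have "h t = 0" if "0 < t" "t < min e r" for t
    using h(2)[of t] z[of t] that by simp
  then have "\<forall>\<^sub>F t in at_right 0. h t = 0"
    unfolding eventually_at_right_field using e r by (intro exI[of _ "min e r"]) auto
  then have "(h \<longlongrightarrow> 0) (at_right 0)" by (simp add: tendsto_eventually)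
  then show ?case using l tendsto_unique trivial_limit_at_right_real by blast
qed

text \<open>Along a ray of U the function is a power series in one variable, so each homogeneous
  part P m vanishes on U. A polynomial vanishing on a nonempty open set is zero, and so g vanishes
  on a full ball although only the cone is controlled.\<close>

lemma analytic_zero_on_cone:
  fixes g :: "real ^ 'n \<Rightarrow> real"
  assumes g: "analytic_at_0 g" and U: "open U" "u \<in> U" "\<And>x t. x \<in> U \<Longrightarrow> t > 0 \<Longrightarrow> t *\<^sub>R x \<in> U"
    and z: "\<forall>\<^sub>F \<xi> in at 0 within U. g \<xi> = 0"
  shows "\<exists>r>0. \<forall>\<xi>\<in>ball 0 r. g \<xi> = 0"
proof -
  obtain a r where r: "r > 0" and a': "\<And>\<xi>. \<xi> \<in> ball 0 r \<Longrightarrow> ((\<lambda>k. a k * (\<Prod>i\<in>UNIV. (\<xi> $ i) ^ k i)) has_sum g \<xi>) UNIV"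
    using g unfolding analytic_at_0_def by blast
  then have a: "((\<lambda>k. a k * vmon \<xi> k) has_sum g \<xi>) UNIV" if "\<xi> \<in> ball 0 r" for \<xi>
    using that by (simp add: vmon_def)
  obtain e where e: "e > 0" "\<And>\<xi>. \<xi> \<in> U \<Longrightarrow> \<xi> \<noteq> 0 \<Longrightarrow> norm \<xi> < e \<Longrightarrow> g \<xi> = 0"
    using z unfolding eventually_at by (auto simp: dist_norm)
  define P where "P m \<xi> = (\<Sum>k | vdeg k = m. a k * vmon \<xi> k)" for m \<xi>
  have Pscale: "P m (c *\<^sub>R \<xi>) = c ^ m * P m \<xi>" for m c \<xi>
    unfolding P_def sum_distrib_left by (intro sum.cong) (auto simp: vmon_scale)
  have Psums: "(\<lambda>m. P m \<xi>) sums g \<xi>" if "\<xi> \<in> ball 0 r" for \<xi>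
  proof -
    have bij: "bij_betw snd (SIGMA m:UNIV. {k :: 'n \<Rightarrow> nat. vdeg k = m}) UNIV"
      by (rule bij_betw_byWitness[where f'="\<lambda>k. (vdeg k, k)"]) auto
    have "((\<lambda>p. a (snd p) * vmon \<xi> (snd p)) has_sum g \<xi>) (SIGMA m:UNIV. {k. vdeg k = m})"
      using a[OF that] has_sum_reindex_bij_betw[OF bij, of "\<lambda>k. a k * vmon \<xi> k"] by simp
    then have "((\<lambda>m. P m \<xi>) has_sum g \<xi>) UNIV"
      by (rule has_sum_SigmaD) (auto simp: P_def finite_vdeg)
    then show ?thesis by (rule has_sum_imp_sums)
  qed
  have PU: "P m \<xi> = 0" if \<xi>: "\<xi> \<in> U" "\<xi> \<noteq> 0" for m \<xi>
  proof (rule powser_zero_right[where c="\<lambda>m. P m \<xi>" and f="\<lambda>t. g (t *\<^sub>R \<xi>)"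
        and r="r / norm \<xi>" and e="e / norm \<xi>"])
    show "(\<lambda>n. P n \<xi> * t ^ n) sums g (t *\<^sub>R \<xi>)" if "\<bar>t\<bar> < r / norm \<xi>" for t
      using Psums[of "t *\<^sub>R \<xi>"] that \<xi> by (simp add: Pscale field_simps)
    show "g (t *\<^sub>R \<xi>) = 0" if "0 < t" "t < e / norm \<xi>" for t
      using that \<xi> by (intro e(2) U(3)) (auto simp: field_simps)
  qed (use r e \<xi> in auto)
  have "U \<noteq> {0}" using U(1) not_open_singleton by metis
  then obtain v where v: "v \<in> U" "v \<noteq> 0" using U(2) by blast
  \<comment> \<open>The origin is not covered by \<open>z\<close>. Scaling a point of U by 0 reaches
    it, also for m = 0, where the factor is 1 but P 0 v is 0.\<close>
  have P0: "P m 0 = 0" for m using Pscale[of m 0 v] PU[OF v] by simp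
  have "P m x = 0" for m x
  proof -
    \<comment> \<open>The homogeneous part on the line through x in direction v, as a polynomial in
      one variable.\<close>
    define q where "q = (\<Sum>k | vdeg k = m. smult (a k) (\<Prod>i\<in>UNIV. [:x $ i, v $ i:] ^ k i))"
    have q: "poly q t = P m (x + t *\<^sub>R v)" for t
      by (simp add: q_def P_def vmon_def poly_sum poly_prod)
    obtain d where d: "d > 0" "ball v d \<subseteq> U" using U(1) v(1) open_contains_ball by blast
    \<comment> \<open>For such t the point v + x / t lies in the ball around v, and scaling it by t
      stays in U; this gives q infinitely many zeros.\<close>
    have "poly q t = 0" if t: "t > norm x / d" for t
    proof -
      have t0: "t > 0" using t d by (smt (verit) divide_nonneg_pos norm_ge_zero)
      have "norm x < t * d" using t d by (simp add: field_simps)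
      then have "v + (1 / t) *\<^sub>R x \<in> ball v d" using t0 d by (simp add: dist_norm field_simps)
      then have "t *\<^sub>R (v + (1 / t) *\<^sub>R x) \<in> U" using d U(3) t0 by blast
      then have "x + t *\<^sub>R v \<in> U" using t0 by (simp add: algebra_simps)
      then show ?thesis using q P0 PU by metis
    qed
    then have "{norm x / d<..} \<subseteq> {t. poly q t = 0}" by auto
    then have "infinite {t. poly q t = 0}" using infinite_Ioi infinite_super by blast
    then have "q = 0" using poly_roots_finite by blast
    then show ?thesis using q[of 0] by simp
  qed
  then have "g \<xi> = 0" if "\<xi> \<in> ball 0 r" for \<xi>
    using Psums[OF that] by (simp add: sums_iff)
  then show ?thesis using r by blast
qed

section \<open>Lattice measures\<close>

abbreviation coord_measure :: "'a set \<Rightarrow> ('a \<Rightarrow> real) measure" where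
  "coord_measure B \<equiv> Pi\<^sub>M B (\<lambda>_. lborel)"

definition lin_comb :: "'a::real_vector set \<Rightarrow> ('a \<Rightarrow> real) \<Rightarrow> 'a" where
  "lin_comb B t = (\<Sum>b\<in>B. t b *\<^sub>R b)"

interpretation lborel_product: product_sigma_finite "\<lambda>_::'a. lborel :: real measure"
  by standard

lemma lin_comb_measurable [measurable]:
  "lin_comb B \<in> borel_measurable (coord_measure (B :: 'a::euclidean_space set))"
  unfolding lin_comb_def by measurable

lemma sigma_finite_coord: "finite B \<Longrightarrow> sigma_finite_measure (coord_measure B)"
  by (rule lborel_product.sigma_finite)

lemma coord_measure_translate:
  assumes B: "finite B"
  shows "distr (coord_measure B) (coord_measure B) (\<lambda>t. \<lambda>b\<in>B. t b + v b) = coord_measure B"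
proof (rule lborel_product.PiM_eqI[OF B])
  show "sets (distr (coord_measure B) (coord_measure B) (\<lambda>t. \<lambda>b\<in>B. t b + v b)) = sets (coord_measure B)"
    by simp
  fix A :: "'a \<Rightarrow> real set" assume A: "\<And>b. b \<in> B \<Longrightarrow> A b \<in> sets lborel"
  have pre: "(\<lambda>t. \<lambda>b\<in>B. t b + v b) -` PiE B A \<inter> space (coord_measure B) = PiE B (\<lambda>b. (+) (v b) -` A b)"
    by (auto simp: space_PiM PiE_iff extensional_def add.commute)
  have "emeasure lborel ((+) c -` X) = emeasure lborel X" if "X \<in> sets lborel" for c and X :: "real set"
    using emeasure_distr[of "(+) c" lborel borel X] that by (simp add: lborel_distr_plus)
  moreover have "(+) (v b) -` A b \<in> sets lborel" if "b \<in> B" for b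
    using measurable_sets[of "(+) (v b)" lborel lborel "A b"] A[OF that] by simp
  moreover have "PiE B A \<in> sets (coord_measure B)"
    using B A by (intro sets_PiM_I_finite) auto
  moreover have "(\<lambda>t. \<lambda>b\<in>B. t b + v b) \<in> measurable (coord_measure B) (coord_measure B)"
    by measurable
  ultimately show "emeasure (distr (coord_measure B) (coord_measure B) (\<lambda>t. \<lambda>b\<in>B. t b + v b)) (PiE B A) =
      (\<Prod>b\<in>B. emeasure lborel (A b))"
    using A B by (simp add: emeasure_distr pre lborel_product.emeasure_PiM)
qed

definition coord_int :: "'a::euclidean_space set \<Rightarrow> ('a \<Rightarrow> ennreal) \<Rightarrow> ennreal" where
  "coord_int B f = (\<integral>\<^sup>+t. f (lin_comb B t) \<partial>coord_measure B)"

lemma coord_int_translate: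
  assumes B: "finite B" and v: "v \<in> span B" and f: "f \<in> borel_measurable borel"
  shows "coord_int B (\<lambda>x. f (v + x)) = coord_int B f"
proof -
  obtain c where c: "v = (\<Sum>b\<in>B. c b *\<^sub>R b)" using v span_finite[OF B] by auto
  have [measurable]: "f \<in> borel_measurable borel" by (rule f)
  have "coord_int B f = (\<integral>\<^sup>+t. f (lin_comb B t) \<partial>distr (coord_measure B) (coord_measure B) (\<lambda>t. \<lambda>b\<in>B. t b + c b))"
    unfolding coord_int_def coord_measure_translate[OF B] ..
  also have "\<dots> = (\<integral>\<^sup>+t. f (lin_comb B (\<lambda>b\<in>B. t b + c b)) \<partial>coord_measure B)"
    by (rule nn_integral_distr) measurable
  also have "\<dots> = (\<integral>\<^sup>+t. f (v + lin_comb B t) \<partial>coord_measure B)"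
    by (simp add: lin_comb_def c scaleR_add_left sum.distrib add.commute)
  finally show ?thesis by (simp add: coord_int_def)
qed

lemma lin_comb_span: "lin_comb B t \<in> span B"
  unfolding lin_comb_def by (intro span_sum span_scale span_base)

text \<open>Uniqueness of a translation invariant measure on the span, by Fubini.\<close>

lemma coord_int_exchange:
  fixes B B' :: "'a::euclidean_space set"
  assumes B: "finite B" "finite B'" and sp: "span B = span B'"
    and f: "f \<in> borel_measurable borel" and g: "g \<in> borel_measurable borel"
  shows "coord_int B f * coord_int B' g = coord_int B g * coord_int B' (\<lambda>y. f (- y))"
proof -
  have [measurable]: "f \<in> borel_measurable borel" "g \<in> borel_measurable borel" by (fact f g)+
  interpret pair_sigma_finite "coord_measure B" "coord_measure B'"
    using B by (simp add: pair_sigma_finite_def sigma_finite_coord)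
  have "coord_int B f * coord_int B' g = (\<integral>\<^sup>+t. f (lin_comb B t) * coord_int B' g \<partial>coord_measure B)"
    unfolding coord_int_def[of B f] by (rule nn_integral_multc[symmetric]) measurable
  also have "\<dots> = (\<integral>\<^sup>+t. f (lin_comb B t) * coord_int B' (\<lambda>y. g (lin_comb B t + y)) \<partial>coord_measure B)"
    using B sp lin_comb_span[of B] by (intro nn_integral_cong) (simp add: coord_int_translate g)
  also have "\<dots> = (\<integral>\<^sup>+t. \<integral>\<^sup>+s. f (lin_comb B t) * g (lin_comb B t + lin_comb B' s) \<partial>coord_measure B' \<partial>coord_measure B)"
    unfolding coord_int_def by (intro nn_integral_cong nn_integral_cmult[symmetric]) measurable
  also have "\<dots> = (\<integral>\<^sup>+s. \<integral>\<^sup>+t. f (lin_comb B t) * g (lin_comb B t + lin_comb B' s) \<partial>coord_measure B \<partial>coord_measure B')"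
    by (rule Fubini'[symmetric]) measurable
  also have "\<dots> = (\<integral>\<^sup>+s. coord_int B (\<lambda>x. f (- lin_comb B' s + (lin_comb B' s + x)) * g (lin_comb B' s + x)) \<partial>coord_measure B')"
    unfolding coord_int_def by (simp add: add.commute)
  also have "\<dots> = (\<integral>\<^sup>+s. coord_int B (\<lambda>x. f (- lin_comb B' s + x) * g x) \<partial>coord_measure B')"
    using B sp lin_comb_span[of B']
    by (intro nn_integral_cong coord_int_translate[where f="\<lambda>x. f (- lin_comb B' _ + x) * g x"]) auto
  also have "\<dots> = (\<integral>\<^sup>+t. \<integral>\<^sup>+s. f (- lin_comb B' s + lin_comb B t) * g (lin_comb B t) \<partial>coord_measure B' \<partial>coord_measure B)"
    unfolding coord_int_def by (rule Fubini') measurable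
  also have "\<dots> = (\<integral>\<^sup>+t. coord_int B' (\<lambda>y. f (- (- lin_comb B t + y))) * g (lin_comb B t) \<partial>coord_measure B)"
    unfolding coord_int_def by (intro nn_integral_cong) (simp add: nn_integral_cmult algebra_simps)
  also have "\<dots> = (\<integral>\<^sup>+t. coord_int B' (\<lambda>y. f (- y)) * g (lin_comb B t) \<partial>coord_measure B)"
    using B sp lin_comb_span[of B] span_neg
    by (intro nn_integral_cong arg_cong2[where f="(*)"] coord_int_translate[where f="\<lambda>y. f (- y)"]) auto
  also have "\<dots> = coord_int B g * coord_int B' (\<lambda>y. f (- y))"
    unfolding coord_int_def[of B g] by (subst nn_integral_cmult) (auto simp: mult.commute)
  finally show ?thesis .
qed

section \<open>Fundamental cells and independence of the lattice basis\<close>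

lemma dual_basis:
  fixes B :: "'a::euclidean_space set"
  assumes "independent B"
  obtains d :: "'a \<Rightarrow> 'a \<Rightarrow> real" where "\<And>b. linear (d b)"
    "\<And>b c. b \<in> B \<Longrightarrow> c \<in> B \<Longrightarrow> d b c = (if c = b then 1 else 0)"
proof -
  have "\<forall>b. \<exists>g. linear g \<and> (\<forall>c\<in>B. g c = (if c = b then 1 else 0 :: real))"
    by (intro allI linear_independent_extend[OF assms])
  then obtain d where "\<forall>b. linear (d b) \<and> (\<forall>c\<in>B. d b c = (if c = b then 1 else 0 :: real))"
    using choice[of "\<lambda>b g. linear g \<and> (\<forall>c\<in>B. g c = (if c = b then 1 else 0 :: real))"] by blast
  then show ?thesis by (intro that[of d]) auto
qed

definition int_span :: "'a::real_vector set \<Rightarrow> 'a set" where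
  "int_span B = {\<Sum>b\<in>B. of_int (k b) *\<^sub>R b | k :: 'a \<Rightarrow> int. True}"

lemma countable_int_span:
  assumes "finite B"
  shows "countable (int_span B)"
proof -
  have "int_span B \<subseteq> (\<lambda>t. \<Sum>b\<in>B. of_int (t b) *\<^sub>R b) ` PiE B (\<lambda>_. UNIV :: int set)"
    unfolding int_span_def
  proof safe
    fix k :: "'a \<Rightarrow> int"
    show "(\<Sum>b\<in>B. of_int (k b) *\<^sub>R b) \<in> (\<lambda>t. \<Sum>b\<in>B. of_int (t b) *\<^sub>R b) ` PiE B (\<lambda>_. UNIV)"
      by (rule image_eqI[of _ _ "restrict k B"]) auto
  qed
  then show ?thesis using assms by (meson countable_PiE countable_image countable_subset uncountable_def countableI_type)
qed

lemma int_span_span: "int_span B \<subseteq> span B"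
  unfolding int_span_def by (clarify, intro span_sum span_scale span_base)

lemma span_int_span:
  assumes "finite B"
  shows "span (int_span B) = span B"
proof
  show "span (int_span B) \<subseteq> span B" using int_span_span[of B] span_minimal subspace_span by blast
  have "b \<in> int_span B" if "b \<in> B" for b
    unfolding int_span_def
    using assms that by (intro CollectI exI[of _ "\<lambda>c. if c = b then 1 else 0"]) (auto simp: if_distrib if_distribR cong: if_cong)
  then show "span B \<subseteq> span (int_span B)" by (meson span_mono subsetI)
qed

text \<open>The half-open fundamental parallelotope of the lattice of B, where d supplies the
  coordinate functionals.\<close>

definition cell :: "('a::euclidean_space \<Rightarrow> 'a \<Rightarrow> real) \<Rightarrow> 'a set \<Rightarrow> 'a set" where
  "cell d B = {x \<in> span B. \<forall>b\<in>B. 0 \<le> d b x \<and> d b x < 1}"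

context
  fixes B :: "'a::euclidean_space set" and d :: "'a \<Rightarrow> 'a \<Rightarrow> real"
  assumes B: "independent B" and lin: "\<And>b. linear (d b)"
    and d: "\<And>b c. b \<in> B \<Longrightarrow> c \<in> B \<Longrightarrow> d b c = (if c = b then 1 else 0)"
begin

lemma finB: "finite B" by (rule independent_imp_finite[OF B])

lemma dual_lin_comb: "b \<in> B \<Longrightarrow> d b (\<Sum>c\<in>B. t c *\<^sub>R c) = t b"
proof -
  assume b: "b \<in> B"
  have "d b (\<Sum>c\<in>B. t c *\<^sub>R c) = (\<Sum>c\<in>B. t c * d b c)"
    by (simp add: linear_sum[OF lin] linear_cmul[OF lin])
  also have "\<dots> = (\<Sum>c\<in>B. if c = b then t b else 0)" using b by (intro sum.cong) (auto simp: d)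
  finally show ?thesis using b finB by simp
qed

lemma cell_borel: "cell d B \<in> sets borel"
proof -
  have "span B \<in> sets borel" using closed_subspace[OF subspace_span] by (rule borel_closed)
  moreover have "d b \<in> borel_measurable borel" for b
    using linear_continuous_on[OF linear_conv_bounded_linear[THEN iffD1, OF lin]] by (rule borel_measurable_continuous_onI)
  then have "{x. 0 \<le> d b x \<and> d b x < 1} \<in> sets borel" for b by measurable
  then have "(\<Inter>b\<in>B. {x. 0 \<le> d b x \<and> d b x < 1}) \<in> sets borel \<or> B = {}"
    using finB by (cases "B = {}") (auto intro!: sets.finite_INT)
  moreover have "cell d B = span B \<inter> (\<Inter>b\<in>B. {x. 0 \<le> d b x \<and> d b x < 1})"
    by (auto simp: cell_def)
  ultimately show ?thesis by (cases "B = {}") auto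
qed

lemma cell_measure: "coord_int B (indicator (cell d B)) = 1"
proof -
  have "coord_int B (indicator (cell d B)) = (\<integral>\<^sup>+t. indicator (PiE B (\<lambda>_. {0..<1})) t \<partial>coord_measure B)"
    unfolding coord_int_def
    using lin_comb_span[of B]
    by (intro nn_integral_cong)
      (auto simp: indicator_def cell_def space_PiM PiE_iff lin_comb_def dual_lin_comb)
  also have "\<dots> = emeasure (coord_measure B) (PiE B (\<lambda>_. {0..<1}))"
    using finB by (intro nn_integral_indicator sets_PiM_I_finite) auto
  also have "\<dots> = 1" using finB by (simp add: lborel_product.emeasure_PiM)
  finally show ?thesis .
qed

lemma cell_tiling:
  assumes x: "x \<in> span B"
  shows "\<exists>!l. l \<in> int_span B \<and> x - l \<in> cell d B"
proof (rule ex1I[of _ "\<Sum>b\<in>B. of_int \<lfloor>d b x\<rfloor> *\<^sub>R b"])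
  let ?l = "\<Sum>b\<in>B. of_int \<lfloor>d b x\<rfloor> *\<^sub>R b"
  have l: "?l \<in> int_span B"
    unfolding int_span_def by (intro CollectI exI[of _ "\<lambda>b. \<lfloor>d b x\<rfloor>"]) simp
  have "d b (x - ?l) = d b x - of_int \<lfloor>d b x\<rfloor>" if "b \<in> B" for b
    using that by (simp add: linear_diff[OF lin] dual_lin_comb)
  moreover have "x - ?l \<in> span B" using x l int_span_span span_diff by blast
  ultimately show "?l \<in> int_span B \<and> x - ?l \<in> cell d B"
    using l by (auto simp: cell_def) linarith
  fix m assume m: "m \<in> int_span B \<and> x - m \<in> cell d B"
  then obtain k where k: "m = (\<Sum>b\<in>B. of_int (k b) *\<^sub>R b)" unfolding int_span_def by blast
  have "k b = \<lfloor>d b x\<rfloor>" if "b \<in> B" for b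
  proof -
    have "d b (x - m) = d b x - of_int (k b)" using that by (simp add: k linear_diff[OF lin] dual_lin_comb)
    then show ?thesis using m that by (auto simp: cell_def floor_unique)
  qed
  then show "m = ?l" unfolding k by (intro sum.cong) auto
qed

end

text \<open>Puts the tiling into the form of an integral over a counting measure, so that Tonelli
  can exchange it with \<open>coord_int\<close>.\<close>

lemma count_tiles:
  assumes "\<exists>!l. l \<in> L \<and> P l"
  shows "(\<integral>\<^sup>+l. indicator {l. P l} l \<partial>count_space L) = 1"
proof -
  from assms obtain l0 where l0: "l0 \<in> L" "P l0" and u: "\<forall>l. l \<in> L \<and> P l \<longrightarrow> l = l0" by (auto simp: Ex1_def)
  have "indicator {l. P l} l = (indicator {l0} l :: ennreal)" if "l \<in> L" for l
  proof (cases "l = l0")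
    case False
    then have "\<not> P l" using u that by blast
    then show ?thesis using False by simp
  qed (use l0 in simp)
  then have "(\<integral>\<^sup>+l. indicator {l. P l} l \<partial>count_space L) = (\<integral>\<^sup>+l. indicator {l0} l \<partial>count_space L)"
    by (intro nn_integral_cong) simp
  also have "\<dots> = emeasure (count_space L) {l0}" using l0 by (intro nn_integral_indicator) simp
  also have "\<dots> = 1" using l0 by simp
  finally show ?thesis .
qed

text \<open>Cells of two bases of one lattice have equal measure: cut the cell of B along the tiles
  of B' and move the pieces by lattice vectors into the cell of B', which they cover exactly once.
  The reflection is the one produced by \<open>coord_int_exchange\<close>.\<close>

lemma cell_measure_other:
  fixes B B' :: "'a::euclidean_space set"
  assumes B: "independent B" and B': "independent B'" and L: "int_span B = int_span B'"
    and lin: "\<And>b. linear (d b)" and d: "\<And>b c. b \<in> B \<Longrightarrow> c \<in> B \<Longrightarrow> d b c = (if c = b then 1 else 0)"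
  shows "coord_int B' (\<lambda>y. indicator (cell d B) (- y)) = 1"
proof -
  obtain d' :: "'a \<Rightarrow> 'a \<Rightarrow> real" where lin': "\<And>b. linear (d' b)"
    and d': "\<And>b c. b \<in> B' \<Longrightarrow> c \<in> B' \<Longrightarrow> d' b c = (if c = b then 1 else 0)"
    using dual_basis[OF B'] by metis
  have f: "finite B" "finite B'" using B B' independent_imp_finite by auto
  have sp: "span B = span B'" using span_int_span f L by metis
  let ?L = "int_span B'"
  let ?P = "indicator (cell d B) :: 'a \<Rightarrow> ennreal" and ?Q = "indicator (cell d' B') :: 'a \<Rightarrow> ennreal"
  have [measurable]: "cell d B \<in> sets borel" "cell d' B' \<in> sets borel"
    using cell_borel[OF B lin d] cell_borel[OF B' lin' d'] by auto
  have c: "countable ?L" using countable_int_span[OF f(2)] .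
  have Lneg: "- l \<in> span B'" if "l \<in> ?L" for l using that int_span_span span_neg by blast
  \<comment> \<open>The inserted factor is the number of translates of the cell of B' that contain
    y, which is 1.\<close>
  have "coord_int B' (\<lambda>y. ?P (- y)) = coord_int B' (\<lambda>y. ?P (- y) * (\<integral>\<^sup>+l. ?Q (y - l) \<partial>count_space ?L))"
    unfolding coord_int_def
  proof (intro nn_integral_cong)
    fix t
    have "(\<integral>\<^sup>+l. ?Q (lin_comb B' t - l) \<partial>count_space ?L) = 1"
      using count_tiles[OF cell_tiling[OF B' lin' d' lin_comb_span[of B' t]]]
      by (simp add: indicator_def)
    then show "?P (- lin_comb B' t) = ?P (- lin_comb B' t) * (\<integral>\<^sup>+l. ?Q (lin_comb B' t - l) \<partial>count_space ?L)"
      by simp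
  qed
  also have "\<dots> = (\<integral>\<^sup>+t. \<integral>\<^sup>+l. ?P (- lin_comb B' t) * ?Q (lin_comb B' t - l) \<partial>count_space ?L \<partial>coord_measure B')"
    unfolding coord_int_def by (intro nn_integral_cong nn_integral_cmult[symmetric]) auto
  also have "\<dots> = (\<integral>\<^sup>+l. coord_int B' (\<lambda>y. ?P (- (l + (- l + y))) * ?Q (- l + y)) \<partial>count_space ?L)"
    unfolding coord_int_def
    by (subst nn_integral_count_space_nn_integral[OF c, symmetric]) (auto simp: algebra_simps)
  \<comment> \<open>Translation by l moves the piece lying in tile l into the cell of B'. The sum
    over l then counts the translates of the cell of B at the reflected point, again 1.\<close>
  also have "\<dots> = (\<integral>\<^sup>+l. coord_int B' (\<lambda>y. ?P (- (l + y)) * ?Q y) \<partial>count_space ?L)"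
    using f(2) Lneg
    by (intro nn_integral_cong coord_int_translate[where f="\<lambda>y. ?P (- (_ + y)) * ?Q y"]) auto
  also have "\<dots> = (\<integral>\<^sup>+t. \<integral>\<^sup>+l. ?P (- (l + lin_comb B' t)) * ?Q (lin_comb B' t) \<partial>count_space ?L \<partial>coord_measure B')"
    unfolding coord_int_def by (subst nn_integral_count_space_nn_integral[OF c]) auto
  also have "\<dots> = coord_int B' (\<lambda>y. (\<integral>\<^sup>+l. ?P (- (l + y)) \<partial>count_space ?L) * ?Q y)"
    unfolding coord_int_def by (intro nn_integral_cong) (simp only: nn_integral_multc borel_measurable_count_space)
  also have "\<dots> = coord_int B' ?Q"
    unfolding coord_int_def
  proof (intro nn_integral_cong)
    fix t
    have "- lin_comb B' t \<in> span B" using lin_comb_span[of B' t] sp span_neg by metis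
    from count_tiles[OF cell_tiling[OF B lin d this]]
    have "(\<integral>\<^sup>+l. ?P (- lin_comb B' t - l) \<partial>count_space ?L) = 1"
      by (simp add: indicator_def L)
    moreover have e: "?P (- (l + lin_comb B' t)) = ?P (- lin_comb B' t - l)" for l
      by (rule arg_cong[where f="?P"]) simp
    ultimately show "(\<integral>\<^sup>+l. ?P (- (l + lin_comb B' t)) \<partial>count_space ?L) * ?Q (lin_comb B' t) = ?Q (lin_comb B' t)"
      unfolding e by (simp only: mult_1)
  qed
  also have "\<dots> = 1" by (rule cell_measure[OF B' lin' d'])
  finally show ?thesis .
qed

text \<open>In \<open>coord_int_exchange\<close> the indicator of the cell of B is taken for f; both
  of its integrals are 1.\<close>

lemma coord_int_basis_change:
  fixes B B' :: "'a::euclidean_space set"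
  assumes B: "independent B" and B': "independent B'" and L: "int_span B = int_span B'"
    and g: "g \<in> borel_measurable borel"
  shows "coord_int B' g = coord_int B g"
proof -
  obtain d :: "'a \<Rightarrow> 'a \<Rightarrow> real" where lin: "\<And>b. linear (d b)"
    and d: "\<And>b c. b \<in> B \<Longrightarrow> c \<in> B \<Longrightarrow> d b c = (if c = b then 1 else 0)"
    using dual_basis[OF B] by metis
  have f: "finite B" "finite B'" using B B' independent_imp_finite by auto
  have sp: "span B = span B'" using span_int_span f L by metis
  have [measurable]: "cell d B \<in> sets borel" by (rule cell_borel[OF B lin d])
  have "indicator (cell d B) \<in> borel_measurable borel" by measurable
  from coord_int_exchange[OF f sp this g]
  show ?thesis by (simp add: cell_measure[OF B lin d] cell_measure_other[OF B B' L lin d])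
qed

lemma lattice_basis_iff: "lattice_basis L B \<longleftrightarrow> independent B \<and> L = int_span B"
  by (simp add: lattice_basis_def int_span_def)

text \<open>\<open>lattice_measure\<close> takes its basis from a choice operator; basis
  independence allows any known basis in its place.\<close>

lemma lattice_measure_eq:
  assumes B: "lattice_basis L (B :: (real ^ 'n) set)"
  shows "lattice_measure L = distr (coord_measure B) borel (lin_comb B)"
proof -
  define B' where "B' = (SOME B. lattice_basis L B)"
  have B': "lattice_basis L B'" unfolding B'_def using someI[of "lattice_basis L", OF B] .
  have "lattice_measure L = distr (coord_measure B') borel (lin_comb B')"
    unfolding lattice_measure_def Let_def lin_comb_def B'_def by simp
  also have "\<dots> = distr (coord_measure B) borel (lin_comb B)"
  proof (rule measure_eqI)
    fix A assume "A \<in> sets (distr (coord_measure B') borel (lin_comb B'))"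
    then have A: "A \<in> sets borel" by simp
    have "emeasure (distr (coord_measure X) borel (lin_comb X)) A = coord_int X (indicator A)" for X :: "(real ^ 'n) set"
    proof -
      have "emeasure (distr (coord_measure X) borel (lin_comb X)) A = (\<integral>\<^sup>+x. indicator A x \<partial>distr (coord_measure X) borel (lin_comb X))"
        using A by simp
      also have "\<dots> = coord_int X (indicator A)"
        unfolding coord_int_def using A by (intro nn_integral_distr) auto
      finally show ?thesis .
    qed
    then show "emeasure (distr (coord_measure B') borel (lin_comb B')) A = emeasure (distr (coord_measure B) borel (lin_comb B)) A"
      using coord_int_basis_change[of B B' "indicator A"] B B' A by (simp add: lattice_basis_iff)
  qed simp
  finally show ?thesis .
qed

section \<open>Simplicial cones\<close>

lemma cone_hull_finite:
  fixes G :: "'a::euclidean_space set"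
  assumes "finite G"
  shows "convex_cone hull G = {\<Sum>g\<in>G. a g *\<^sub>R g | a. \<forall>g\<in>G. 0 \<le> a g}" (is "_ = ?C")
proof
  have "convex_cone ?C"
    unfolding convex_cone_def
  proof (intro conjI)
    show "?C \<noteq> {}" by (auto intro: exI[of _ "\<lambda>_. 0"])
    show "conic ?C" unfolding conic_def
    proof clarify
      fix c :: real and a :: "'a \<Rightarrow> real" assume "0 \<le> c" "\<forall>g\<in>G. 0 \<le> a g"
      then show "\<exists>b. c *\<^sub>R (\<Sum>g\<in>G. a g *\<^sub>R g) = (\<Sum>g\<in>G. b g *\<^sub>R g) \<and> (\<forall>g\<in>G. 0 \<le> b g)"
        by (intro exI[of _ "\<lambda>g. c * a g"]) (auto simp: scaleR_sum_right)
    qed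
    show "convex ?C" unfolding convex_def
    proof clarify
      fix u v :: real and a b :: "'a \<Rightarrow> real"
      assume "0 \<le> u" "0 \<le> v" "\<forall>g\<in>G. 0 \<le> a g" "\<forall>g\<in>G. 0 \<le> b g"
      then show "\<exists>c. u *\<^sub>R (\<Sum>g\<in>G. a g *\<^sub>R g) + v *\<^sub>R (\<Sum>g\<in>G. b g *\<^sub>R g) = (\<Sum>g\<in>G. c g *\<^sub>R g) \<and> (\<forall>g\<in>G. 0 \<le> c g)"
        by (intro exI[of _ "\<lambda>g. u * a g + v * b g"])
          (auto simp: scaleR_sum_right scaleR_add_left sum.distrib)
    qed
  qed
  moreover have "G \<subseteq> ?C"
  proof
    fix g assume "g \<in> G"
    then show "g \<in> ?C"
      using assms by (intro CollectI exI[of _ "\<lambda>h. if h = g then 1 else 0"])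
        (auto simp: if_distrib if_distribR cong: if_cong)
  qed
  ultimately show "convex_cone hull G \<subseteq> ?C" by (simp add: hull_minimal)
  have "(\<Sum>g\<in>H. a g *\<^sub>R g) \<in> convex_cone hull G" if "H \<subseteq> G" "\<forall>g\<in>G. 0 \<le> a g" for H a
    using finite_subset[OF that(1) assms] that
  proof (induction H rule: finite_induct)
    case (insert h H)
    then show ?case
      by (simp add: convex_cone_hull_add convex_cone_hull_mul hull_inc)
  qed (simp add: convex_cone_hull_contains_0)
  then show "?C \<subseteq> convex_cone hull G" by blast
qed

lemma span_cone_hull: "span (convex_cone hull G) = span (G :: 'a::euclidean_space set)" if "finite G"
proof
  have "convex_cone hull G \<subseteq> span G"
    unfolding cone_hull_finite[OF that] by (clarify, intro span_sum span_scale span_base)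
  then show "span (convex_cone hull G) \<subseteq> span G" by (simp add: span_minimal)
  show "span G \<subseteq> span (convex_cone hull G)" by (intro span_mono hull_subset)
qed

section \<open>Faces, lattice sums and integrals of a simplicial cone\<close>

context
  fixes G :: "'a::euclidean_space set" and d :: "'a \<Rightarrow> 'a \<Rightarrow> real"
  assumes G: "independent G" and lin: "\<And>b. linear (d b)"
    and d: "\<And>b c. b \<in> G \<Longrightarrow> c \<in> G \<Longrightarrow> d b c = (if c = b then 1 else 0)"
begin

private lemma fin: "finite G" by (rule independent_imp_finite[OF G])

private lemma dual: "H \<subseteq> G \<Longrightarrow> b \<in> G \<Longrightarrow> d b (\<Sum>c\<in>H. t c *\<^sub>R c) = (if b \<in> H then t b else 0)"
proof -
  assume H: "H \<subseteq> G" and b: "b \<in> G"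
  have "d b (\<Sum>c\<in>H. t c *\<^sub>R c) = (\<Sum>c\<in>H. t c * d b c)"
    by (simp add: linear_sum[OF lin] linear_cmul[OF lin])
  also have "\<dots> = (\<Sum>c\<in>H. if c = b then t b else 0)" using b H by (intro sum.cong) (auto simp: d)
  finally show ?thesis using finite_subset[OF H fin] by simp
qed

lemma mem_cone_iff:
  assumes "H \<subseteq> G"
  shows "x \<in> convex_cone hull H \<longleftrightarrow>
    x = (\<Sum>b\<in>G. d b x *\<^sub>R b) \<and> (\<forall>b\<in>G. 0 \<le> d b x) \<and> (\<forall>b\<in>G - H. d b x = 0)"
proof
  assume "x \<in> convex_cone hull H"
  then obtain a where a: "x = (\<Sum>g\<in>H. a g *\<^sub>R g)" "\<forall>g\<in>H. 0 \<le> a g"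
    unfolding cone_hull_finite[OF finite_subset[OF assms fin]] by blast
  have dx: "d b x = (if b \<in> H then a b else 0)" if "b \<in> G" for b
    unfolding a(1) by (rule dual[OF assms that])
  have "(\<Sum>b\<in>G. d b x *\<^sub>R b) = (\<Sum>b\<in>H. d b x *\<^sub>R b)"
    using fin assms by (intro sum.mono_neutral_right) (auto simp: dx)
  also have "\<dots> = x" unfolding a(1) using assms dual[OF assms] by (intro sum.cong) auto
  finally show "x = (\<Sum>b\<in>G. d b x *\<^sub>R b) \<and> (\<forall>b\<in>G. 0 \<le> d b x) \<and> (\<forall>b\<in>G - H. d b x = 0)"
    using dx a(2) by auto
next
  assume *: "x = (\<Sum>b\<in>G. d b x *\<^sub>R b) \<and> (\<forall>b\<in>G. 0 \<le> d b x) \<and> (\<forall>b\<in>G - H. d b x = 0)"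
  have "(\<Sum>b\<in>G. d b x *\<^sub>R b) = (\<Sum>b\<in>H. d b x *\<^sub>R b)"
    using fin assms * by (intro sum.mono_neutral_right) auto
  then have "x = (\<Sum>b\<in>H. d b x *\<^sub>R b)" using * by simp
  then show "x \<in> convex_cone hull H"
    unfolding cone_hull_finite[OF finite_subset[OF assms fin]] using * assms
    by (intro CollectI exI[of _ "\<lambda>b. d b x"]) auto
qed

lemma dual_nonneg_cone: "x \<in> convex_cone hull G \<Longrightarrow> b \<in> G \<Longrightarrow> 0 \<le> d b x"
  using mem_cone_iff[of G x] by auto

lemma gen_mem_cone_iff: "H \<subseteq> G \<Longrightarrow> g \<in> G \<Longrightarrow> g \<in> convex_cone hull H \<longleftrightarrow> g \<in> H"
  using mem_cone_iff[of H g] d[of g g] hull_inc[of g H convex_cone] by (metis DiffI zero_neq_one)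

lemma cone_inj:
  assumes "H \<subseteq> G" "K \<subseteq> G" "convex_cone hull H = convex_cone hull K"
  shows "H = K"
  using gen_mem_cone_iff[OF assms(1)] gen_mem_cone_iff[OF assms(2)] assms by blast

lemma cone_face:
  assumes "H \<subseteq> G"
  shows "convex_cone hull H face_of convex_cone hull G"
  unfolding face_of_def
proof (intro conjI ballI impI)
  show "convex_cone hull H \<subseteq> convex_cone hull G" using assms by (rule hull_mono)
  show "convex (convex_cone hull H)" by (rule convex_convex_cone_hull)
  fix a b x assume a: "a \<in> convex_cone hull G" and b: "b \<in> convex_cone hull G"
    and x: "x \<in> convex_cone hull H" and seg: "x \<in> open_segment a b"
  obtain t where t: "0 < t" "t < 1" "x = (1 - t) *\<^sub>R a + t *\<^sub>R b"
    using seg by (auto simp: in_segment)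
  have z: "d g a = 0 \<and> d g b = 0" if g: "g \<in> G - H" for g
  proof -
    have "d g x = 0" using mem_cone_iff[OF assms] x g by blast
    then have "(1 - t) * d g a + t * d g b = 0"
      by (simp add: t(3) linear_add[OF lin] linear_cmul[OF lin])
    moreover have "0 \<le> d g a" "0 \<le> d g b" using a b g dual_nonneg_cone by auto
    ultimately show ?thesis using t(1,2)
      by (metis (no_types, lifting) add_nonneg_eq_0_iff diff_gt_0_iff_gt less_eq_real_def
          mult_eq_0_iff mult_nonneg_nonneg less_irrefl)
  qed
  show "a \<in> convex_cone hull H" "b \<in> convex_cone hull H"
    using a b z mem_cone_iff[OF assms] mem_cone_iff[OF subset_refl] by auto
qed

text \<open>A nonempty face is closed under nonnegative scaling, hence a convex cone. It contains
  every generator that occurs in one of its points, because such a point is a midpoint of its part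
  along the generator and the rest, both doubled.\<close>

lemma face_cone:
  assumes F: "F face_of convex_cone hull G" "F \<noteq> {}"
  shows "\<exists>H\<subseteq>G. F = convex_cone hull H"
proof -
  let ?C = "convex_cone hull G"
  have sub: "F \<subseteq> ?C" and cvx: "convex F" using F by (auto simp: face_of_def)
  have ext: "a \<in> F \<and> b \<in> F" if "a \<in> ?C" "b \<in> ?C" "x \<in> F" "x = (1/2) *\<^sub>R a + (1/2) *\<^sub>R b" for a b x
  \<comment> \<open>\<open>open_segment\<close> is empty for equal end points, where the face
    property says nothing.\<close>
  proof (cases "a = b")
    case True
    then show ?thesis using that by (simp add: scaleR_add_left[symmetric])
  next
    case False
    have "x \<in> open_segment a b"
      unfolding in_segment using False that(4) by (intro conjI exI[of _ "1/2"]) (auto simp: algebra_simps)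
    then show ?thesis using F that unfolding face_of_def by blast
  qed
  \<comment> \<open>x is the midpoint of 0 and 2 x, so F is closed under doubling; convexity with 0
    then fills in all nonnegative multiples.\<close>
  have F02: "0 \<in> F \<and> 2 *\<^sub>R x \<in> F" if "x \<in> F" for x
    using that sub by (intro ext[of 0 "2 *\<^sub>R x" x]) (auto intro: convex_cone_hull_mul convex_cone_hull_contains_0)
  have F0: "0 \<in> F" using F02 F(2) by blast
  have Fadd: "x + y \<in> F" if "x \<in> F" "y \<in> F" for x y
  proof -
    have "(1/2) *\<^sub>R x + (1/2) *\<^sub>R y \<in> F" using that by (intro convexD[OF cvx]) auto
    from F02[OF this] show ?thesis by (simp add: scaleR_add_right)
  qed
  have Fpow: "(2 ^ n) *\<^sub>R x \<in> F" if "x \<in> F" for x n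
    using that F02 by (induction n) (auto simp: mult.commute simp flip: scaleR_scaleR)
  have Fscale: "c *\<^sub>R x \<in> F" if x: "x \<in> F" and c: "0 \<le> c" for x c
  proof -
    obtain n where n: "c < 2 ^ n" using real_arch_pow[of 2 c] by auto
    have "(c / 2 ^ n) *\<^sub>R ((2 ^ n) *\<^sub>R x) + (1 - c / 2 ^ n) *\<^sub>R 0 \<in> F"
      using Fpow[OF x] F0 n c by (intro convexD[OF cvx]) auto
    then show ?thesis by simp
  qed
  define H where "H = {g \<in> G. g \<in> F}"
  have HG: "H \<subseteq> G" by (auto simp: H_def)
  have "convex_cone hull H \<subseteq> F"
  proof (rule hull_minimal)
    show "H \<subseteq> F" by (auto simp: H_def)
    show "convex_cone F" unfolding convex_cone_def conic_def using cvx F(2) Fscale by auto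
  qed
  moreover have "F \<subseteq> convex_cone hull H"
  proof
    fix x assume x: "x \<in> F"
    then have xC: "x \<in> ?C" using sub by blast
    have "g \<in> H" if g: "g \<in> G" "d g x \<noteq> 0" for g
    proof -
      have p: "0 < d g x" using dual_nonneg_cone[OF xC g(1)] g(2) by simp
      have gC: "g \<in> ?C" using g by (simp add: hull_inc)
      \<comment> \<open>The rest of x after removing its part along g. Its coordinates are those of
        x with the one at g set to 0, so it stays in the cone.\<close>
      let ?r = "x - d g x *\<^sub>R g"
      have dr: "d b ?r = (if b = g then 0 else d b x)" if "b \<in> G" for b
        using that g(1) by (simp add: linear_diff[OF lin] linear_cmul[OF lin] d)
      have "?r = (\<Sum>b\<in>G. d b x *\<^sub>R b) - d g x *\<^sub>R g" using mem_cone_iff[of G x] xC by simp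
      also have "\<dots> = (\<Sum>b\<in>G - {g}. d b x *\<^sub>R b)" using fin g(1) by (simp add: sum.remove)
      also have "\<dots> = (\<Sum>b\<in>G. d b ?r *\<^sub>R b)"
        using fin dr by (intro sum.mono_neutral_cong_left) auto
      finally have "?r \<in> ?C"
        using mem_cone_iff[of G ?r] dr dual_nonneg_cone[OF xC] by auto
      then have "2 *\<^sub>R ?r \<in> ?C" by (intro convex_cone_hull_mul) auto
      moreover have "2 *\<^sub>R (d g x *\<^sub>R g) \<in> ?C" using gC p by (intro convex_cone_hull_mul) auto
      ultimately have "2 *\<^sub>R (d g x *\<^sub>R g) \<in> F"
        using ext[of "2 *\<^sub>R (d g x *\<^sub>R g)" "2 *\<^sub>R ?r" x] x by simp
      from Fscale[OF this, of "1 / (2 * d g x)"] show ?thesis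
        using p g(1) by (simp add: H_def)
    qed
    then show "x \<in> convex_cone hull H"
      using mem_cone_iff[OF HG, of x] mem_cone_iff[of G x] xC by auto
  qed
  ultimately show ?thesis using HG by blast
qed

lemma bij_faces: "bij_betw (\<lambda>H. convex_cone hull H) (Pow G) {F. F face_of convex_cone hull G \<and> F \<noteq> {}}"
  unfolding bij_betw_def
proof
  show "inj_on (\<lambda>H. convex_cone hull H) (Pow G)" using cone_inj by (intro inj_onI) auto
  show "(\<lambda>H. convex_cone hull H) ` Pow G = {F. F face_of convex_cone hull G \<and> F \<noteq> {}}"
    using face_cone cone_face by (auto simp: image_iff convex_cone_hull_nonempty)
qed

lemma bij_proper_faces:
  "bij_betw (\<lambda>H. convex_cone hull H) (Pow G - {{}}) {F. F face_of convex_cone hull G \<and> F \<noteq> {} \<and> F \<noteq> {0}}"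
proof -
  have "bij_betw (\<lambda>H. convex_cone hull H) (Pow G - {{}}) ({F. F face_of convex_cone hull G \<and> F \<noteq> {}} - {{0}})"
    using bij_betw_DiffI[OF bij_faces, of "{{}}" "{{0}}"] cone_face[of "{}"] by (simp add: bij_betw_def)
  also have "{F. F face_of convex_cone hull G \<and> F \<noteq> {}} - {{0}} = {F. F face_of convex_cone hull G \<and> F \<noteq> {} \<and> F \<noteq> {0}}"
    by auto
  finally show ?thesis .
qed

text \<open>Coordinates with respect to G are unique: membership in the span of H kills those
  outside H, and the others remain integers.\<close>

lemma int_span_Int_span:
  assumes "H \<subseteq> G"
  shows "int_span G \<inter> span H = int_span H"
proof
  show "int_span G \<inter> span H \<subseteq> int_span H"
  proof
    fix x assume x: "x \<in> int_span G \<inter> span H"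
    then obtain k where k: "x = (\<Sum>b\<in>G. of_int (k b) *\<^sub>R b)" unfolding int_span_def by blast
    obtain t where t: "x = (\<Sum>b\<in>H. t b *\<^sub>R b)"
      using x span_finite[OF finite_subset[OF assms fin]] by auto
    have "of_int (k b) = (if b \<in> H then t b else 0)" if "b \<in> G" for b
      using dual[OF assms that, of t] dual[OF subset_refl that, of "\<lambda>b. of_int (k b)"] k t that by simp
    then have "x = (\<Sum>b\<in>H. of_int (k b) *\<^sub>R b)" unfolding t using assms by (intro sum.cong) auto
    then show "x \<in> int_span H" unfolding int_span_def by blast
  qed
  show "int_span H \<subseteq> int_span G \<inter> span H"
  proof
    fix x assume x: "x \<in> int_span H"
    then obtain k where k: "x = (\<Sum>b\<in>H. of_int (k b) *\<^sub>R b)" unfolding int_span_def by blast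
    have "x = (\<Sum>b\<in>G. of_int (if b \<in> H then k b else 0) *\<^sub>R b)"
      unfolding k using assms fin by (intro sum.mono_neutral_cong_left) auto
    then have "x \<in> int_span G" unfolding int_span_def by (intro CollectI exI conjI, assumption) simp
    then show "x \<in> int_span G \<inter> span H" using x int_span_span by blast
  qed
qed

text \<open>G is a basis of the lattice, so the lattice points of the cone are the combinations of G
  with natural coefficients, each obtained once. The sum becomes a product of geometric
  series.\<close>

lemma cone_sum_simplicial:
  fixes \<xi> :: 'a
  assumes neg: "\<And>g. g \<in> G \<Longrightarrow> \<xi> \<bullet> g < 0"
  shows "(\<Sum>\<^sub>\<infinity>x\<in>convex_cone hull G \<inter> int_span G. exp (\<xi> \<bullet> x)) = (\<Prod>g\<in>G. 1 / (1 - exp (\<xi> \<bullet> g)))"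
proof -
  let ?f = "\<lambda>n :: 'a \<Rightarrow> nat. \<Sum>g\<in>G. of_nat (n g) *\<^sub>R g"
  have dn: "d g (?f n) = of_nat (n g)" if "g \<in> G" for g n
    using dual[OF subset_refl that, of "\<lambda>g. of_nat (n g)"] that by simp
  have bij: "bij_betw ?f (PiE G (\<lambda>_. UNIV)) (convex_cone hull G \<inter> int_span G)"
    unfolding bij_betw_def
  proof
    show "inj_on ?f (PiE G (\<lambda>_. UNIV))"
    proof (rule inj_onI)
      fix m n assume mn: "m \<in> PiE G (\<lambda>_. UNIV)" "n \<in> PiE G (\<lambda>_. UNIV)" "?f m = ?f n"
      have "m g = n g" if "g \<in> G" for g using dn[OF that, of m] dn[OF that, of n] mn(3) by simp
      then show "m = n" using mn by (intro PiE_ext) auto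
    qed
    show "?f ` (PiE G (\<lambda>_. UNIV)) = convex_cone hull G \<inter> int_span G"
    proof
      show "?f ` (PiE G (\<lambda>_. UNIV)) \<subseteq> convex_cone hull G \<inter> int_span G"
      proof clarify
        fix n :: "'a \<Rightarrow> nat"
        have "?f n \<in> convex_cone hull G"
          unfolding cone_hull_finite[OF fin] by (intro CollectI exI[of _ "\<lambda>g. of_nat (n g)"]) simp
        moreover have "?f n \<in> int_span G"
          unfolding int_span_def by (intro CollectI exI[of _ "\<lambda>g. int (n g)"]) simp
        ultimately show "?f n \<in> convex_cone hull G \<inter> int_span G" by blast
      qed
      show "convex_cone hull G \<inter> int_span G \<subseteq> ?f ` (PiE G (\<lambda>_. UNIV))"
      proof
        fix x assume x: "x \<in> convex_cone hull G \<inter> int_span G"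
        then obtain k where k: "x = (\<Sum>b\<in>G. of_int (k b) *\<^sub>R b)" unfolding int_span_def by blast
        have "0 \<le> k b" if "b \<in> G" for b
          using dual_nonneg_cone[of x b] x that dual[OF subset_refl that, of "\<lambda>b. of_int (k b)"] k by simp
        then have "x = ?f (restrict (\<lambda>b. nat (k b)) G)" unfolding k by (intro sum.cong) auto
        then show "x \<in> ?f ` (PiE G (\<lambda>_. UNIV))"
          by (rule image_eqI[of x ?f "restrict (\<lambda>b. nat (k b)) G"]) auto
      qed
    qed
  qed
  have geo: "((\<lambda>n. exp (\<xi> \<bullet> g) ^ n) has_sum 1 / (1 - exp (\<xi> \<bullet> g))) UNIV" if "g \<in> G" for g
    using neg[OF that] by (intro sums_nonneg_imp_has_sum geometric_sums) auto
  have "(\<Sum>\<^sub>\<infinity>x\<in>convex_cone hull G \<inter> int_span G. exp (\<xi> \<bullet> x)) = (\<Sum>\<^sub>\<infinity>n\<in>PiE G (\<lambda>_. UNIV). exp (\<xi> \<bullet> ?f n))"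
    by (rule infsum_reindex_bij_betw[OF bij, symmetric])
  also have "\<dots> = (\<Sum>\<^sub>\<infinity>n\<in>PiE G (\<lambda>_. UNIV). \<Prod>g\<in>G. exp (\<xi> \<bullet> g) ^ n g)"
    by (intro infsum_cong) (simp add: inner_sum_right exp_sum[OF fin] exp_of_nat_mult)
  also have "\<dots> = (\<Prod>g\<in>G. \<Sum>\<^sub>\<infinity>n. exp (\<xi> \<bullet> g) ^ n)"
    using geo has_sum_imp_summable by (intro infsum_prod_PiE_abs fin) fastforce
  also have "\<dots> = (\<Prod>g\<in>G. 1 / (1 - exp (\<xi> \<bullet> g)))"
    using geo by (intro prod.cong) (auto simp: infsumI)
  finally show ?thesis .
qed

lemma lineality_cone: "{x \<in> convex_cone hull G. - x \<in> convex_cone hull G} = {0}"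
proof -
  have "x = 0" if x: "x \<in> convex_cone hull G" "- x \<in> convex_cone hull G" for x
  proof -
    have "d b x = 0" if "b \<in> G" for b
      using dual_nonneg_cone[OF x(1) that] dual_nonneg_cone[OF x(2) that] by (simp add: linear_neg[OF lin])
    then show ?thesis using mem_cone_iff[of G x] x(1) by simp
  qed
  then show ?thesis using convex_cone_hull_contains_0[of G] by auto
qed

lemma convergence_cone:
  "(\<forall>x\<in>convex_cone hull G. x \<noteq> 0 \<longrightarrow> \<xi> \<bullet> x < 0) \<longleftrightarrow> (\<forall>g\<in>G. \<xi> \<bullet> g < 0)"
proof (intro iffI ballI impI)
  fix g assume *: "\<forall>x\<in>convex_cone hull G. x \<noteq> 0 \<longrightarrow> \<xi> \<bullet> x < 0" and g: "g \<in> G"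
  then have "g \<noteq> 0" using G dependent_zero by blast
  then show "\<xi> \<bullet> g < 0" using * g by (simp add: hull_inc)
next
  fix x assume *: "\<forall>g\<in>G. \<xi> \<bullet> g < 0" and x: "x \<in> convex_cone hull G" "x \<noteq> 0"
  have xe: "x = (\<Sum>b\<in>G. d b x *\<^sub>R b)" using mem_cone_iff[of G x] x(1) by simp
  then have "\<xi> \<bullet> x = (\<Sum>b\<in>G. d b x * (\<xi> \<bullet> b))" by (metis (no_types, lifting) inner_scaleR_right inner_sum_right sum.cong)
  also have "\<dots> < 0"
  proof -
    obtain b where b: "b \<in> G" "d b x \<noteq> 0" using xe x(2) by (metis (no_types, lifting) scale_eq_0_iff sum.neutral)
    then have "d b x * (\<xi> \<bullet> b) < 0" using dual_nonneg_cone[OF x(1) b(1)] * by (simp add: mult_less_0_iff)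
    moreover have "(\<Sum>c\<in>G - {b}. d c x * (\<xi> \<bullet> c)) \<le> 0"
      using dual_nonneg_cone[OF x(1)] * by (intro sum_nonpos) (auto simp: mult_le_0_iff less_imp_le)
    ultimately show ?thesis using fin b(1) by (simp add: sum.remove)
  qed
  finally show "\<xi> \<bullet> x < 0" .
qed

end

lemma exp_integral_half_line:
  assumes "(c::real) < 0"
  shows "has_bochner_integral lborel (\<lambda>x. exp (c * x) * indicator {0..} x) (- 1 / c)"
proof (rule has_bochner_integral_nn_integral)
  have "((\<lambda>x. exp (c * x) / c) \<longlongrightarrow> 0 / c) at_top"
    using assms
    by (intro tendsto_divide filterlim_compose[OF exp_at_bot] filterlim_tendsto_neg_mult_at_bot[OF tendsto_const] filterlim_ident) auto
  then have "(\<integral>\<^sup>+x. ennreal (exp (c * x)) * indicator {0..} x \<partial>lborel) = ennreal (0 - exp (c * 0) / c)"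
    using assms by (intro nn_integral_FTC_atLeast) (auto intro!: derivative_eq_intros)
  then show "(\<integral>\<^sup>+x. ennreal (exp (c * x) * indicator {0..} x) \<partial>lborel) = ennreal (- 1 / c)"
    by (simp add: ennreal_mult'' ennreal_indicator)
qed (use assms in \<open>auto simp: divide_nonpos_neg\<close>)

text \<open>By independence of the basis, H itself may be used for the measure. In its coordinates
  both the indicator of the cone and the exponential factorise.\<close>

lemma cone_integral_simplicial:
  fixes H :: "(real ^ 'n) set"
  assumes H: "independent H" and L: "L \<inter> span H = int_span H" and neg: "\<And>g. g \<in> H \<Longrightarrow> \<xi> \<bullet> g < 0"
  shows "cone_integral L (convex_cone hull H) \<xi> = (\<Prod>g\<in>H. - 1 / (\<xi> \<bullet> g))"
proof -
  have fin: "finite H" by (rule independent_imp_finite[OF H])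
  obtain d :: "real ^ 'n \<Rightarrow> real ^ 'n \<Rightarrow> real" where lin: "\<And>b. linear (d b)"
    and d: "\<And>b c. b \<in> H \<Longrightarrow> c \<in> H \<Longrightarrow> d b c = (if c = b then 1 else 0)"
    using dual_basis[OF H] by metis
  let ?C = "convex_cone hull H"
  have C: "?C \<in> sets borel" using closed_convex_cone_hull[OF fin] by (rule borel_closed)
  have mem: "lin_comb H t \<in> ?C \<longleftrightarrow> (\<forall>b\<in>H. 0 \<le> t b)" for t
  proof -
    have dl: "d b (lin_comb H t) = t b" if "b \<in> H" for b
      unfolding lin_comb_def by (rule dual_lin_comb[OF H lin d that])
    have e: "(\<Sum>b\<in>H. d b (lin_comb H t) *\<^sub>R b) = lin_comb H t"
      unfolding lin_comb_def[of H t] by (intro sum.cong refl) (simp add: dl flip: lin_comb_def)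
    show ?thesis using mem_cone_iff[OF H lin d subset_refl, of "lin_comb H t"] e dl by auto
  qed
  have ind: "indicator ?C (lin_comb H t) = (\<Prod>b\<in>H. indicator {0..} (t b) :: real)" for t
  proof (cases "\<forall>b\<in>H. 0 \<le> t b")
    case False
    then obtain b where "b \<in> H" "\<not> 0 \<le> t b" by blast
    then show ?thesis using mem[of t] fin False by (simp add: prod_zero_iff) (auto simp: indicator_def)
  qed (use mem[of t] in auto)
  have "L \<inter> span ?C = int_span H" using L span_cone_hull[OF fin] by simp
  then have lm: "lattice_measure (L \<inter> span ?C) = distr (coord_measure H) borel (lin_comb H)"
    using H by (intro lattice_measure_eq) (simp add: lattice_basis_iff)
  have "cone_integral L ?C \<xi> = (\<integral>x. indicator ?C x * exp (\<xi> \<bullet> x) \<partial>distr (coord_measure H) borel (lin_comb H))"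
    unfolding cone_integral_def lm set_lebesgue_integral_def by simp
  also have "\<dots> = (\<integral>t. indicator ?C (lin_comb H t) * exp (\<xi> \<bullet> lin_comb H t) \<partial>coord_measure H)"
    using C by (intro integral_distr) auto
  also have "\<dots> = (\<integral>t. (\<Prod>b\<in>H. exp ((\<xi> \<bullet> b) * t b) * indicator {0..} (t b)) \<partial>coord_measure H)"
  proof (rule Bochner_Integration.integral_cong[OF refl])
    fix t
    have "exp (\<xi> \<bullet> lin_comb H t) = (\<Prod>b\<in>H. exp ((\<xi> \<bullet> b) * t b))"
      by (simp add: lin_comb_def inner_sum_right exp_sum[OF fin] mult.commute)
    then show "indicator ?C (lin_comb H t) * exp (\<xi> \<bullet> lin_comb H t) = (\<Prod>b\<in>H. exp ((\<xi> \<bullet> b) * t b) * indicator {0..} (t b))"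
      by (simp add: ind prod.distrib mult.commute)
  qed
  also have "\<dots> = (\<Prod>b\<in>H. \<integral>x. exp ((\<xi> \<bullet> b) * x) * indicator {0..} x \<partial>lborel)"
    using exp_integral_half_line[OF neg]
    by (intro lborel_product.product_integral_prod fin) (auto simp: has_bochner_integral_iff)
  also have "\<dots> = (\<Prod>g\<in>H. - 1 / (\<xi> \<bullet> g))"
    using exp_integral_half_line[OF neg] by (intro prod.cong) (auto simp: has_bochner_integral_iff)
  finally show ?thesis .
qed

section \<open>The Todd series\<close>

definition rtodd :: "nat \<Rightarrow> real" where
  "rtodd n = of_rat (todd_coeff n)"

lemma rtodd_0: "rtodd 0 = 1"
  by (simp add: rtodd_def todd_coeff_0)

lemma rtodd_fps_mult: "Abs_fps rtodd * (1 - fps_exp (- 1)) = fps_X"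
proof (rule fps_ext)
  fix n
  have fact: "of_rat (fact k) = (fact k :: real)" for k
    by (metis of_nat_fact of_rat_of_nat_eq)
  have "fps_nth (Abs_fps rtodd * (1 - fps_exp (- 1))) n =
      of_rat (fps_nth (Abs_fps todd_coeff * (1 - fps_exp (- 1))) n)"
    by (simp add: fps_mult_nth rtodd_def of_rat_sum of_rat_mult of_rat_diff of_rat_divide of_rat_power of_rat_minus fact
        if_distrib[of of_rat] cong: if_cong)
  then show "fps_nth (Abs_fps rtodd * (1 - fps_exp (- 1))) n = fps_nth fps_X n"
    unfolding todd_fps_mult by (simp add: fps_X_def)
qed

text \<open>1 - exp (-x) is x times a series g with constant term 1 and infinite radius of
  convergence, so the Todd series is the inverse of g and converges near 0. The result is divided by
  y to match the coefficients \<open>rtodd (Suc n)\<close>.\<close>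

lemma todd_series:
  obtains \<rho> :: real where "0 < \<rho>" "summable (\<lambda>n. \<bar>rtodd (Suc n)\<bar> * \<rho> ^ n)"
    "\<And>y. y \<noteq> 0 \<Longrightarrow> \<bar>y\<bar> \<le> \<rho> \<Longrightarrow> (\<lambda>n. rtodd (Suc n) * y ^ n) sums ((y / (1 - exp (- y)) - 1) / y)"
proof -
  let ?F = "Abs_fps rtodd" and ?e = "1 - fps_exp (- 1) :: real fps"
  define g where "g = fps_shift 1 ?e"
  have e: "?e = g * fps_X" unfolding g_def by (rule fps_ext) simp
  have "?F * g * fps_X = 1 * fps_X" using rtodd_fps_mult by (simp add: e mult.assoc)
  then have Fg: "?F * g = 1" by (metis fps_X_neq_zero mult_right_cancel)
  have g0: "fps_nth g 0 \<noteq> 0" by (simp add: g_def)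
  have F: "?F = inverse g" using Fg fps_inverse_unique by (metis mult.commute)
  have rg: "fps_conv_radius g = \<infinity>"
  proof -
    have "fps_conv_radius ?e \<ge> \<infinity>"
      by (rule order_trans[OF _ fps_conv_radius_diff]) simp
    then show ?thesis unfolding g_def by (simp add: fps_conv_radius_shift)
  qed
  have RF: "0 < fps_conv_radius ?F" unfolding F using g0 rg by (intro fps_conv_radius_inverse_pos) auto
  obtain R :: real where R: "0 < R" "ereal R < fps_conv_radius ?F"
    using RF ereal_dense2[of 0 "fps_conv_radius ?F"] by (auto simp: zero_ereal_def)
  have sm: "summable (\<lambda>n. \<bar>rtodd n\<bar> * R ^ n)"
    using abs_summable_in_conv_radius[of R rtodd] R by (simp add: fps_conv_radius_def norm_mult abs_mult)
  have ev: "(\<lambda>n. rtodd n * y ^ n) sums (y / (1 - exp (- y)))" if y: "y \<noteq> 0" "\<bar>y\<bar> \<le> R" for y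
  proof -
    have yF: "ereal (norm y) < fps_conv_radius ?F" using y R(2) by (intro le_less_trans[OF _ R(2)]) simp
    have "eval_fps (?F * g) y = eval_fps ?F y * eval_fps g y"
      using yF rg by (intro eval_fps_mult) auto
    then have 1: "eval_fps ?F y * eval_fps g y = 1" by (simp add: Fg)
    have "eval_fps ?e y = eval_fps g y * y"
      unfolding e using rg by (subst eval_fps_mult) auto
    moreover have "eval_fps ?e y = 1 - exp (- y)"
      by (subst eval_fps_diff) auto
    ultimately have 2: "eval_fps g y = (1 - exp (- y)) / y" using y by (simp add: field_simps)
    have "eval_fps ?F y = y / (1 - exp (- y))" using 1 y by (simp add: 2 field_simps)
    moreover have "(\<lambda>n. rtodd n * y ^ n) sums eval_fps ?F y"
      using sums_eval_fps[OF yF] by simp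
    ultimately show ?thesis by simp
  qed
  show ?thesis
  proof (rule that[OF R(1)])
    have "summable (\<lambda>n. \<bar>rtodd (Suc n)\<bar> * R ^ Suc n)" using sm by (subst summable_Suc_iff)
    then have "summable (\<lambda>n. (1 / R) * (\<bar>rtodd (Suc n)\<bar> * R ^ Suc n))" by (rule summable_mult)
    then show "summable (\<lambda>n. \<bar>rtodd (Suc n)\<bar> * R ^ n)" using R(1) by simp
    fix y assume y: "y \<noteq> 0" "\<bar>y\<bar> \<le> R"
    have "(\<lambda>n. rtodd (Suc n) * y ^ Suc n) sums (y / (1 - exp (- y)) - 1)"
      using ev[OF y] by (subst sums_Suc_iff) (simp add: rtodd_0)
    from sums_divide[OF this, of y] show "(\<lambda>n. rtodd (Suc n) * y ^ n) sums ((y / (1 - exp (- y)) - 1) / y)"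
      using y by simp
  qed
qed

section \<open>The dual basis of a chain\<close>

text \<open>
  The generators of the transverse cone of the chain \<open>J\<close>; inside the space of vectors that are constant
  on the blocks of \<open>J\<close> and have sum \<open>0\<close> they form the basis dual to the vectors \<open>e\<^sub>S\<close>.
\<close>

definition uvec :: "'n::finite set set \<Rightarrow> 'n set \<Rightarrow> real ^ 'n" where
  "uvec J S = (\<chi> i. (if i \<in> S - pred_in S J then 1 / of_nat (card (S - pred_in S J)) else 0) -
     (if i \<in> succ_in S J - S then 1 / of_nat (card (succ_in S J - S)) else 0))"

definition pchain :: "'n::finite set set \<Rightarrow> bool" where
  "pchain J \<longleftrightarrow> chain_set J \<and> J \<subseteq> proper_subsets"

lemma pchain_subset: "pchain J \<Longrightarrow> K \<subseteq> J \<Longrightarrow> pchain K"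
  unfolding pchain_def using chain_set_subset by blast

lemma pchain_gap: "pchain J \<Longrightarrow> S \<in> J \<Longrightarrow> gap (pred_in S J) S (succ_in S J) J"
  unfolding pchain_def using gap_chain by blast

lemma inner_subset_vec: "x \<bullet> subset_vec s = (\<Sum>i\<in>s. x $ i)"
  unfolding inner_vec_def subset_vec_def by (simp add: if_distrib sum.If_cases cong: if_cong)

lemma uvec_inner: "uvec J S \<bullet> subset_vec s = hat (pred_in S J) S (succ_in S J) s"
  unfolding inner_subset_vec
  by (simp add: uvec_def hat_def sum_subtractf sum.If_cases set_diff_eq[symmetric])

lemma uvec_inner_UNIV: "pchain J \<Longrightarrow> S \<in> J \<Longrightarrow> uvec J S \<bullet> subset_vec UNIV = 0"
  unfolding uvec_inner using hat_cases(5)[of "pred_in S J" S "succ_in S J" UNIV] pchain_gap[of J S]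
  by (simp add: gap_def)

lemma uvec_inner_mem: "pchain J \<Longrightarrow> S \<in> J \<Longrightarrow> K \<in> J \<Longrightarrow> uvec J S \<bullet> subset_vec K = (if K = S then 1 else 0)"
  unfolding uvec_inner by (rule hat_mem[OF pchain_gap])

lemma uvec_inner_tent:
  assumes "pchain J" "K \<subseteq> J" "S \<in> K" "s \<in> J - K"
  shows "uvec K S \<bullet> subset_vec s = tent S K s"
proof -
  have K: "pchain K" using assms pchain_subset by blast
  have "\<forall>X\<in>K. s \<subseteq> X \<or> X \<subseteq> s"
    using assms unfolding pchain_def chain_set_def by blast
  then show ?thesis unfolding uvec_inner
    using assms(3,4) by (intro hat_tent[OF pchain_gap[OF K]]) simp_all
qed

text \<open>Two averaging vectors of l1 norm at most 1 are subtracted. This is the 2 in the cost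
  \<open>2 * r\<close> of a linear form.\<close>

lemma uvec_norm1: "(\<Sum>i\<in>UNIV. \<bar>uvec J S $ i\<bar>) \<le> 2"
proof -
  have *: "(\<Sum>i\<in>UNIV. if i \<in> X then 1 / of_nat (card X) else 0) \<le> (1::real)" for X :: "'a set"
    by (simp add: sum.If_cases)
  have "(\<Sum>i\<in>UNIV. \<bar>uvec J S $ i\<bar>) \<le> (\<Sum>i\<in>UNIV. (if i \<in> S - pred_in S J then 1 / of_nat (card (S - pred_in S J)) else 0) +
     (if i \<in> succ_in S J - S then 1 / of_nat (card (succ_in S J - S)) else 0))"
    by (intro sum_mono) (auto simp: uvec_def)
  then show ?thesis unfolding sum.distrib using *[of "S - pred_in S J"] *[of "succ_in S J - S"] by linarith
qed

text \<open>The vectors constant on the blocks of J, with arbitrary sum; those of sum 0 are the span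
  of the vectors \<open>uvec J S\<close> when J is a chain of proper subsets.\<close>

definition chain_space :: "'n::finite set set \<Rightarrow> (real ^ 'n) set" where
  "chain_space J = span (subset_vec ` insert UNIV J)"

lemma chain_space_mono: "K \<subseteq> J \<Longrightarrow> chain_space K \<subseteq> chain_space J"
  unfolding chain_space_def by (intro span_mono) auto

lemma uvec_chain_space:
  assumes "pchain J" "S \<in> J"
  shows "uvec J S \<in> chain_space J"
proof -
  let ?A = "pred_in S J" and ?B = "succ_in S J"
  have g: "?A \<subset> S" "S \<subset> ?B" "?A \<in> J \<or> ?A = {}" "?B \<in> J \<or> ?B = UNIV"
    using pchain_gap[OF assms] by (auto simp: gap_def)
  have "subset_vec {} = (0 :: real ^ 'a)" by (simp add: subset_vec_def vec_eq_iff)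
  then have m: "subset_vec X \<in> chain_space J" if "X \<in> J \<or> X = {} \<or> X = UNIV" for X
    using that unfolding chain_space_def by (auto intro: span_base span_zero)
  have "uvec J S = (1 / of_nat (card (S - ?A))) *\<^sub>R (subset_vec S - subset_vec ?A) -
      (1 / of_nat (card (?B - S))) *\<^sub>R (subset_vec ?B - subset_vec S)"
    using g(1,2) by (auto simp: vec_eq_iff uvec_def subset_vec_def)
  also have "\<dots> \<in> chain_space J"
    using m assms(2) g unfolding chain_space_def by (intro span_diff span_scale) auto
  finally show ?thesis .
qed

text \<open>The difference of both sides lies in the span of the vectors e_s and pairs to 0 with all
  of them, so it is orthogonal to itself.\<close>

lemma chain_space_expand:
  assumes J: "pchain J" and x: "x \<in> chain_space J" "x \<bullet> subset_vec UNIV = 0"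
  shows "x = (\<Sum>s\<in>J. (x \<bullet> subset_vec s) *\<^sub>R uvec J s)"
proof -
  define z where "z = x - (\<Sum>s\<in>J. (x \<bullet> subset_vec s) *\<^sub>R uvec J s)"
  have "z \<in> chain_space J"
    using x(1) uvec_chain_space[OF J] unfolding z_def chain_space_def by (intro span_diff span_sum span_scale) auto
  have "z \<bullet> subset_vec t = 0" if t: "t \<in> insert UNIV J" for t
  proof (cases "t \<in> J")
    case True
    have "(\<Sum>s\<in>J. (x \<bullet> subset_vec s) * (uvec J s \<bullet> subset_vec t)) = (\<Sum>s\<in>J. if s = t then x \<bullet> subset_vec t else 0)"
      using True by (intro sum.cong) (auto simp: uvec_inner_mem[OF J])
    then show ?thesis using True by (simp add: z_def inner_diff_left inner_sum_left)
  next
    case False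
    then have "t = UNIV" using t by simp
    then show ?thesis using x(2) by (simp add: z_def inner_diff_left inner_sum_left uvec_inner_UNIV[OF J])
  qed
  then have "orthogonal z y" if "y \<in> subset_vec ` insert UNIV J" for y
    using that by (auto simp: orthogonal_def)
  then have "orthogonal z z"
    using \<open>z \<in> chain_space J\<close> orthogonal_to_span unfolding chain_space_def by blast
  then have "z = 0" by (simp add: orthogonal_def)
  then show ?thesis by (simp add: z_def)
qed

lemma uvec_inj: "pchain J \<Longrightarrow> inj_on (uvec J) J"
  by (rule inj_onI) (metis uvec_inner_mem zero_neq_one)

lemma uvec_independent:
  assumes J: "pchain (J :: 'n::finite set set)"
  shows "independent (uvec J ` J)"
proof (rule ccontr)
  assume "\<not> independent (uvec J ` J)"
  then obtain c where c: "\<exists>v\<in>uvec J ` J. c v \<noteq> 0" "(\<Sum>v\<in>uvec J ` J. c v *\<^sub>R v) = 0"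
    using dependent_finite[of "uvec J ` J"] by auto
  then obtain t where t: "t \<in> J" "c (uvec J t) \<noteq> 0" by blast
  have "0 = (\<Sum>s\<in>J. c (uvec J s) *\<^sub>R uvec J s) \<bullet> subset_vec t"
    using c(2) by (simp add: sum.reindex[OF uvec_inj[OF J]])
  also have "\<dots> = (\<Sum>s\<in>J. if s = t then c (uvec J t) else 0)"
    unfolding inner_sum_left using t(1) by (intro sum.cong) (auto simp: uvec_inner_mem[OF J])
  also have "\<dots> = c (uvec J t)" using t(1) by simp
  finally show False using t(2) by simp
qed

text \<open>The vector of the smaller chain lies in the space of the larger one, and its coordinates
  there are its pairings with the e_s: 1 at S, 0 at the rest of K, and \<open>tent\<close> outside
  K. This replaces the linear relation of the Chow ring, where the left hand side counts as
  0.\<close>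

lemma uvec_expand:
  assumes J: "pchain J" and K: "K \<subseteq> J" "S \<in> K"
  shows "uvec K S = uvec J S + (\<Sum>s\<in>J - K. tent S K s *\<^sub>R uvec J s)"
proof -
  have pK: "pchain K" using pchain_subset J K by blast
  have "uvec K S = (\<Sum>s\<in>J. (uvec K S \<bullet> subset_vec s) *\<^sub>R uvec J s)"
    using uvec_chain_space[OF pK K(2)] chain_space_mono[OF K(1)] uvec_inner_UNIV[OF pK K(2)]
    by (intro chain_space_expand[OF J]) auto
  also have "\<dots> = (\<Sum>s\<in>K. (uvec K S \<bullet> subset_vec s) *\<^sub>R uvec J s) + (\<Sum>s\<in>J - K. (uvec K S \<bullet> subset_vec s) *\<^sub>R uvec J s)"
    using K(1) by (subst sum.subset_diff[of K]) auto
  also have "(\<Sum>s\<in>K. (uvec K S \<bullet> subset_vec s) *\<^sub>R uvec J s) = (\<Sum>s\<in>K. if s = S then uvec J S else 0)"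
    using K(2) by (intro sum.cong) (auto simp: uvec_inner_mem[OF pK])
  also have "\<dots> = uvec J S" using K(2) by simp
  also have "(\<Sum>s\<in>J - K. (uvec K S \<bullet> subset_vec s) *\<^sub>R uvec J s) = (\<Sum>s\<in>J - K. tent S K s *\<^sub>R uvec J s)"
    by (intro sum.cong) (auto simp: uvec_inner_tent[OF J K])
  finally show ?thesis .
qed

section \<open>The local function of a chain\<close>

text \<open>The coordinate y_S of the overview. The sign makes it positive on the convergence
  domain, where a ray contributes 1 / y_S to the integral and 1 / (1 - exp (-y_S)) to the
  sum.\<close>

definition lval :: "real ^ 'n::finite \<Rightarrow> 'n set \<Rightarrow> 'n set set \<Rightarrow> real" where
  "lval \<xi> S J = - (\<xi> \<bullet> uvec J S)"

definition series :: "(nat \<Rightarrow> real) \<Rightarrow> ('n::finite set \<Rightarrow> 'n set set \<Rightarrow> real) \<Rightarrow> 'n set \<Rightarrow>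
    ('n set set \<Rightarrow> real) \<Rightarrow> 'n set set \<Rightarrow> real" where
  "series c l S V K = suminf (\<lambda>n. c (Suc n) * (step l S ^^ n) V K)"

fun proc :: "(nat \<Rightarrow> real) \<Rightarrow> ('n::finite set \<Rightarrow> 'n set set \<Rightarrow> real) \<Rightarrow> 'n set list \<Rightarrow>
    ('n set set \<Rightarrow> real) \<Rightarrow> 'n set set \<Rightarrow> real" where
  "proc c l [] V = V"
| "proc c l (h # hs) V = proc c l hs (series c l h V)"

text \<open>The expression of \<open>alpha_eq_proc0\<close> with the linear forms no longer set to
  0; at the origin it therefore returns \<open>alpha\<close>.\<close>

definition mu :: "'n::finite set set \<Rightarrow> real ^ 'n \<Rightarrow> real" where
  "mu J \<xi> = (\<Sum>Hs\<in>chains_of_subsets. proc rtodd (lval \<xi>) Hs (delta (set Hs)) J)"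

lemma tent_le_1: "\<bar>tent S J s :: real\<bar> \<le> 1"
proof -
  \<comment> \<open>This includes b = 0, where the quotient is 0.\<close>
  have q: "real a / real b \<le> 1" if "a \<le> b" for a b :: nat
    using that by (cases "b = 0") (auto simp: divide_le_eq_1)
  have "real (card (s - pred_in S J)) / real (card (S - pred_in S J)) \<le> 1" if "s \<subset> S"
    using that by (intro q card_mono) auto
  moreover have "real (card (succ_in S J - s)) / real (card (succ_in S J - S)) \<le> 1" if "S \<subset> s"
    using that by (intro q card_mono) auto
  ultimately show ?thesis unfolding tent_def by auto
qed

lemma step_cong:
  assumes "\<And>K S. K \<subseteq> J \<Longrightarrow> S \<in> K \<Longrightarrow> l S K = l' S K" "\<And>K. K \<subseteq> J \<Longrightarrow> V K = V' K" "K \<subseteq> J"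
  shows "step l S V K = step l' S V' K"
proof -
  have "(\<Sum>s\<in>K - {S}. tent S (K - {s}) s * V (K - {s})) = (\<Sum>s\<in>K - {S}. tent S (K - {s}) s * V' (K - {s}))"
    using assms(3) by (intro sum.cong refl arg_cong2[where f="(*)"] assms(2)) blast
  then show ?thesis using assms by (simp add: step_def)
qed

lemma step_power_cong:
  assumes "\<And>K S. K \<subseteq> J \<Longrightarrow> S \<in> K \<Longrightarrow> l S K = l' S K" "\<And>K. K \<subseteq> J \<Longrightarrow> V K = V' K" "K \<subseteq> J"
  shows "(step l S ^^ n) V K = (step l' S ^^ n) V' K"
  using assms(3)
proof (induction n arbitrary: K)
  case (Suc n)
  have "step l S ((step l S ^^ n) V) K = step l' S ((step l' S ^^ n) V') K"
    by (rule step_cong[where J=J]) (use assms(1) Suc in auto)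
  then show ?case by simp
qed (use assms(2) in simp)

lemma proc_cong:
  assumes "\<And>K S. K \<subseteq> J \<Longrightarrow> S \<in> K \<Longrightarrow> l S K = l' S K" "\<And>K. K \<subseteq> J \<Longrightarrow> V K = V' K" "K \<subseteq> J"
  shows "proc c l Hs V K = proc c l' Hs V' K"
  using assms(2)
proof (induction Hs arbitrary: V V')
  case (Cons h Hs)
  have "series c l h V M = series c l' h V' M" if "M \<subseteq> J" for M
    unfolding series_def using step_power_cong[OF assms(1) Cons.prems that] by simp
  then show ?case using Cons.IH by simp
qed (use assms(3) in simp)

text \<open>\<open>step\<close> at K consults only subsets of K, so \<open>mu J\<close> is a
  function of the pairings with the vectors \<open>uvec K S\<close> for K inside J. This is how its
  dependence on a projection alone becomes visible.\<close>

lemma mu_cong: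
  assumes "\<And>K S. K \<subseteq> J \<Longrightarrow> S \<in> K \<Longrightarrow> \<xi> \<bullet> uvec K S = \<eta> \<bullet> uvec K S"
  shows "mu J \<xi> = mu J \<eta>"
  unfolding mu_def by (intro sum.cong refl proc_cong[where J=J]) (auto simp: lval_def assms)

lemma step_of_rat: "step0 S (\<lambda>J. of_rat (V J)) K = (of_rat (step0 S V K) :: real)"
  by (simp add: step_def of_rat_minus of_rat_sum of_rat_mult tent_def of_rat_divide if_distrib[of of_rat] cong: if_cong)

lemma step_power_of_rat: "(step0 S ^^ n) (\<lambda>J. of_rat (V J)) K = (of_rat ((step0 S ^^ n) V K) :: real)"
proof (induction n arbitrary: K)
  case (Suc n)
  then have "(step0 S ^^ n) (\<lambda>J. of_rat (V J)) = (\<lambda>K. of_rat ((step0 S ^^ n) V K) :: real)" by blast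
  then show ?case by (simp add: step_of_rat)
qed simp

lemma proc_of_rat: "proc rtodd (\<lambda>_ _. 0) Hs (\<lambda>J. of_rat (V J)) K = of_rat (proc0 todd_coeff Hs V K)"
proof (induction Hs arbitrary: V)
  case (Cons h Hs)
  have "series rtodd (\<lambda>_ _. 0) h (\<lambda>J. of_rat (V J)) K = of_rat (series0 todd_coeff h V K)" for K
  proof -
    have "series rtodd (\<lambda>_ _. 0) h (\<lambda>J. of_rat (V J)) K =
        (\<Sum>n\<le>CARD('a set). rtodd (Suc n) * (step0 h ^^ n) (\<lambda>J. of_rat (V J)) K)"
      unfolding series_def
    proof (rule suminf_finite)
      fix n assume "n \<notin> {..CARD('a set)}"
      then have "card K < n" using card_mono[OF finite subset_UNIV, of K] by (simp only: atMost_iff not_le)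
      then show "rtodd (Suc n) * (step0 h ^^ n) (\<lambda>J. of_rat (V J)) K = 0" by (simp add: step0_nilpotent)
    qed simp
    then show ?thesis
      unfolding series0_def by (simp add: step_power_of_rat rtodd_def of_rat_sum of_rat_mult)
  qed
  then have "series rtodd (\<lambda>_ _. 0) h (\<lambda>J. of_rat (V J)) = (\<lambda>K. of_rat (series0 todd_coeff h V K))" by blast
  then show ?case by (simp add: Cons)
qed simp

lemma mu_0:
  assumes "Ts \<in> (chains_of_subsets :: 'n::finite set list set)"
  shows "mu (set Ts) 0 = of_rat (alpha Ts)"
proof -
  have l0: "lval (0 :: real ^ 'n) = (\<lambda>_ _. 0)" by (simp add: lval_def fun_eq_iff)
  have dl: "delta J = (\<lambda>K. of_rat (delta J K) :: real)" for J :: "'n set set"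
    by (auto simp: delta_def)
  show ?thesis
    unfolding mu_def alpha_eq_proc0[OF assms] of_rat_sum l0
    by (intro sum.cong refl, subst dl, rule proc_of_rat)
qed

text \<open>
  The factor \<open>(1 / e) ^ card K\<close> makes the norm of \<open>step\<close> small: multiplication by a linear form costs \<open>2 * r\<close>,
  and each insertion of a set into a chain costs \<open>e\<close>.
\<close>

definition tuple_bound :: "real \<Rightarrow> real \<Rightarrow> ('n::finite set set \<Rightarrow> real ^ 'n \<Rightarrow> real) \<Rightarrow> real \<Rightarrow> bool" where
  "tuple_bound r e W B \<longleftrightarrow> (\<forall>K. majorized r (W K) (B * (1 / e) ^ card K))"

section \<open>Convergence of the reduction in a weighted norm\<close>

context
  fixes r e \<rho> :: real and ty :: "'n::finite itself"
  assumes r: "0 < r" and e: "0 < e" and \<rho>: "2 * r + real CARD('n set) * e \<le> \<rho>"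
begin

text \<open>The norm of \<open>step\<close> is at most \<open>\<rho>\<close>: the linear form
  contributes 2 r, and each of the at most \<open>CARD('n set)\<close> deletions contributes
  e.\<close>

lemma tuple_bound_step:
  fixes W :: "'n set set \<Rightarrow> real ^ 'n \<Rightarrow> real"
  assumes W: "tuple_bound r e W B" and B: "0 \<le> B"
  shows "tuple_bound r e (\<lambda>K \<xi>. step (lval \<xi>) S (\<lambda>K. W K \<xi>) K) (\<rho> * B)"
  unfolding tuple_bound_def
proof
  fix K :: "'n set set"
  have \<rho>0: "0 \<le> \<rho>" using \<rho> r e by (smt (verit) mult_nonneg_nonneg of_nat_0_le_iff)
  show "majorized r (\<lambda>\<xi>. step (lval \<xi>) S (\<lambda>K. W K \<xi>) K) (\<rho> * B * (1 / e) ^ card K)"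
  proof (cases "S \<in> K")
    case False
    then show ?thesis
      using majorized_mono[OF majorized_0, of "\<rho> * B * (1 / e) ^ card K" r] B e \<rho>0 by (simp add: step_def)
  next
    case True
    let ?X = "B * (1 / e) ^ card K"
    have X0: "0 \<le> ?X" using B e by simp
    have 1: "majorized r (\<lambda>\<xi>. (\<xi> \<bullet> - uvec K S) * W K \<xi>) (2 * r * ?X)"
    proof (rule majorized_mono)
      show "majorized r (\<lambda>\<xi>. (\<xi> \<bullet> - uvec K S) * W K \<xi>) ((\<Sum>i\<in>UNIV. \<bar>(- uvec K S) $ i\<bar>) * r * ?X)"
        using W r by (intro majorized_inner) (auto simp: tuple_bound_def)
      show "(\<Sum>i\<in>UNIV. \<bar>(- uvec K S) $ i\<bar>) * r * ?X \<le> 2 * r * ?X"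
        using uvec_norm1[of K S] r X0 by (intro mult_right_mono) auto
    qed
    have 2: "majorized r (\<lambda>\<xi>. \<Sum>s\<in>K - {S}. - tent S (K - {s}) s * W (K - {s}) \<xi>) (\<Sum>s\<in>K - {S}. e * ?X)"
    proof (rule majorized_finite_sum)
      fix s assume s: "s \<in> K - {S}"
      show "majorized r (\<lambda>\<xi>. - tent S (K - {s}) s * W (K - {s}) \<xi>) (e * ?X)"
      proof (rule majorized_mono)
        show "majorized r (\<lambda>\<xi>. - tent S (K - {s}) s * W (K - {s}) \<xi>)
            (\<bar>- tent S (K - {s}) s\<bar> * (B * (1 / e) ^ card (K - {s})))"
          using W by (intro majorized_cmult) (auto simp: tuple_bound_def)
        \<comment> \<open>The weight at K - {s} has one factor 1 / e fewer than that at K; this is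
          the gain e.\<close>
        have "card K = Suc (card (K - {s}))" by (rule card.remove) (use s in auto)
        then have eq: "e * ?X = 1 * (B * (1 / e) ^ card (K - {s}))" using e by (simp add: field_simps)
        show "\<bar>- tent S (K - {s}) s\<bar> * (B * (1 / e) ^ card (K - {s})) \<le> e * ?X"
          unfolding eq using tent_le_1[of S "K - {s}" s] B e by (intro mult_right_mono) simp_all
      qed
    qed (use r in simp)
    have "majorized r (\<lambda>\<xi>. (\<xi> \<bullet> - uvec K S) * W K \<xi> + (\<Sum>s\<in>K - {S}. - tent S (K - {s}) s * W (K - {s}) \<xi>))
        (2 * r * ?X + (\<Sum>s\<in>K - {S}. e * ?X))"
      using majorized_add[OF 1 2] r by simp
    moreover have "2 * r * ?X + (\<Sum>s\<in>K - {S}. e * ?X) \<le> \<rho> * ?X"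
    proof -
      have "real (card (K - {S})) \<le> real CARD('n set)" by (intro of_nat_mono card_mono) auto
      then have "2 * r + real (card (K - {S})) * e \<le> \<rho>"
        using \<rho> mult_right_mono[of "real (card (K - {S}))" "real CARD('n set)" e] e by linarith
      from mult_right_mono[OF this X0] show ?thesis by (simp add: algebra_simps)
    qed
    ultimately show ?thesis
      using True majorized_mono by (fastforce simp: step_def lval_def sum_negf mult.assoc)
  qed
qed

lemma tuple_bound_power:
  fixes W :: "'n set set \<Rightarrow> real ^ 'n \<Rightarrow> real"
  assumes W: "tuple_bound r e W B" and B: "0 \<le> B"
  shows "tuple_bound r e (\<lambda>K \<xi>. (step (lval \<xi>) S ^^ n) (\<lambda>K. W K \<xi>) K) (\<rho> ^ n * B)"
proof (induction n)
  case (Suc n)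
  have \<rho>0: "0 \<le> \<rho>" using \<rho> r e by (smt (verit) mult_nonneg_nonneg of_nat_0_le_iff)
  have "0 \<le> \<rho> ^ n * B" using \<rho>0 B by simp
  from tuple_bound_step[OF Suc this, of S] show ?case by (simp add: mult.assoc)
qed (use W in simp)

context
  assumes sm: "summable (\<lambda>n. \<bar>rtodd (Suc n)\<bar> * \<rho> ^ n)"
begin

definition "todd_bound = suminf (\<lambda>n. \<bar>rtodd (Suc n)\<bar> * \<rho> ^ n)"

lemma todd_bound_nonneg: "0 \<le> todd_bound"
proof -
  have \<rho>0: "0 \<le> \<rho>" using \<rho> r e by (smt (verit) mult_nonneg_nonneg of_nat_0_le_iff)
  then show ?thesis unfolding todd_bound_def by (intro suminf_nonneg sm) auto
qed

lemma majorized_abs_le: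
  assumes "majorized r g B" "box_pt r \<xi>"
  shows "\<bar>g \<xi>\<bar> \<le> B"
proof -
  obtain a s where a: "((\<lambda>k. \<bar>a k\<bar> * r ^ vdeg k) has_sum s) UNIV" "s \<le> B" "((\<lambda>k. a k * vmon \<xi> k) has_sum g \<xi>) UNIV"
    using assms unfolding majorized_def by blast
  have le: "norm (a k * vmon \<xi> k) \<le> \<bar>a k\<bar> * r ^ vdeg k" for k
    using vmon_bound[OF assms(2), of k] by (simp add: abs_mult mult_left_mono)
  have "(\<lambda>k. norm (a k * vmon \<xi> k)) summable_on UNIV"
    using le by (intro summable_on_comparison_test[OF has_sum_imp_summable[OF a(1)]]) auto
  then obtain t where t: "((\<lambda>k. norm (a k * vmon \<xi> k)) has_sum t) UNIV" using summable_iff_has_sum_infsum by blast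
  have "norm (g \<xi>) \<le> t" by (rule norm_has_sum_bound[OF t a(3)])
  also have "t \<le> s" by (rule has_sum_mono[OF t a(1) le])
  finally show ?thesis using a(2) by simp
qed

lemma series_terms_summable:
  fixes W :: "'n set set \<Rightarrow> real ^ 'n \<Rightarrow> real"
  assumes W: "tuple_bound r e W B" and B: "0 \<le> B" and \<xi>: "box_pt r \<xi>"
  shows "summable (\<lambda>n. rtodd (Suc n) * (step (lval \<xi>) S ^^ n) (\<lambda>K. W K \<xi>) K)"
proof (rule summable_comparison_test')
  show "summable (\<lambda>n. \<bar>rtodd (Suc n)\<bar> * \<rho> ^ n * (B * (1 / e) ^ card K))" by (rule summable_mult2[OF sm])
  fix n :: nat assume "0 \<le> n"
  have "\<bar>(step (lval \<xi>) S ^^ n) (\<lambda>K. W K \<xi>) K\<bar> \<le> \<rho> ^ n * B * (1 / e) ^ card K"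
    using tuple_bound_power[OF W B, where S=S and n=n] \<xi> by (intro majorized_abs_le) (auto simp: tuple_bound_def)
  then show "norm (rtodd (Suc n) * (step (lval \<xi>) S ^^ n) (\<lambda>K. W K \<xi>) K) \<le> \<bar>rtodd (Suc n)\<bar> * \<rho> ^ n * (B * (1 / e) ^ card K)"
    by (simp add: abs_mult mult.assoc mult_left_mono)
qed

lemma tuple_bound_series:
  fixes W :: "'n set set \<Rightarrow> real ^ 'n \<Rightarrow> real"
  assumes W: "tuple_bound r e W B" and B: "0 \<le> B"
  shows "tuple_bound r e (\<lambda>K \<xi>. series rtodd (lval \<xi>) S (\<lambda>K. W K \<xi>) K) (todd_bound * B)"
  unfolding tuple_bound_def
proof
  fix K :: "'n set set"
  let ?b = "\<lambda>n. \<bar>rtodd (Suc n)\<bar> * \<rho> ^ n * (B * (1 / e) ^ card K)"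
  have "majorized r (\<lambda>\<xi>. series rtodd (lval \<xi>) S (\<lambda>K. W K \<xi>) K) (suminf ?b)"
  proof (rule majorized_sums)
    show "majorized r (\<lambda>\<xi>. rtodd (Suc n) * (step (lval \<xi>) S ^^ n) (\<lambda>K. W K \<xi>) K) (?b n)" for n
      using majorized_cmult[of r "\<lambda>\<xi>. (step (lval \<xi>) S ^^ n) (\<lambda>K. W K \<xi>) K" "\<rho> ^ n * B * (1 / e) ^ card K" "rtodd (Suc n)"]
        tuple_bound_power[OF W B, where S=S and n=n] by (simp add: tuple_bound_def mult.assoc)
    show "summable ?b" by (rule summable_mult2[OF sm])
    show "(\<lambda>n. rtodd (Suc n) * (step (lval \<xi>) S ^^ n) (\<lambda>K. W K \<xi>) K) sums series rtodd (lval \<xi>) S (\<lambda>K. W K \<xi>) K"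
      if "box_pt r \<xi>" for \<xi>
      unfolding series_def by (rule summable_sums[OF series_terms_summable[OF W B that]])
  qed (rule r)
  moreover have "suminf ?b = todd_bound * B * (1 / e) ^ card K"
    unfolding todd_bound_def using suminf_mult2[OF sm, of "B * (1 / e) ^ card K"] by (simp add: mult.assoc)
  ultimately show "majorized r (\<lambda>\<xi>. series rtodd (lval \<xi>) S (\<lambda>K. W K \<xi>) K) (todd_bound * B * (1 / e) ^ card K)" by simp
qed

lemma tuple_bound_proc:
  fixes W :: "'n set set \<Rightarrow> real ^ 'n \<Rightarrow> real"
  assumes "tuple_bound r e W B" "0 \<le> B"
  shows "\<exists>B'\<ge>0. tuple_bound r e (\<lambda>K \<xi>. proc rtodd (lval \<xi>) Hs (\<lambda>K. W K \<xi>) K) B'"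
  using assms
proof (induction Hs arbitrary: W B)
  case (Cons h Hs)
  have "0 \<le> todd_bound * B" using Cons.prems(2) todd_bound_nonneg by simp
  from Cons.IH[OF tuple_bound_series[OF Cons.prems, of h] this] show ?case by simp
qed auto

lemma tuple_bound_delta: "tuple_bound r e (\<lambda>K \<xi>. delta H K) ((max 1 e) ^ card (H :: 'n set set))"
  unfolding tuple_bound_def
proof
  fix K :: "'n set set"
  show "majorized r (\<lambda>\<xi>. delta H K) (max 1 e ^ card H * (1 / e) ^ card K)"
  proof (cases "K = H")
    case True
    \<comment> \<open>\<open>max 1 e\<close> compensates the factor 1 / e per element of H, whether
      e is below or above 1.\<close>
    have "1 \<le> (max 1 e * (1 / e)) ^ card H" using e by (intro one_le_power) (simp add: field_simps)
    then have "\<bar>1\<bar> \<le> max 1 e ^ card H * (1 / e) ^ card K"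
      unfolding power_mult_distrib using True by simp
    from majorized_mono[OF majorized_const this] show ?thesis using True by (simp add: delta_def)
  next
    case False
    have "0 \<le> max 1 e ^ card H * (1 / e) ^ card K" using e by simp
    from majorized_mono[OF majorized_0 this] show ?thesis using False by (simp add: delta_def)
  qed
qed

lemma mu_majorized: "\<exists>B. majorized r (mu (J :: 'n set set)) B"
proof -
  have "\<exists>B. majorized r (\<lambda>\<xi>. proc rtodd (lval \<xi>) Hs (delta (set Hs)) J) B" for Hs :: "'n set list"
    using tuple_bound_proc[OF tuple_bound_delta, of "set Hs" Hs] unfolding tuple_bound_def by auto
  then obtain B where "\<And>Hs :: 'n set list. majorized r (\<lambda>\<xi>. proc rtodd (lval \<xi>) Hs (delta (set Hs)) J) (B Hs)" by metis
  then have "majorized r (\<lambda>\<xi>. \<Sum>Hs\<in>chains_of_subsets. proc rtodd (lval \<xi>) Hs (delta (set Hs)) J) (\<Sum>Hs\<in>chains_of_subsets. B Hs)"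
    using r by (intro majorized_finite_sum) auto
  then show ?thesis unfolding mu_def by blast
qed

text \<open>The counterpart of \<open>Phi\<close>: the variable of s becomes the coordinate y_s of
  the fixed chain J, so only subsets of J are evaluated.\<close>

definition ev :: "'n set set \<Rightarrow> real ^ 'n \<Rightarrow> ('n set set \<Rightarrow> real) \<Rightarrow> real" where
  "ev J \<xi> V = (\<Sum>K\<in>Pow J. (\<Prod>s\<in>K. lval \<xi> s J) * V K)"

lemma lval_expand:
  fixes J :: "'n set set"
  assumes "pchain J" "K \<subseteq> J" "S \<in> K"
  shows "lval \<xi> S K = lval \<xi> S J + (\<Sum>s\<in>J - K. tent S K s * lval \<xi> s J)"
  unfolding lval_def uvec_expand[OF assms] by (simp add: inner_add_right inner_sum_right sum_negf)

text \<open>\<open>lval_expand\<close> takes the place of \<open>chain_relation\<close>: the linear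
  form at K is y_S plus contributions of the members of J outside K, and the insertions in
  \<open>step\<close> cancel exactly these. So the identity holds on the nose, not modulo an
  ideal.\<close>

lemma ev_step:
  assumes J: "pchain J" and S: "S \<in> J" and V: "\<And>K. V K \<noteq> 0 \<Longrightarrow> S \<in> K"
  shows "ev J \<xi> (step (lval \<xi>) S V) = lval \<xi> S J * ev J \<xi> V"
proof -
  let ?P = "{K\<in>Pow J. S \<in> K}" and ?y = "\<lambda>K. \<Prod>s\<in>K. lval \<xi> s J"
  have "ev J \<xi> (step (lval \<xi>) S V) = (\<Sum>K\<in>?P. ?y K * step (lval \<xi>) S V K)"
    unfolding ev_def by (rule sum.mono_neutral_right) (auto simp: step_def)
  also have "\<dots> = (\<Sum>K\<in>?P. ?y K * lval \<xi> S K * V K) - (\<Sum>K\<in>?P. \<Sum>s\<in>K - {S}. ?y (insert s (K - {s})) * (tent S (K - {s}) s * V (K - {s})))"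
    unfolding sum_subtractf[symmetric]
    by (intro sum.cong) (auto simp: step_def algebra_simps sum_distrib_left insert_absorb)
  also have "(\<Sum>K\<in>?P. \<Sum>s\<in>K - {S}. ?y (insert s (K - {s})) * (tent S (K - {s}) s * V (K - {s}))) =
      (\<Sum>K\<in>?P. \<Sum>s\<in>J - K. ?y (insert s K) * (tent S K s * V K))"
    by (rule sum_remove_reindex[where g="\<lambda>K s. ?y (insert s K) * (tent S K s * V K)"]) simp
  also have "\<dots> = (\<Sum>K\<in>?P. ?y K * (\<Sum>s\<in>J - K. tent S K s * lval \<xi> s J) * V K)"
    by (intro sum.cong refl) (simp add: sum_distrib_left sum_distrib_right mult_ac)
  also have "(\<Sum>K\<in>?P. ?y K * lval \<xi> S K * V K) - \<dots> = (\<Sum>K\<in>?P. lval \<xi> S J * (?y K * V K))"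
    unfolding sum_subtractf[symmetric]
  proof (intro sum.cong refl)
    fix K assume "K \<in> ?P"
    then have "lval \<xi> S K = lval \<xi> S J + (\<Sum>s\<in>J - K. tent S K s * lval \<xi> s J)"
      by (intro lval_expand[OF J]) auto
    then show "?y K * lval \<xi> S K * V K - ?y K * (\<Sum>s\<in>J - K. tent S K s * lval \<xi> s J) * V K = lval \<xi> S J * (?y K * V K)"
      by (simp only: algebra_simps)
  qed
  also have "\<dots> = lval \<xi> S J * (\<Sum>K\<in>?P. ?y K * V K)" by (simp add: sum_distrib_left)
  also have "(\<Sum>K\<in>?P. ?y K * V K) = ev J \<xi> V"
    unfolding ev_def by (rule sum.mono_neutral_left) (use V in auto)
  finally show ?thesis .
qed

lemma ev_step_power:
  assumes J: "pchain J" and S: "S \<in> J" and V: "\<And>K. V K \<noteq> 0 \<Longrightarrow> S \<in> K"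
  shows "ev J \<xi> ((step (lval \<xi>) S ^^ n) V) = lval \<xi> S J ^ n * ev J \<xi> V"
proof (induction n)
  case (Suc n)
  let ?W = "(step (lval \<xi>) S ^^ n) V"
  have "S \<in> K" if "?W K \<noteq> 0" for K
  proof (cases n)
    case (Suc m)
    then show ?thesis using that step_def[of "lval \<xi>" S "(step (lval \<xi>) S ^^ m) V" K] by (auto split: if_splits)
  qed (use that V in simp)
  from ev_step[OF J S, of ?W \<xi>, OF this] show ?case using Suc by simp
qed simp

context
  assumes td: "\<And>y. y \<noteq> 0 \<Longrightarrow> \<bar>y\<bar> \<le> \<rho> \<Longrightarrow> (\<lambda>n. rtodd (Suc n) * y ^ n) sums ((y / (1 - exp (- y)) - 1) / y)"
begin

lemma lval_le: "box_pt r \<xi> \<Longrightarrow> \<bar>lval \<xi> S (J :: 'n set set)\<bar> \<le> \<rho>"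
proof -
  assume b: "box_pt r \<xi>"
  have "\<bar>\<xi> \<bullet> uvec J S\<bar> \<le> (\<Sum>i\<in>UNIV. \<bar>\<xi> $ i * uvec J S $ i\<bar>)"
    unfolding inner_vec_def by (simp add: sum_abs)
  also have "\<dots> \<le> (\<Sum>i\<in>UNIV. r * \<bar>uvec J S $ i\<bar>)"
    using b by (intro sum_mono) (simp add: abs_mult box_pt_def mult_right_mono)
  also have "\<dots> = r * (\<Sum>i\<in>UNIV. \<bar>uvec J S $ i\<bar>)" by (simp add: sum_distrib_left)
  also have "\<dots> \<le> r * 2" using uvec_norm1 r by (intro mult_left_mono) auto
  also have "\<dots> \<le> \<rho>" using \<rho> e mult_nonneg_nonneg[of "real CARD('n set)" e] by linarith
  finally show ?thesis by (simp add: lval_def)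
qed

text \<open>On \<open>ev J\<close> the powers of \<open>step\<close> are powers of y_S, and they sum
  to the Todd series without constant term, divided by y_S. Multiplying by y_S removes that
  quotient.\<close>

lemma ev_series:
  fixes W :: "'n set set \<Rightarrow> real ^ 'n \<Rightarrow> real"
  assumes J: "pchain J" and S: "S \<in> J" and V: "\<And>K. W K \<xi> \<noteq> 0 \<Longrightarrow> S \<in> K"
    and W: "tuple_bound r e W B" "0 \<le> B" and \<xi>: "box_pt r \<xi>" and y: "lval \<xi> S J \<noteq> 0"
  shows "lval \<xi> S J * ev J \<xi> (series rtodd (lval \<xi>) S (\<lambda>K. W K \<xi>)) =
    (lval \<xi> S J / (1 - exp (- lval \<xi> S J)) - 1) * ev J \<xi> (\<lambda>K. W K \<xi>)"
proof -
  let ?V = "\<lambda>K. W K \<xi>" and ?y = "lval \<xi> S J"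
  have "(\<lambda>n. \<Sum>K\<in>Pow J. (\<Prod>s\<in>K. lval \<xi> s J) * (rtodd (Suc n) * (step (lval \<xi>) S ^^ n) ?V K)) sums
      ev J \<xi> (series rtodd (lval \<xi>) S ?V)"
    unfolding ev_def series_def
    by (intro sums_sum sums_mult summable_sums series_terms_summable[OF W \<xi>])
  moreover have "(\<Sum>K\<in>Pow J. (\<Prod>s\<in>K. lval \<xi> s J) * (rtodd (Suc n) * (step (lval \<xi>) S ^^ n) ?V K)) =
      rtodd (Suc n) * ?y ^ n * ev J \<xi> ?V" for n
  proof -
    have "(\<Sum>K\<in>Pow J. (\<Prod>s\<in>K. lval \<xi> s J) * (rtodd (Suc n) * (step (lval \<xi>) S ^^ n) ?V K)) =
        rtodd (Suc n) * ev J \<xi> ((step (lval \<xi>) S ^^ n) ?V)"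
      unfolding ev_def sum_distrib_left by (intro sum.cong refl) simp
    then show ?thesis using ev_step_power[OF J S, of ?V \<xi> n, OF V] by simp
  qed
  ultimately have "(\<lambda>n. rtodd (Suc n) * ?y ^ n * ev J \<xi> ?V) sums ev J \<xi> (series rtodd (lval \<xi>) S ?V)" by simp
  moreover have "(\<lambda>n. rtodd (Suc n) * ?y ^ n * ev J \<xi> ?V) sums ((?y / (1 - exp (- ?y)) - 1) / ?y * ev J \<xi> ?V)"
    by (intro sums_mult2 td y lval_le \<xi>)
  ultimately have "ev J \<xi> (series rtodd (lval \<xi>) S ?V) = (?y / (1 - exp (- ?y)) - 1) / ?y * ev J \<xi> ?V"
    by (rule sums_unique2)
  then show ?thesis using y by simp
qed

lemma series_support:
  assumes "\<And>J. V J \<noteq> 0 \<Longrightarrow> H \<subseteq> J" "S \<in> H" "series c l S V J \<noteq> 0"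
  shows "H \<subseteq> J"
proof (rule ccontr)
  assume "\<not> H \<subseteq> J"
  then have "(step l S ^^ n) V J = 0" for n
    using step_power_support[OF assms(1) _ assms(2)] by blast
  then show False using assms(3) by (simp add: series_def)
qed

lemma proc_support:
  assumes "\<And>J. V J \<noteq> 0 \<Longrightarrow> H \<subseteq> J" "set Hs \<subseteq> H" "proc c l Hs V J \<noteq> 0"
  shows "H \<subseteq> J"
  using assms
proof (induction Hs arbitrary: V)
  case (Cons h Hs)
  show ?case
    by (rule Cons.IH[of "series c l h V"]) (use Cons.prems series_support[of V H h c l] in auto)
qed auto

lemma ev_proc:
  fixes W :: "'n set set \<Rightarrow> real ^ 'n \<Rightarrow> real"
  assumes J: "pchain J" and Hs: "set Hs \<subseteq> J" "set Hs \<subseteq> H" and V: "\<And>K. W K \<xi> \<noteq> 0 \<Longrightarrow> H \<subseteq> K"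
    and W: "tuple_bound r e W B" "0 \<le> B" and \<xi>: "box_pt r \<xi>" and y: "\<And>s. s \<in> J \<Longrightarrow> lval \<xi> s J \<noteq> 0"
  shows "(\<Prod>h\<leftarrow>Hs. lval \<xi> h J) * ev J \<xi> (proc rtodd (lval \<xi>) Hs (\<lambda>K. W K \<xi>)) =
    (\<Prod>h\<leftarrow>Hs. lval \<xi> h J / (1 - exp (- lval \<xi> h J)) - 1) * ev J \<xi> (\<lambda>K. W K \<xi>)"
  using Hs V W
proof (induction Hs arbitrary: W B)
  case (Cons h Hs)
  let ?W = "\<lambda>K \<xi>. series rtodd (lval \<xi>) h (\<lambda>K. W K \<xi>) K"
  have b: "0 \<le> todd_bound * B" using Cons.prems todd_bound_nonneg by simp
  have 1: "(\<Prod>h\<leftarrow>Hs. lval \<xi> h J) * ev J \<xi> (proc rtodd (lval \<xi>) Hs (\<lambda>K. ?W K \<xi>)) =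
      (\<Prod>h\<leftarrow>Hs. lval \<xi> h J / (1 - exp (- lval \<xi> h J)) - 1) * ev J \<xi> (\<lambda>K. ?W K \<xi>)"
  proof (rule Cons.IH[OF _ _ _ tuple_bound_series[OF Cons.prems(4,5)] b])
    show "H \<subseteq> K" if "?W K \<xi> \<noteq> 0" for K
      using series_support[of "\<lambda>K. W K \<xi>" H h, OF Cons.prems(3) _ that] Cons.prems(2) by simp
  qed (use Cons.prems in auto)
  have 2: "lval \<xi> h J * ev J \<xi> (\<lambda>K. ?W K \<xi>) = (lval \<xi> h J / (1 - exp (- lval \<xi> h J)) - 1) * ev J \<xi> (\<lambda>K. W K \<xi>)"
    using Cons.prems by (intro ev_series[OF J _ _ Cons.prems(4,5) \<xi>] y) auto
  show ?case using 1 2 by (simp add: mult_ac)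
qed simp

text \<open>Expanding the right hand side as a product of 1 plus Todd tails selects the sets of
  heads in J, each listed by exactly one chain. The product of tails is \<open>ev J\<close> of the
  reduced monomial. Head chains not contained in J drop out, since the reduction only enlarges
  sets.\<close>

lemma mu_identity:
  fixes J :: "'n set set"
  assumes J: "pchain J" and \<xi>: "box_pt r \<xi>" and y: "\<And>s. s \<in> J \<Longrightarrow> lval \<xi> s J \<noteq> 0"
  shows "(\<Sum>K\<in>Pow J. (\<Prod>s\<in>K. lval \<xi> s J) * mu K \<xi>) = (\<Prod>s\<in>J. lval \<xi> s J / (1 - exp (- lval \<xi> s J)))"
proof -
  let ?C = "chains_of_subsets :: 'n set list set"
  let ?p = "\<lambda>Hs. proc rtodd (lval \<xi>) Hs (delta (set Hs))"
  let ?q = "\<lambda>s. lval \<xi> s J / (1 - exp (- lval \<xi> s J)) - 1"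
  have supp: "set Hs \<subseteq> K" if "?p Hs K \<noteq> 0" for Hs K
    by (rule proc_support[OF _ subset_refl that]) (auto simp: delta_def split: if_splits)
  have main: "ev J \<xi> (?p Hs) = prod ?q (set Hs)" if Hs: "Hs \<in> ?C" "set Hs \<subseteq> J" for Hs
  proof -
    have "sorted_wrt (\<subset>) Hs" using Hs by (simp add: chains_of_subsets_def)
    then have dst: "distinct Hs" by (induction Hs) auto
    have pl: "(\<Prod>h\<leftarrow>Hs. f h) = prod f (set Hs)" for f :: "'n set \<Rightarrow> real"
      using dst by (simp add: prod.distinct_set_conv_list)
    have nz: "(\<Prod>h\<in>set Hs. lval \<xi> h J) \<noteq> 0" using y Hs by (auto simp: prod_zero_iff)
    \<comment> \<open>The starting tuple evaluates to the product of the coordinates of the heads,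
      which cancels the factor on the left of \<open>ev_proc\<close>.\<close>
    have "ev J \<xi> (delta (set Hs)) = (\<Prod>h\<in>set Hs. lval \<xi> h J)"
      unfolding ev_def delta_def using Hs(2) by (simp add: if_distrib cong: if_cong)
    moreover have "(\<Prod>h\<leftarrow>Hs. lval \<xi> h J) * ev J \<xi> (?p Hs) = (\<Prod>h\<leftarrow>Hs. ?q h) * ev J \<xi> (delta (set Hs))"
      by (rule ev_proc[OF J Hs(2) subset_refl _ tuple_bound_delta _ \<xi> y]) (use e in \<open>auto simp: delta_def split: if_splits\<close>)
    ultimately show ?thesis using nz unfolding pl by simp
  qed
  have z: "ev J \<xi> (?p Hs) = 0" if "\<not> set Hs \<subseteq> J" for Hs
    unfolding ev_def using supp[of Hs] that by (intro sum.neutral) auto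
  have "(\<Sum>K\<in>Pow J. (\<Prod>s\<in>K. lval \<xi> s J) * mu K \<xi>) = (\<Sum>Hs\<in>?C. ev J \<xi> (?p Hs))"
    unfolding mu_def ev_def sum_distrib_left by (rule sum.swap)
  also have "\<dots> = (\<Sum>Hs\<in>{Hs\<in>?C. set Hs \<subseteq> J}. prod ?q (set Hs))"
    using main z by (intro sum.mono_neutral_cong_right) auto
  also have "\<dots> = (\<Sum>H\<in>Pow J. prod ?q H)"
  proof (rule sum.reindex_bij_betw)
    show "bij_betw set {Hs\<in>?C. set Hs \<subseteq> J} (Pow J)"
      unfolding bij_betw_def
    proof
      show "inj_on set {Hs\<in>?C. set Hs \<subseteq> J}"
        by (rule inj_on_subset[OF bij_betw_imp_inj_on[OF bij_chain_lists]]) simp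
      have ex: "\<exists>Hs\<in>?C. set Hs = H" if "H \<subseteq> J" for H
        using chain_list_exists[of H] pchain_subset[OF J that] by (auto simp: pchain_def)
      show "set ` {Hs\<in>?C. set Hs \<subseteq> J} = Pow J"
      proof (intro equalityI subsetI)
        fix H assume "H \<in> Pow J"
        then obtain Hs where "Hs \<in> ?C" "set Hs = H" using ex[of H] by auto
        then show "H \<in> set ` {Hs\<in>?C. set Hs \<subseteq> J}" using \<open>H \<in> Pow J\<close> by (intro image_eqI[of H set Hs]) simp_all
      qed auto
    qed
  qed
  also have "\<dots> = (\<Prod>s\<in>J. ?q s + 1)" by (subst prod_add) auto
  finally show ?thesis by simp
qed

end

end

end

section \<open>Projections along the faces\<close>

lemma perp_proj_eqI:
  assumes "subspace L" "y \<in> L\<^sup>\<bottom>" "x - y \<in> L"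
  shows "perp_proj L x = y"
  unfolding perp_proj_def
proof (rule the_equality)
  show "y \<in> L\<^sup>\<bottom> \<and> x - y \<in> L" using assms by blast
  fix z assume z: "z \<in> L\<^sup>\<bottom> \<and> x - z \<in> L"
  have "(x - y) - (x - z) \<in> L" using z assms subspace_diff by blast
  then have "orthogonal (z - y) z" "orthogonal (z - y) y" using z assms(2) by (auto simp: orthogonal_comp_def)
  then have "orthogonal (z - y) (z - y)" by (simp add: orthogonal_def inner_diff_right)
  then show "z = y" by (simp add: orthogonal_def)
qed

lemma perp_proj_props:
  assumes "subspace L"
  shows "perp_proj L x \<in> L\<^sup>\<bottom>" "x - perp_proj L x \<in> L"
proof -
  obtain y z where yz: "y \<in> span L" "\<And>w. w \<in> span L \<Longrightarrow> orthogonal z w" "x = y + z"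
    using orthogonal_subspace_decomp_exists[of L x] by blast
  have sL: "span L = L" using assms by (simp add: span_eq_iff)
  have z: "z \<in> L\<^sup>\<bottom>" using yz(2) sL by (auto simp: orthogonal_comp_def orthogonal_commute)
  then have "perp_proj L x = z" using assms yz sL by (intro perp_proj_eqI) auto
  then show "perp_proj L x \<in> L\<^sup>\<bottom>" "x - perp_proj L x \<in> L" using z yz sL by auto
qed

lemma perp_proj_inner:
  assumes "subspace L" "\<And>w. w \<in> L \<Longrightarrow> w \<bullet> v = 0"
  shows "perp_proj L x \<bullet> v = x \<bullet> v"
  using assms(2)[OF perp_proj_props(2)[OF assms(1), of x]] by (simp add: inner_diff_left)

lemma norm_perp_proj_le:
  assumes "subspace L"
  shows "norm (perp_proj L x) \<le> norm x"
proof -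
  have "orthogonal (x - perp_proj L x) (perp_proj L x)"
    using perp_proj_props[OF assms, of x] by (auto simp: orthogonal_comp_def)
  then have "norm ((x - perp_proj L x) + perp_proj L x) ^ 2 = norm (x - perp_proj L x) ^ 2 + norm (perp_proj L x) ^ 2"
    by (rule norm_add_Pythagorean)
  then have "norm (perp_proj L x) ^ 2 \<le> norm x ^ 2" by simp
  then show ?thesis by (rule power2_le_imp_le) simp
qed

text \<open>On vectors of sum 0, and for a chain K of proper subsets, this is the orthogonal
  projection to the sum 0 part of the space of K.\<close>

definition chain_proj :: "'n::finite set set \<Rightarrow> real ^ 'n \<Rightarrow> real ^ 'n" where
  "chain_proj K x = (\<Sum>s\<in>K. (x \<bullet> subset_vec s) *\<^sub>R uvec K s)"

lemma sum_uvec_inner: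
  assumes "pchain K" "t \<in> K"
  shows "(\<Sum>s\<in>K. a s *\<^sub>R uvec K s) \<bullet> subset_vec t = a t"
proof -
  have "(\<Sum>s\<in>K. a s *\<^sub>R uvec K s) \<bullet> subset_vec t = (\<Sum>s\<in>K. if s = t then a t else 0)"
    unfolding inner_sum_left using assms(2) by (intro sum.cong) (auto simp: uvec_inner_mem[OF assms(1)])
  then show ?thesis using assms(2) by simp
qed

lemma sum_uvec_inner_UNIV: "pchain K \<Longrightarrow> (\<Sum>s\<in>K. a s *\<^sub>R uvec K s) \<bullet> subset_vec UNIV = 0"
  unfolding inner_sum_left by (intro sum.neutral) (simp add: uvec_inner_UNIV)

lemma sum_uvec_chain_space: "pchain K \<Longrightarrow> (\<Sum>s\<in>K. a s *\<^sub>R uvec K s) \<in> chain_space K"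
  using uvec_chain_space[of K] unfolding chain_space_def by (intro span_sum span_scale) auto

lemma chain_space_perp:
  assumes "\<And>k y. k \<in> insert UNIV K \<Longrightarrow> y \<in> L \<Longrightarrow> y \<bullet> subset_vec k = 0" "x \<in> chain_space K" "y \<in> L"
  shows "y \<bullet> x = 0"
proof -
  have "orthogonal y v" if "v \<in> subset_vec ` insert UNIV K" for v
    using that assms(1)[OF _ assms(3)] by (auto simp: orthogonal_def)
  then have "orthogonal y x" using orthogonal_to_span assms(2) unfolding chain_space_def by blast
  then show ?thesis by (simp add: orthogonal_def)
qed

text \<open>The candidate lies in the space of K, which is orthogonal to L. This serves for spans of
  faces and for the lineality space alike.\<close>

lemma perp_proj_chain:
  assumes K: "pchain K" and L: "subspace L" "\<And>k y. k \<in> insert UNIV K \<Longrightarrow> y \<in> L \<Longrightarrow> y \<bullet> subset_vec k = 0"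
    and x: "x - chain_proj K x \<in> L"
  shows "perp_proj L x = chain_proj K x"
proof (rule perp_proj_eqI[OF L(1) _ x])
  have "chain_proj K x \<in> chain_space K" unfolding chain_proj_def by (rule sum_uvec_chain_space[OF K])
  then show "chain_proj K x \<in> L\<^sup>\<bottom>"
    using chain_space_perp[OF L(2)] by (auto simp: orthogonal_comp_def orthogonal_def)
qed

definition chain_lattice :: "'n::finite set set \<Rightarrow> (real ^ 'n) set" where
  "chain_lattice K = int_span (uvec K ` K)"

definition chain_cone :: "'n::finite set set \<Rightarrow> (real ^ 'n) set" where
  "chain_cone K = convex_cone hull (uvec K ` K)"

lemma chain_lattice_eq:
  assumes K: "pchain K"
  shows "chain_lattice K = {\<Sum>s\<in>K. of_int (k s) *\<^sub>R uvec K s | k. True}"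
proof -
  have inj: "inj_on (uvec K) K" by (rule uvec_inj[OF K])
  show ?thesis unfolding chain_lattice_def int_span_def
  proof (intro equalityI subsetI)
    fix x assume "x \<in> {\<Sum>b\<in>uvec K ` K. of_int (k b) *\<^sub>R b | k. True}"
    then obtain k where "x = (\<Sum>b\<in>uvec K ` K. of_int (k b) *\<^sub>R b)" by blast
    then have "x = (\<Sum>s\<in>K. of_int (k (uvec K s)) *\<^sub>R uvec K s)" by (simp add: sum.reindex[OF inj])
    then show "x \<in> {\<Sum>s\<in>K. of_int (k s) *\<^sub>R uvec K s | k. True}" by (intro CollectI exI conjI, assumption) simp
  next
    fix x assume "x \<in> {\<Sum>s\<in>K. of_int (k s) *\<^sub>R uvec K s | k. True}"
    then obtain k :: "'a set \<Rightarrow> int" where "x = (\<Sum>s\<in>K. of_int (k s) *\<^sub>R uvec K s)" by blast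
    then have "x = (\<Sum>b\<in>uvec K ` K. of_int (k (inv_into K (uvec K) b)) *\<^sub>R b)"
      by (simp add: sum.reindex[OF inj] inv_into_f_f[OF inj])
    then show "x \<in> {\<Sum>b\<in>uvec K ` K. of_int (k b) *\<^sub>R b | k. True}" by (intro CollectI exI conjI, assumption) simp
  qed
qed

lemma chain_cone_eq:
  assumes K: "pchain (K :: 'n::finite set set)"
  shows "chain_cone K = {\<Sum>s\<in>K. a s *\<^sub>R uvec K s | a. \<forall>s\<in>K. 0 \<le> a s}"
proof -
  have inj: "inj_on (uvec K) K" by (rule uvec_inj[OF K])
  have fin: "finite (uvec K ` K)" by simp
  show ?thesis unfolding chain_cone_def cone_hull_finite[OF fin]
  proof (intro equalityI subsetI)
    fix x assume "x \<in> {\<Sum>g\<in>uvec K ` K. a g *\<^sub>R g | a. \<forall>g\<in>uvec K ` K. 0 \<le> a g}"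
    then obtain a where "x = (\<Sum>g\<in>uvec K ` K. a g *\<^sub>R g)" "\<forall>g\<in>uvec K ` K. 0 \<le> a g" by blast
    then have "x = (\<Sum>s\<in>K. a (uvec K s) *\<^sub>R uvec K s)" "\<forall>s\<in>K. 0 \<le> a (uvec K s)" by (simp_all add: sum.reindex[OF inj])
    then show "x \<in> {\<Sum>s\<in>K. a s *\<^sub>R uvec K s | a. \<forall>s\<in>K. 0 \<le> a s}"
      by (intro CollectI exI[of _ "\<lambda>s. a (uvec K s)"] conjI)
  next
    fix x assume "x \<in> {\<Sum>s\<in>K. a s *\<^sub>R uvec K s | a. \<forall>s\<in>K. 0 \<le> a s}"
    then obtain a where a: "x = (\<Sum>s\<in>K. a s *\<^sub>R uvec K s)" "\<forall>s\<in>K. 0 \<le> a s" by blast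
    have "x = (\<Sum>g\<in>uvec K ` K. a (inv_into K (uvec K) g) *\<^sub>R g)"
      by (simp add: a(1) sum.reindex[OF inj] inv_into_f_f[OF inj])
    moreover have "\<forall>g\<in>uvec K ` K. 0 \<le> a (inv_into K (uvec K) g)"
      using a(2) by (auto simp: inv_into_f_f[OF inj])
    ultimately show "x \<in> {\<Sum>g\<in>uvec K ` K. a g *\<^sub>R g | a. \<forall>g\<in>uvec K ` K. 0 \<le> a g}"
      by (intro CollectI exI[of _ "\<lambda>g. a (inv_into K (uvec K) g)"] conjI)
  qed
qed

text \<open>Both kinds of quotient, by the lineality space and by a face, are computed through the
  pairings with the e_s: it is enough that these are integral on X and take all integer values
  simultaneously.\<close>

lemma image_chain_lattice:
  fixes X :: "(real ^ 'n::finite) set"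
  assumes K: "pchain K" and p: "\<And>x. x \<in> X \<Longrightarrow> p x = chain_proj K x"
    and int: "\<And>x s. x \<in> X \<Longrightarrow> s \<in> K \<Longrightarrow> x \<bullet> subset_vec s \<in> \<int>"
    and ex: "\<And>k :: 'n set \<Rightarrow> int. \<exists>x\<in>X. \<forall>s\<in>K. x \<bullet> subset_vec s = of_int (k s)"
  shows "p ` X = chain_lattice K"
  unfolding chain_lattice_eq[OF K]
proof (intro equalityI subsetI)
  fix y assume "y \<in> p ` X"
  then obtain x where x: "x \<in> X" "y = chain_proj K x" using p by auto
  have "x \<bullet> subset_vec s = of_int \<lfloor>x \<bullet> subset_vec s\<rfloor>" if "s \<in> K" for s
    using int[OF x(1) that] by (simp add: of_int_floor_cancel[THEN iffD2] Ints_def)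
  then have "y = (\<Sum>s\<in>K. of_int \<lfloor>x \<bullet> subset_vec s\<rfloor> *\<^sub>R uvec K s)"
    unfolding x(2) chain_proj_def by (intro sum.cong refl) metis
  then show "y \<in> {\<Sum>s\<in>K. of_int (k s) *\<^sub>R uvec K s | k. True}"
    by (intro CollectI exI[of _ "\<lambda>s. \<lfloor>x \<bullet> subset_vec s\<rfloor>"] conjI) simp_all
next
  fix y assume "y \<in> {\<Sum>s\<in>K. of_int (k s) *\<^sub>R uvec K s | k. True}"
  then obtain k :: "'n set \<Rightarrow> int" where k: "y = (\<Sum>s\<in>K. of_int (k s) *\<^sub>R uvec K s)" by blast
  obtain x where x: "x \<in> X" "\<forall>s\<in>K. x \<bullet> subset_vec s = of_int (k s)" using ex by blast
  have "y = p x" unfolding p[OF x(1)] chain_proj_def k using x(2) by (intro sum.cong) auto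
  then show "y \<in> p ` X" using x(1) by blast
qed

lemma image_chain_cone:
  fixes X :: "(real ^ 'n::finite) set"
  assumes K: "pchain K" and p: "\<And>x. x \<in> X \<Longrightarrow> p x = chain_proj K x"
    and nn: "\<And>x s. x \<in> X \<Longrightarrow> s \<in> K \<Longrightarrow> 0 \<le> x \<bullet> subset_vec s"
    and ex: "\<And>a :: 'n set \<Rightarrow> real. (\<And>s. 0 \<le> a s) \<Longrightarrow> \<exists>x\<in>X. \<forall>s\<in>K. x \<bullet> subset_vec s = a s"
  shows "p ` X = chain_cone K"
  unfolding chain_cone_eq[OF K]
proof (intro equalityI subsetI)
  fix y assume "y \<in> p ` X"
  then obtain x where x: "x \<in> X" "y = chain_proj K x" using p by auto
  then show "y \<in> {\<Sum>s\<in>K. a s *\<^sub>R uvec K s | a. \<forall>s\<in>K. 0 \<le> a s}"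
    using nn[OF x(1)] unfolding chain_proj_def by (intro CollectI exI[of _ "\<lambda>s. x \<bullet> subset_vec s"] conjI) simp_all
next
  fix y assume "y \<in> {\<Sum>s\<in>K. a s *\<^sub>R uvec K s | a. \<forall>s\<in>K. 0 \<le> a s}"
  then obtain a where a: "y = (\<Sum>s\<in>K. a s *\<^sub>R uvec K s)" "\<forall>s\<in>K. 0 \<le> a s" by blast
  \<comment> \<open>\<open>ex\<close> asks for nonnegative values at every set, whereas a is known
    to be nonnegative only on K.\<close>
  obtain x where x: "x \<in> X" "\<forall>s\<in>K. x \<bullet> subset_vec s = max 0 (a s)" using ex[of "\<lambda>s. max 0 (a s)"] by auto
  have "y = p x" unfolding p[OF x(1)] chain_proj_def a(1) using x(2) a(2) by (intro sum.cong) auto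
  then show "y \<in> p ` X" using x(1) by blast
qed

lemma face_span_perp:
  assumes T: "pchain T" and I: "I \<subseteq> T" and k: "k \<in> insert UNIV (T - I)" and y: "y \<in> span (uvec T ` I)"
  shows "y \<bullet> subset_vec k = 0"
proof -
  have "subset_vec k \<bullet> v = 0" if v: "v \<in> uvec T ` I" for v
  proof -
    obtain s where s: "s \<in> I" "v = uvec T s" using v by blast
    then have sT: "s \<in> T" using I by blast
    show ?thesis
    proof (cases "k \<in> T - I")
      case True
      then have "k \<noteq> s" "k \<in> T" using s by auto
      then show ?thesis using uvec_inner_mem[OF T sT] s by (simp add: inner_commute)
    next
      case False
      then have "k = UNIV" using k by blast
      then show ?thesis using uvec_inner_UNIV[OF T sT] s by (simp add: inner_commute)
    qed
  qed
  then have "orthogonal (subset_vec k) y"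
    using orthogonal_to_span[OF y] by (simp add: orthogonal_def)
  then show ?thesis by (simp add: orthogonal_def inner_commute)
qed

text \<open>The generators of the face are orthogonal to e_k for k in T - I. Subtracting
  \<open>chain_proj\<close> makes all pairings with T - I vanish, so only basis vectors with index
  in I are left.\<close>

lemma perp_proj_face:
  assumes T: "pchain T" and I: "I \<subseteq> T" and x: "x \<in> chain_space T" "x \<bullet> subset_vec UNIV = 0"
  shows "perp_proj (span (uvec T ` I)) x = chain_proj (T - I) x"
proof -
  let ?K = "T - I"
  have K: "pchain ?K" using pchain_subset[OF T] by auto
  show ?thesis
  proof (rule perp_proj_chain[OF K subspace_span])
    show "y \<bullet> subset_vec k = 0" if "k \<in> insert UNIV ?K" "y \<in> span (uvec T ` I)" for k y
      by (rule face_span_perp[OF T I that])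
    let ?z = "x - chain_proj ?K x"
    have z1: "?z \<in> chain_space T"
      using x(1) sum_uvec_chain_space[OF K] chain_space_mono[of ?K T]
      unfolding chain_proj_def chain_space_def by (intro span_diff) auto
    have z2: "?z \<bullet> subset_vec UNIV = 0"
      using x(2) sum_uvec_inner_UNIV[OF K] by (simp add: chain_proj_def inner_diff_left)
    have z3: "?z \<bullet> subset_vec s = 0" if "s \<in> ?K" for s
      using sum_uvec_inner[OF K that] by (simp add: chain_proj_def inner_diff_left)
    have "?z = (\<Sum>s\<in>T. (?z \<bullet> subset_vec s) *\<^sub>R uvec T s)"
      by (rule chain_space_expand[OF T z1 z2])
    also have "\<dots> = (\<Sum>s\<in>I. (?z \<bullet> subset_vec s) *\<^sub>R uvec T s)"
      using I z3 by (intro sum.mono_neutral_right) auto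
    also have "\<dots> \<in> span (uvec T ` I)" by (intro span_sum span_scale span_base) auto
    finally show "?z \<in> span (uvec T ` I)" .
  qed
qed

lemma perp_proj_face_lattice:
  assumes T: "pchain T" and I: "I \<subseteq> T"
  shows "perp_proj (span (uvec T ` I)) ` chain_lattice T = chain_lattice (T - I)"
proof (rule image_chain_lattice)
  show "pchain (T - I)" using pchain_subset[OF T] by auto
  show "perp_proj (span (uvec T ` I)) x = chain_proj (T - I) x" if "x \<in> chain_lattice T" for x
    using that unfolding chain_lattice_eq[OF T]
    by (intro perp_proj_face[OF T I]) (auto simp: sum_uvec_chain_space[OF T] sum_uvec_inner_UNIV[OF T])
  show "x \<bullet> subset_vec s \<in> \<int>" if "x \<in> chain_lattice T" "s \<in> T - I" for x s
    using that unfolding chain_lattice_eq[OF T] by (auto simp: sum_uvec_inner[OF T])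
  show "\<exists>x\<in>chain_lattice T. \<forall>s\<in>T - I. x \<bullet> subset_vec s = of_int (k s)" for k
    unfolding chain_lattice_eq[OF T]
    by (intro bexI[of _ "\<Sum>s\<in>T. of_int (k s) *\<^sub>R uvec T s"]) (auto simp: sum_uvec_inner[OF T])
qed

lemma perp_proj_face_cone:
  assumes T: "pchain T" and I: "I \<subseteq> T"
  shows "perp_proj (span (uvec T ` I)) ` chain_cone T = chain_cone (T - I)"
proof (rule image_chain_cone)
  show "pchain (T - I)" using pchain_subset[OF T] by auto
  show "perp_proj (span (uvec T ` I)) x = chain_proj (T - I) x" if "x \<in> chain_cone T" for x
    using that unfolding chain_cone_eq[OF T]
    by (intro perp_proj_face[OF T I]) (auto simp: sum_uvec_chain_space[OF T] sum_uvec_inner_UNIV[OF T])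
  show "0 \<le> x \<bullet> subset_vec s" if "x \<in> chain_cone T" "s \<in> T - I" for x s
    using that unfolding chain_cone_eq[OF T] by (auto simp: sum_uvec_inner[OF T])
  show "\<exists>x\<in>chain_cone T. \<forall>s\<in>T - I. x \<bullet> subset_vec s = a s" if "\<And>s. 0 \<le> a s" for a
    unfolding chain_cone_eq[OF T] using that
    by (intro bexI[of _ "\<Sum>s\<in>T. a s *\<^sub>R uvec T s"]) (auto simp: sum_uvec_inner[OF T])
qed

section \<open>The root lattice and the cones of the braid fan\<close>

lemma root_vectors:
  assumes K: "pchain (K :: 'n::finite set set)"
  shows "\<exists>r. \<forall>s\<in>K. r s \<in> root_lattice \<and> (\<forall>t\<in>K. r s \<bullet> subset_vec t = (if t = s then 1 else 0))"
proof -
  have "\<exists>v. v \<in> root_lattice \<and> (\<forall>t\<in>K. v \<bullet> subset_vec t = (if t = s then 1 else 0))" if s: "s \<in> K" for s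
  proof -
    have g: "gap (pred_in s K) s (succ_in s K) K" by (rule pchain_gap[OF K s])
    \<comment> \<open>The root e_i - e_j is separated by s, while every other member of K contains
      both i and j or neither. This is the unimodularity of the cone.\<close>
    obtain i j where ij: "i \<in> s" "i \<notin> pred_in s K" "j \<in> succ_in s K" "j \<notin> s" using g unfolding gap_def by blast
    define v :: "real ^ 'n" where "v = axis i 1 - axis j 1"
    have vs: "v \<bullet> subset_vec t = (if i \<in> t then 1 else 0) - (if j \<in> t then 1 else 0)" for t
      unfolding v_def by (simp add: inner_diff_left inner_axis' subset_vec_def)
    have "(\<Sum>l\<in>UNIV. v $ l) = 0" using vs[of UNIV] by (simp add: inner_subset_vec)
    moreover have "v $ l \<in> \<int>" for l by (simp add: v_def axis_def)
    ultimately have "v \<in> root_lattice" by (simp add: root_lattice_def)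
    moreover have "v \<bullet> subset_vec t = (if t = s then 1 else 0)" if t: "t \<in> K" for t
    proof -
      have "t \<subseteq> pred_in s K \<or> t = s \<or> succ_in s K \<subseteq> t" "pred_in s K \<subset> s" "s \<subset> succ_in s K"
        using g t unfolding gap_def by auto
      then show ?thesis unfolding vs using ij by auto
    qed
    ultimately show ?thesis by blast
  qed
  then show ?thesis by (intro bchoice) blast
qed

lemma root_lattice_int_comb: "(\<And>s. s \<in> K \<Longrightarrow> r s \<in> root_lattice) \<Longrightarrow> (\<Sum>s\<in>K. of_int (k s) *\<^sub>R r s) \<in> root_lattice"
proof -
  assume r: "\<And>s. s \<in> K \<Longrightarrow> r s \<in> root_lattice"
  have "(\<Sum>i\<in>UNIV. (\<Sum>s\<in>K. of_int (k s) *\<^sub>R r s) $ i) = (\<Sum>s\<in>K. of_int (k s) * (\<Sum>i\<in>UNIV. r s $ i))"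
    by (simp add: sum_distrib_left sum.swap[of _ K])
  also have "\<dots> = 0" using r by (intro sum.neutral) (auto simp: root_lattice_def)
  finally show ?thesis using r by (auto simp: root_lattice_def intro!: Ints_sum Ints_mult)
qed

lemma span_root_lattice: "span root_lattice = {x :: real ^ 'n. x \<bullet> subset_vec UNIV = 0}"
proof (intro equalityI subsetI)
  fix x :: "real ^ 'n" assume x: "x \<in> span root_lattice"
  have "subspace {x :: real ^ 'n. x \<bullet> subset_vec UNIV = 0}"
    by (auto simp: subspace_def inner_add_left)
  moreover have "root_lattice \<subseteq> {x :: real ^ 'n. x \<bullet> subset_vec UNIV = 0}"
    by (auto simp: root_lattice_def inner_subset_vec)
  ultimately show "x \<in> {x. x \<bullet> subset_vec UNIV = 0}" using x span_minimal by blast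
next
  fix x :: "real ^ 'n" assume x: "x \<in> {x. x \<bullet> subset_vec UNIV = 0}"
  fix i0 :: 'n
  have "x = (\<Sum>i\<in>UNIV. (x $ i) *\<^sub>R axis i 1)"
    by (simp add: vec_eq_iff axis_def if_distrib cong: if_cong)
  also have "\<dots> = (\<Sum>i\<in>UNIV. (x $ i) *\<^sub>R (axis i 1 - axis i0 1)) + (\<Sum>i\<in>UNIV. x $ i) *\<^sub>R axis i0 1"
    by (simp add: scaleR_diff_right sum_subtractf scaleR_sum_left)
  also have "(\<Sum>i\<in>UNIV. x $ i) = 0" using x by (simp add: inner_subset_vec)
  finally have "x = (\<Sum>i\<in>UNIV. (x $ i) *\<^sub>R (axis i 1 - axis i0 1))" by simp
  moreover have "axis i 1 - axis i0 1 \<in> root_lattice" for i :: 'n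
    unfolding root_lattice_def by (auto simp: axis_def sum_subtractf)
  ultimately show "x \<in> span root_lattice" by (metis (no_types, lifting) span_sum span_scale span_base)
qed

lemma dual_cone_braid:
  fixes Ts :: "'n::finite set list"
  shows "dual_cone root_lattice (braid_cone Ts) = {m. m \<bullet> subset_vec UNIV = 0 \<and> (\<forall>s\<in>set Ts. 0 \<le> m \<bullet> subset_vec s)}"
proof -
  have "(\<forall>v\<in>braid_cone Ts. 0 \<le> m \<bullet> v) \<longleftrightarrow> (\<forall>s\<in>set Ts. 0 \<le> m \<bullet> subset_vec s)" if m: "m \<bullet> subset_vec UNIV = 0" for m :: "real ^ 'n"
  proof
    assume *: "\<forall>v\<in>braid_cone Ts. 0 \<le> m \<bullet> v"
    have "subset_vec s + 0 *\<^sub>R subset_vec UNIV \<in> braid_cone Ts" if "s \<in> set Ts" for s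
      using that hull_inc[of "subset_vec s" "subset_vec ` set Ts" convex_cone] unfolding braid_cone_def by blast
    then show "\<forall>s\<in>set Ts. 0 \<le> m \<bullet> subset_vec s" using * by fastforce
  next
    assume *: "\<forall>s\<in>set Ts. 0 \<le> m \<bullet> subset_vec s"
    show "\<forall>v\<in>braid_cone Ts. 0 \<le> m \<bullet> v"
    proof
      fix w assume "w \<in> braid_cone Ts"
      then obtain v t where w: "w = v + t *\<^sub>R subset_vec UNIV" and v: "v \<in> convex_cone hull (subset_vec ` set Ts)"
        unfolding braid_cone_def by blast
      have "finite (subset_vec ` set Ts)" by simp
      from v[unfolded cone_hull_finite[OF this]]
      obtain a where a: "v = (\<Sum>g\<in>subset_vec ` set Ts. a g *\<^sub>R g)" "\<forall>g\<in>subset_vec ` set Ts. 0 \<le> a g" by blast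
      have "0 \<le> m \<bullet> v" unfolding a(1) inner_sum_right
        using a(2) * by (intro sum_nonneg) auto
      then show "0 \<le> m \<bullet> w" using m by (simp add: w inner_add_right)
    qed
  qed
  then show ?thesis unfolding dual_cone_def span_root_lattice by auto
qed

text \<open>Only vectors of sum 0 are projected, and there the projection is governed by the
  pairings with the chain. Integer and nonnegative combinations of the roots from
  \<open>root_vectors\<close> realise all the values required.\<close>

lemma braid_projection:
  fixes Ts :: "'n::finite set list"
  assumes Ts: "Ts \<in> chains_of_subsets"
  defines "C \<equiv> dual_cone root_lattice (braid_cone Ts)"
  shows "perp_proj (lineality C) ` root_lattice = chain_lattice (set Ts)"
    and "perp_proj (lineality C) ` C = chain_cone (set Ts)"
proof -
  let ?K = "set Ts"
  have K: "pchain ?K" using Ts chain_set_list by (auto simp: pchain_def chains_of_subsets_def)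
  have C: "C = {m. m \<bullet> subset_vec UNIV = 0 \<and> (\<forall>s\<in>?K. 0 \<le> m \<bullet> subset_vec s)}"
    unfolding C_def by (rule dual_cone_braid)
  have L: "lineality C = {m. m \<bullet> subset_vec UNIV = 0 \<and> (\<forall>s\<in>?K. m \<bullet> subset_vec s = 0)}"
    unfolding lineality_def C by (auto intro: order.antisym)
  have sub: "subspace (lineality C)" unfolding L by (auto simp: subspace_def inner_add_left)
  have p: "perp_proj (lineality C) x = chain_proj ?K x" if x: "x \<bullet> subset_vec UNIV = 0" for x
  proof (rule perp_proj_chain[OF K sub])
    show "y \<bullet> subset_vec k = 0" if "k \<in> insert UNIV ?K" "y \<in> lineality C" for k y
      using that unfolding L by auto
    show "x - chain_proj ?K x \<in> lineality C"
      unfolding L using x by (auto simp: chain_proj_def inner_diff_left sum_uvec_inner[OF K] sum_uvec_inner_UNIV[OF K])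
  qed
  obtain r where r: "\<And>s. s \<in> ?K \<Longrightarrow> r s \<in> root_lattice"
    "\<And>s t. s \<in> ?K \<Longrightarrow> t \<in> ?K \<Longrightarrow> r s \<bullet> subset_vec t = (if t = s then 1 else 0)"
    using root_vectors[OF K] by metis
  have comb: "(\<Sum>s\<in>?K. a s *\<^sub>R r s) \<bullet> subset_vec t = a t" if "t \<in> ?K" for a t
  proof -
    have "(\<Sum>s\<in>?K. a s *\<^sub>R r s) \<bullet> subset_vec t = (\<Sum>s\<in>?K. if s = t then a t else 0)"
      unfolding inner_sum_left using that by (intro sum.cong) (auto simp: r(2))
    then show ?thesis using that by simp
  qed
  have root0: "x \<bullet> subset_vec UNIV = 0" if "x \<in> root_lattice" for x :: "real ^ 'n"
    using that by (simp add: root_lattice_def inner_subset_vec)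
  show "perp_proj (lineality C) ` root_lattice = chain_lattice ?K"
  proof (rule image_chain_lattice[OF K])
    show "x \<bullet> subset_vec s \<in> \<int>" if "x \<in> root_lattice" for x :: "real ^ 'n" and s
      using that by (auto simp: inner_subset_vec root_lattice_def intro: Ints_sum)
    show "\<exists>x\<in>root_lattice. \<forall>s\<in>?K. x \<bullet> subset_vec s = of_int (k s)" for k
      using comb root_lattice_int_comb[of ?K r k] r(1) by (intro bexI[of _ "\<Sum>s\<in>?K. of_int (k s) *\<^sub>R r s"]) auto
  qed (rule p[OF root0])
  show "perp_proj (lineality C) ` C = chain_cone ?K"
  proof (rule image_chain_cone[OF K])
    show "perp_proj (lineality C) x = chain_proj ?K x" if "x \<in> C" for x using that p unfolding C by blast
    show "0 \<le> x \<bullet> subset_vec s" if "x \<in> C" "s \<in> ?K" for x s using that unfolding C by blast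
    show "\<exists>x\<in>C. \<forall>s\<in>?K. x \<bullet> subset_vec s = a s" if "\<And>s. 0 \<le> a s" for a
    proof (rule bexI[of _ "\<Sum>s\<in>?K. a s *\<^sub>R r s"])
      have "(\<Sum>s\<in>?K. a s *\<^sub>R r s) \<bullet> subset_vec UNIV = 0"
        using root0[OF r(1)] by (simp add: inner_sum_left)
      then show "(\<Sum>s\<in>?K. a s *\<^sub>R r s) \<in> C" unfolding C using comb that by simp
    qed (simp add: comb)
  qed
qed

section \<open>The Berline-Vergne function of a chain\<close>

lemma chain_dual:
  assumes "pchain (T :: 'n::finite set set)"
  obtains d :: "real ^ 'n \<Rightarrow> real ^ 'n \<Rightarrow> real" where "\<And>b. linear (d b)"
    "\<And>b c. b \<in> uvec T ` T \<Longrightarrow> c \<in> uvec T ` T \<Longrightarrow> d b c = (if c = b then 1 else 0)"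
  using dual_basis[OF uvec_independent[OF assms]] by metis

lemma mu_facts:
  "\<exists>r>0. (\<forall>J :: 'n::finite set set. \<exists>B. majorized r (mu J) B) \<and>
     (\<forall>J :: 'n set set. \<forall>\<xi>. pchain J \<longrightarrow> box_pt r \<xi> \<longrightarrow> (\<forall>s\<in>J. lval \<xi> s J \<noteq> 0) \<longrightarrow>
       (\<Sum>K\<in>Pow J. (\<Prod>s\<in>K. lval \<xi> s J) * mu K \<xi>) = (\<Prod>s\<in>J. lval \<xi> s J / (1 - exp (- lval \<xi> s J))))"
proof -
  obtain \<rho> :: real where \<rho>: "0 < \<rho>" "summable (\<lambda>n. \<bar>rtodd (Suc n)\<bar> * \<rho> ^ n)"
    "\<And>y. y \<noteq> 0 \<Longrightarrow> \<bar>y\<bar> \<le> \<rho> \<Longrightarrow> (\<lambda>n. rtodd (Suc n) * y ^ n) sums ((y / (1 - exp (- y)) - 1) / y)"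
    using todd_series by metis
  \<comment> \<open>Each of the two terms in the condition on \<open>\<rho>\<close> is given one
    half of it.\<close>
  let ?r = "\<rho> / 4" and ?e = "\<rho> / (2 * real CARD('n set))"
  have c: "real CARD('n set) > 0" by (simp add: zero_less_card_finite del: card_UNIV_set)
  have re: "0 < ?r" "0 < ?e" using \<rho>(1) c by (simp_all del: card_UNIV_set)
  have "real CARD('n set) * ?e = \<rho> / 2" using c by (simp add: field_simps del: card_UNIV_set)
  then have le: "2 * ?r + real CARD('n set) * ?e \<le> \<rho>" by (simp del: card_UNIV_set)
  show ?thesis
    using re(1) mu_majorized[OF re le \<rho>(2)] mu_identity[OF re le \<rho>(2,3)]
    by (intro exI[of _ ?r]) blast
qed

lemma mu_analytic: "analytic_at_0 (mu (J :: 'n::finite set set))"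
  using mu_facts[where 'n='n] majorized_analytic by blast

text \<open>The Euler-Maclaurin formula evaluates the function of the quotient at a projected point.
  The span of the face is orthogonal to the space of T - I, so this function does not notice the
  projection.\<close>

lemma mu_face_proj:
  assumes T: "pchain T" and I: "I \<subseteq> T"
  shows "mu (T - I) (perp_proj (span (uvec T ` I)) \<xi>) = mu (T - I) \<xi>"
proof (rule mu_cong)
  fix K S assume K: "K \<subseteq> T - I" and S: "S \<in> K"
  have "pchain K" using pchain_subset[OF T] K by blast
  then have u: "uvec K S \<in> chain_space (T - I)"
    using uvec_chain_space S chain_space_mono[OF K] by blast
  show "perp_proj (span (uvec T ` I)) \<xi> \<bullet> uvec K S = \<xi> \<bullet> uvec K S"
  proof (rule perp_proj_inner[OF subspace_span])
    fix w assume "w \<in> span (uvec T ` I)"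
    then show "w \<bullet> uvec K S = 0"
      using chain_space_perp[OF _ u, of "span (uvec T ` I)" w] face_span_perp[OF T I] by blast
  qed
qed

lemma bij_chain_faces:
  assumes T: "pchain (T :: 'n::finite set set)"
  shows "bij_betw (\<lambda>I. convex_cone hull (uvec T ` I)) (Pow T - {{}})
    {F. F face_of chain_cone T \<and> F \<noteq> {} \<and> F \<noteq> {0}}"
proof -
  obtain d :: "real ^ 'n \<Rightarrow> real ^ 'n \<Rightarrow> real" where d: "\<And>b. linear (d b)"
    "\<And>b c. b \<in> uvec T ` T \<Longrightarrow> c \<in> uvec T ` T \<Longrightarrow> d b c = (if c = b then 1 else 0)"
    using chain_dual[OF T] by metis
  have b: "bij_betw ((`) (uvec T)) (Pow T - {{}}) (Pow (uvec T ` T) - {{}})"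
    unfolding bij_betw_def
  proof
    show "inj_on ((`) (uvec T)) (Pow T - {{}})"
      by (rule inj_on_subset[OF inj_on_image_Pow[OF uvec_inj[OF T]]]) blast
    show "(`) (uvec T) ` (Pow T - {{}}) = Pow (uvec T ` T) - {{}}"
    proof (intro equalityI subsetI)
      fix X assume X: "X \<in> Pow (uvec T ` T) - {{}}"
      then obtain I where "I \<subseteq> T" "X = uvec T ` I" by (auto simp: subset_image_iff)
      then show "X \<in> (`) (uvec T) ` (Pow T - {{}})" using X by blast
    qed auto
  qed
  show ?thesis
    using bij_betw_trans[OF b bij_proper_faces[OF uvec_independent[OF T] d]]
    unfolding chain_cone_def by (simp add: comp_def)
qed

lemma chain_face_cases:
  assumes "pchain T" "F face_of chain_cone T" "F \<noteq> {}" "F \<noteq> {0}"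
  obtains I where "I \<subseteq> T" "I \<noteq> {}" "F = convex_cone hull (uvec T ` I)"
proof -
  have "F \<in> (\<lambda>I. convex_cone hull (uvec T ` I)) ` (Pow T - {{}})"
    using bij_chain_faces[OF assms(1)] assms(2-4) unfolding bij_betw_def by blast
  then show ?thesis using that by blast
qed

lemma convergence_chain:
  assumes T: "pchain (T :: 'n::finite set set)"
  shows "convergence_domain (chain_cone T) = {\<xi>. \<forall>s\<in>T. \<xi> \<bullet> uvec T s < 0}"
proof -
  obtain d :: "real ^ 'n \<Rightarrow> real ^ 'n \<Rightarrow> real" where d: "\<And>b. linear (d b)"
    "\<And>b c. b \<in> uvec T ` T \<Longrightarrow> c \<in> uvec T ` T \<Longrightarrow> d b c = (if c = b then 1 else 0)"
    using chain_dual[OF T] by metis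
  show ?thesis
    unfolding convergence_domain_def chain_cone_def
  proof (rule Collect_cong)
    fix \<xi> :: "real ^ 'n"
    have "(\<forall>x\<in>convex_cone hull uvec T ` T. x \<noteq> 0 \<longrightarrow> \<xi> \<bullet> x < 0) \<longleftrightarrow> (\<forall>g\<in>uvec T ` T. \<xi> \<bullet> g < 0)"
      by (rule convergence_cone[OF uvec_independent[OF T] d])
    then show "(\<forall>x\<in>convex_cone hull uvec T ` T. x \<noteq> 0 \<longrightarrow> \<xi> \<bullet> x < 0) \<longleftrightarrow> (\<forall>s\<in>T. \<xi> \<bullet> uvec T s < 0)"
      by simp
  qed
qed

text \<open>Recovers the generators from the face, because \<open>BV_pointed\<close> wants the
  functions of the quotients as a family indexed by faces.\<close>

definition face_index :: "'n::finite set set \<Rightarrow> (real ^ 'n) set \<Rightarrow> 'n set set" where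
  "face_index T F = {s \<in> T. uvec T s \<in> F}"

lemma face_index_cone:
  assumes T: "pchain (T :: 'n::finite set set)" and I: "I \<subseteq> T"
  shows "face_index T (convex_cone hull (uvec T ` I)) = I"
proof -
  obtain d :: "real ^ 'n \<Rightarrow> real ^ 'n \<Rightarrow> real" where d: "\<And>b. linear (d b)"
    "\<And>b c. b \<in> uvec T ` T \<Longrightarrow> c \<in> uvec T ` T \<Longrightarrow> d b c = (if c = b then 1 else 0)"
    using chain_dual[OF T] by metis
  have "uvec T s \<in> convex_cone hull (uvec T ` I) \<longleftrightarrow> s \<in> I" if "s \<in> T" for s
    using gen_mem_cone_iff[OF uvec_independent[OF T] d, of "uvec T ` I" "uvec T s"] I that
      inj_on_image_mem_iff[OF uvec_inj[OF T] that I] by blast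
  then show ?thesis using I by (auto simp: face_index_def)
qed

lemma span_face: "span (convex_cone hull (uvec T ` I)) = span (uvec T ` (I :: 'n::finite set set))"
  by (rule span_cone_hull) simp

text \<open>This is \<open>mu_identity\<close> divided by the product of all y_s. The set K there is
  the complement of the index set I of a face: K belongs to the transverse cone, and the leftover
  product of 1 / y_s over I is the integral over the face.\<close>

lemma euler_maclaurin_chain:
  assumes T: "pchain (T :: 'n::finite set set)"
  shows "\<forall>\<^sub>F \<xi> in at 0 within convergence_domain (chain_cone T).
    cone_sum (chain_lattice T) (chain_cone T) \<xi> = mu T \<xi> +
      (\<Sum>F | F face_of chain_cone T \<and> F \<noteq> {} \<and> F \<noteq> {0}.
        mu (T - face_index T F) (perp_proj (span F) \<xi>) * cone_integral (chain_lattice T) F \<xi>)"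
proof -
  obtain r where r: "r > 0" "\<And>\<xi>. box_pt r \<xi> \<Longrightarrow> (\<forall>s\<in>T. lval \<xi> s T \<noteq> 0) \<Longrightarrow>
       (\<Sum>K\<in>Pow T. (\<Prod>s\<in>K. lval \<xi> s T) * mu K \<xi>) = (\<Prod>s\<in>T. lval \<xi> s T / (1 - exp (- lval \<xi> s T)))"
    using mu_facts[where 'n='n] T by blast
  obtain d :: "real ^ 'n \<Rightarrow> real ^ 'n \<Rightarrow> real" where d: "\<And>b. linear (d b)"
    "\<And>b c. b \<in> uvec T ` T \<Longrightarrow> c \<in> uvec T ` T \<Longrightarrow> d b c = (if c = b then 1 else 0)"
    using chain_dual[OF T] by metis
  have ind: "independent (uvec T ` T)" by (rule uvec_independent[OF T])
  have inj: "inj_on (uvec T) I" if "I \<subseteq> T" for I using uvec_inj[OF T] that inj_on_subset by blast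
  have main: "cone_sum (chain_lattice T) (chain_cone T) \<xi> = mu T \<xi> +
      (\<Sum>F | F face_of chain_cone T \<and> F \<noteq> {} \<and> F \<noteq> {0}.
        mu (T - face_index T F) (perp_proj (span F) \<xi>) * cone_integral (chain_lattice T) F \<xi>)"
    if \<xi>: "\<xi> \<in> convergence_domain (chain_cone T)" "norm \<xi> < r" for \<xi>
  proof -
    have neg: "\<xi> \<bullet> uvec T s < 0" if "s \<in> T" for s using \<xi>(1) that by (simp add: convergence_chain[OF T])
    let ?y = "\<lambda>s. lval \<xi> s T"
    have y0: "?y s \<noteq> 0" if "s \<in> T" for s using neg[OF that] by (simp add: lval_def)
    have "cone_sum (chain_lattice T) (chain_cone T) \<xi> = (\<Prod>g\<in>uvec T ` T. 1 / (1 - exp (\<xi> \<bullet> g)))"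
      unfolding cone_sum_def chain_cone_def chain_lattice_def
      by (rule cone_sum_simplicial[OF ind d]) (use neg in auto)
    also have "\<dots> = (\<Prod>s\<in>T. 1 / (1 - exp (- ?y s)))"
      by (simp add: prod.reindex[OF inj[OF subset_refl]] lval_def)
    finally have cs: "cone_sum (chain_lattice T) (chain_cone T) \<xi> = \<dots>" .
    have "(\<Prod>s\<in>T. ?y s) * cone_sum (chain_lattice T) (chain_cone T) \<xi> = (\<Prod>s\<in>T. ?y s / (1 - exp (- ?y s)))"
      unfolding cs by (simp add: prod.distrib[symmetric])
    also have "\<dots> = (\<Sum>K\<in>Pow T. (\<Prod>s\<in>K. ?y s) * mu K \<xi>)"
      using r(2)[of \<xi>] box_pt_ball[of \<xi> r] \<xi>(2) y0 by simp
    also have "\<dots> = (\<Sum>I\<in>Pow T. (\<Prod>s\<in>T - I. ?y s) * mu (T - I) \<xi>)"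
      by (rule sum.reindex_bij_witness[where i="\<lambda>I. T - I" and j="\<lambda>I. T - I"]) (auto simp: double_diff)
    also have "\<dots> = (\<Sum>I\<in>Pow T. (\<Prod>s\<in>T. ?y s) * (mu (T - I) \<xi> * (\<Prod>s\<in>I. 1 / ?y s)))"
    proof (rule sum.cong[OF refl])
      fix I assume I: "I \<in> Pow T"
      have "(\<Prod>s\<in>T. ?y s) = (\<Prod>s\<in>T - I. ?y s) * (\<Prod>s\<in>I. ?y s)"
        using I by (intro prod.subset_diff) auto
      moreover have "(\<Prod>s\<in>I. ?y s) * (\<Prod>s\<in>I. 1 / ?y s) = 1"
        unfolding prod.distrib[symmetric] using y0 I by (intro prod.neutral) auto
      ultimately show "(\<Prod>s\<in>T - I. ?y s) * mu (T - I) \<xi> = (\<Prod>s\<in>T. ?y s) * (mu (T - I) \<xi> * (\<Prod>s\<in>I. 1 / ?y s))"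
        by (simp add: mult_ac)
    qed
    also have "\<dots> = (\<Prod>s\<in>T. ?y s) * (\<Sum>I\<in>Pow T. mu (T - I) \<xi> * (\<Prod>s\<in>I. 1 / ?y s))"
      by (rule sum_distrib_left[symmetric])
    finally have "cone_sum (chain_lattice T) (chain_cone T) \<xi> = (\<Sum>I\<in>Pow T. mu (T - I) \<xi> * (\<Prod>s\<in>I. 1 / ?y s))"
      using y0 by (simp add: prod_zero_iff)
    also have "\<dots> = mu T \<xi> + (\<Sum>I\<in>Pow T - {{}}. mu (T - I) \<xi> * (\<Prod>s\<in>I. 1 / ?y s))"
      by (subst sum.remove[of _ "{}"]) auto
    also have "(\<Sum>I\<in>Pow T - {{}}. mu (T - I) \<xi> * (\<Prod>s\<in>I. 1 / ?y s)) =
        (\<Sum>I\<in>Pow T - {{}}. mu (T - face_index T (convex_cone hull (uvec T ` I))) (perp_proj (span (convex_cone hull (uvec T ` I))) \<xi>) *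
           cone_integral (chain_lattice T) (convex_cone hull (uvec T ` I)) \<xi>)"
    proof (rule sum.cong[OF refl])
      fix I assume "I \<in> Pow T - {{}}"
      then have I: "I \<subseteq> T" by blast
      have "independent (uvec T ` I)" using ind I by (meson image_mono independent_mono)
      moreover have "chain_lattice T \<inter> span (uvec T ` I) = int_span (uvec T ` I)"
        unfolding chain_lattice_def using I by (intro int_span_Int_span[OF ind d]) auto
      ultimately have "cone_integral (chain_lattice T) (convex_cone hull (uvec T ` I)) \<xi> = (\<Prod>g\<in>uvec T ` I. - 1 / (\<xi> \<bullet> g))"
        using neg I by (intro cone_integral_simplicial) auto
      also have "\<dots> = (\<Prod>s\<in>I. 1 / ?y s)"
        by (simp add: prod.reindex[OF inj[OF I]] lval_def)
      finally show "mu (T - I) \<xi> * (\<Prod>s\<in>I. 1 / ?y s) =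
          mu (T - face_index T (convex_cone hull (uvec T ` I))) (perp_proj (span (convex_cone hull (uvec T ` I))) \<xi>) *
           cone_integral (chain_lattice T) (convex_cone hull (uvec T ` I)) \<xi>"
        by (simp add: face_index_cone[OF T I] span_face mu_face_proj[OF T I])
    qed
    also have "\<dots> = (\<Sum>F | F face_of chain_cone T \<and> F \<noteq> {} \<and> F \<noteq> {0}.
        mu (T - face_index T F) (perp_proj (span F) \<xi>) * cone_integral (chain_lattice T) F \<xi>)"
      by (rule sum.reindex_bij_betw[OF bij_chain_faces[OF T]])
    finally show ?thesis .
  qed
  show ?thesis
    unfolding eventually_at using main r(1) by (intro exI[of _ r]) (auto simp: dist_norm)
qed

lemma rational_chain_cone:
  assumes T: "pchain (T :: 'n::finite set set)"
  shows "rational_cone (chain_lattice T) (chain_cone T)" "lineality (chain_cone T) = {0}"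
proof -
  obtain d :: "real ^ 'n \<Rightarrow> real ^ 'n \<Rightarrow> real" where d: "\<And>b. linear (d b)"
    "\<And>b c. b \<in> uvec T ` T \<Longrightarrow> c \<in> uvec T ` T \<Longrightarrow> d b c = (if c = b then 1 else 0)"
    using chain_dual[OF T] by metis
  have "lattice_basis (chain_lattice T) (uvec T ` T)"
    using uvec_independent[OF T] by (simp add: lattice_basis_iff chain_lattice_def)
  moreover have "uvec T ` T \<subseteq> chain_lattice T"
  proof
    fix v assume "v \<in> uvec T ` T"
    then obtain s where s: "s \<in> T" "v = uvec T s" by blast
    have "v = (\<Sum>t\<in>T. of_int (if t = s then 1 else 0) *\<^sub>R uvec T t)"
      using s by (simp add: if_distrib if_distribR cong: if_cong)
    then show "v \<in> chain_lattice T" unfolding chain_lattice_eq[OF T] by (intro CollectI exI conjI, assumption) simp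
  qed
  ultimately show "rational_cone (chain_lattice T) (chain_cone T)"
    unfolding rational_cone_def chain_cone_def by (intro conjI exI[of _ "uvec T ` T"]) auto
  show "lineality (chain_cone T) = {0}"
    unfolding lineality_def chain_cone_def by (rule lineality_cone[OF uvec_independent[OF T] d])
qed

lemma face_quotient:
  assumes T: "pchain T" and F: "F face_of chain_cone T" "F \<noteq> {}" "F \<noteq> {0}"
  shows "perp_proj (span F) ` chain_lattice T = chain_lattice (T - face_index T F)"
    and "perp_proj (span F) ` chain_cone T = chain_cone (T - face_index T F)"
    and "card (T - face_index T F) < card T"
    and "pchain (T - face_index T F)"
proof -
  obtain I where I: "I \<subseteq> T" "I \<noteq> {}" "F = convex_cone hull (uvec T ` I)"
    using chain_face_cases[OF T F] .
  have fi: "face_index T F = I" unfolding I(3) by (rule face_index_cone[OF T I(1)])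
  show "perp_proj (span F) ` chain_lattice T = chain_lattice (T - face_index T F)"
    "perp_proj (span F) ` chain_cone T = chain_cone (T - face_index T F)"
    unfolding fi unfolding I(3) span_face
    using perp_proj_face_lattice[OF T I(1)] perp_proj_face_cone[OF T I(1)] by auto
  show "card (T - face_index T F) < card T"
    unfolding fi using I(1,2) by (intro psubset_card_mono) auto
  show "pchain (T - face_index T F)" using pchain_subset[OF T] by blast
qed

text \<open>Quotients by nonzero faces are again cones of subchains, with fewer generators, so their
  functions are available by induction.\<close>

lemma BV_mu:
  assumes "pchain (T :: 'n::finite set set)"
  shows "BV (chain_lattice T) (chain_cone T) (mu T)"
  using assms
proof (induction "card T" arbitrary: T rule: less_induct)
  case less
  note T = \<open>pchain T\<close>
  show ?case
  proof (rule BV_pointed[where h="\<lambda>F. mu (T - face_index T F)"])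
    show "BV (perp_proj (span F) ` chain_lattice T) (perp_proj (span F) ` chain_cone T) (mu (T - face_index T F))"
      if "F face_of chain_cone T" "F \<noteq> {}" "F \<noteq> {0}" for F
      unfolding face_quotient(1,2)[OF T that]
      by (rule less.hyps) (use face_quotient(3,4)[OF T that] in auto)
  qed (use rational_chain_cone[OF T] mu_analytic euler_maclaurin_chain[OF T] in auto)
qed

text \<open>By induction two solutions have the same face terms near 0, so their difference is
  analytic and vanishes near 0 on the convergence domain. That domain is an open cone, hence the
  difference is the zero germ.\<close>

lemma BV_unique:
  assumes "pchain (T :: 'n::finite set set)" "BV (chain_lattice T) (chain_cone T) g"
  shows "\<exists>e>0. \<forall>\<xi>\<in>ball 0 e. g \<xi> = mu T \<xi>"
  using assms
proof (induction "card T" arbitrary: T g rule: less_induct)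
  case less
  note T = \<open>pchain T\<close>
  let ?L = "chain_lattice T" and ?C = "chain_cone T"
  let ?F = "{F. F face_of ?C \<and> F \<noteq> {} \<and> F \<noteq> {0}}"
  \<comment> \<open>The rule for cones containing a line is excluded by the trivial lineality space
    of the cone.\<close>
  obtain h where g: "analytic_at_0 g"
    and h: "\<And>F. F \<in> ?F \<Longrightarrow> BV (perp_proj (span F) ` ?L) (perp_proj (span F) ` ?C) (h F)"
    and em: "\<forall>\<^sub>F \<xi> in at 0 within convergence_domain ?C. cone_sum ?L ?C \<xi> = g \<xi> +
         (\<Sum>F\<in>?F. h F (perp_proj (span F) \<xi>) * cone_integral ?L F \<xi>)"
    using less.prems(2) rational_chain_cone(2)[OF T] by (cases rule: BV.cases) auto
  have hm: "\<forall>\<^sub>F \<xi> in at 0 within convergence_domain ?C. h F (perp_proj (span F) \<xi>) = mu (T - face_index T F) (perp_proj (span F) \<xi>)"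
    if F: "F \<in> ?F" for F
  proof -
    have F': "F face_of ?C" "F \<noteq> {}" "F \<noteq> {0}" using F by auto
    have "BV (chain_lattice (T - face_index T F)) (chain_cone (T - face_index T F)) (h F)"
      using h[OF F] unfolding face_quotient(1,2)[OF T F'] .
    from less.hyps[OF face_quotient(3,4)[OF T F'] this]
    obtain e where e: "e > 0" "\<And>\<xi>. norm \<xi> < e \<Longrightarrow> h F \<xi> = mu (T - face_index T F) \<xi>" by auto
    \<comment> \<open>Orthogonal projection does not increase the norm, so agreement on a ball
      passes to projected arguments.\<close>
    have "h F (perp_proj (span F) \<xi>) = mu (T - face_index T F) (perp_proj (span F) \<xi>)" if "norm \<xi> < e" for \<xi>
      using norm_perp_proj_le[OF subspace_span[of F], of \<xi>] that by (intro e(2)) simp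
    then show ?thesis unfolding eventually_at using e(1) by (auto simp: dist_norm)
  qed
  have finF: "finite ?F"
    using bij_betw_finite[OF bij_chain_faces[OF T]] by simp
  have "\<forall>\<^sub>F \<xi> in at 0 within convergence_domain ?C. \<forall>F\<in>?F.
      h F (perp_proj (span F) \<xi>) = mu (T - face_index T F) (perp_proj (span F) \<xi>)"
    by (rule eventually_ball_finite[OF finF]) (use hm in blast)
  from eventually_conj[OF this eventually_conj[OF em euler_maclaurin_chain[OF T]]]
  have z: "\<forall>\<^sub>F \<xi> in at 0 within convergence_domain ?C. g \<xi> - mu T \<xi> = 0"
  proof (rule eventually_mono, elim conjE)
    fix \<xi>
    assume eq: "\<forall>F\<in>?F. h F (perp_proj (span F) \<xi>) = mu (T - face_index T F) (perp_proj (span F) \<xi>)"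
      and 1: "cone_sum ?L ?C \<xi> = g \<xi> + (\<Sum>F\<in>?F. h F (perp_proj (span F) \<xi>) * cone_integral ?L F \<xi>)"
      and 2: "cone_sum ?L ?C \<xi> = mu T \<xi> + (\<Sum>F\<in>?F. mu (T - face_index T F) (perp_proj (span F) \<xi>) * cone_integral ?L F \<xi>)"
    have "(\<Sum>F\<in>?F. h F (perp_proj (span F) \<xi>) * cone_integral ?L F \<xi>) =
        (\<Sum>F\<in>?F. mu (T - face_index T F) (perp_proj (span F) \<xi>) * cone_integral ?L F \<xi>)"
      by (rule sum.cong) (use eq in auto)
    then show "g \<xi> - mu T \<xi> = 0" using 1 2 by linarith
  qed
  have "\<exists>e>0. \<forall>\<xi>\<in>ball 0 e. g \<xi> - mu T \<xi> = 0"
  proof (rule analytic_zero_on_cone[OF analytic_at_0_diff[OF g mu_analytic] _ _ _ z])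
    have "convergence_domain ?C = (\<Inter>s\<in>T. {\<xi>. \<xi> \<bullet> uvec T s < 0})" by (auto simp: convergence_chain[OF T])
    then show "open (convergence_domain ?C)" by (auto intro!: open_INT open_Collect_less continuous_intros)
    \<comment> \<open>The negated sum of the e_t thus pairs to -1 with every generator, which shows
      the convergence domain to be nonempty.\<close>
    have "(\<Sum>t\<in>T. subset_vec t) \<bullet> uvec T s = 1" if "s \<in> T" for s
    proof -
      have "(\<Sum>t\<in>T. subset_vec t) \<bullet> uvec T s = (\<Sum>t\<in>T. if t = s then 1 else 0)"
        unfolding inner_sum_left using that uvec_inner_mem[OF T that] by (intro sum.cong) (auto simp: inner_commute)
      then show ?thesis using that by simp
    qed
    then show "- (\<Sum>t\<in>T. subset_vec t) \<in> convergence_domain ?C" by (simp add: convergence_chain[OF T])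
    show "t *\<^sub>R x \<in> convergence_domain ?C" if "x \<in> convergence_domain ?C" "t > 0" for x t
      using that by (simp add: convergence_chain[OF T] mult_pos_neg)
  qed
  then show ?case by simp
qed

text \<open>The function is unique only as a germ, but this fixes its value at 0, which is all that
  the definite description in \<open>alpha_BV\<close> asks for.\<close>

theorem alpha_BV_eq:
  assumes Ts: "Ts \<in> (chains_of_subsets :: 'n::finite set list set)"
  shows "alpha_BV root_lattice (braid_cone Ts) = of_rat (alpha Ts)"
proof -
  have T: "pchain (set Ts)" using Ts chain_set_list by (auto simp: pchain_def chains_of_subsets_def)
  have "(THE a. \<exists>g. BV (chain_lattice (set Ts)) (chain_cone (set Ts)) g \<and> g 0 = a) = mu (set Ts) 0"
  proof (rule the_equality)
    show "\<exists>g. BV (chain_lattice (set Ts)) (chain_cone (set Ts)) g \<and> g 0 = mu (set Ts) 0"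
      using BV_mu[OF T] by blast
    fix a assume "\<exists>g. BV (chain_lattice (set Ts)) (chain_cone (set Ts)) g \<and> g 0 = a"
    then obtain g where g: "BV (chain_lattice (set Ts)) (chain_cone (set Ts)) g" "g 0 = a" by blast
    then show "a = mu (set Ts) 0" using BV_unique[OF T g(1)] by force
  qed
  then show ?thesis
    unfolding alpha_BV_def Let_def braid_projection[OF Ts] by (simp add: mu_0[OF Ts])
qed

theorem theorem4p4:
  shows "(todd_class :: 'n::finite set_poly set) =
      chow_class (\<Sum>Ts\<in>chains_of_subsets. const (alpha Ts) * chain_monomial Ts)
    \<and> (\<forall>Ts \<in> (chains_of_subsets :: 'n set list set).
         of_rat (alpha Ts) = alpha_BV root_lattice (braid_cone Ts))"
  by (intro conjI ballI todd_class_eq alpha_BV_eq[symmetric])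

end
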